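(* Assume (R1). Let $n\ge1$ be an integer, $m\in\{1,2,3,\dots\}\cup\{\infty\}$, $t_k=\frac{kT}n$ for $0\le k\le n$, and let $\rho$ satisfy $$0\le\rho\le\frac{9mn^2}{4T^2(m-1)\left(C_A[\dot b]_\infty\sqrt{3d(2m-1)/m}+C_BT^{3/2}\sqrt{2(m-1)/m}\right)^2},$$ where $C_A=\sqrt T+[\dot b]_\infty\int_0^Te^{[\dot b]_\infty(T-t)}\sqrt t\,dt$ and $C_B=e^{T[\dot b]_\infty}([\dot b]_\infty^2+a_{\Delta b})$. Then for all $x\ge0$, $$\mathbb E\left[\exp\left\{\rho\left(\frac{(m-1)T^2x}{2mn}+\max_{1\le k\le n}|X^{mn}_{t_k}-X^n_{t_k}|\right)^2\right\}\right]\le\exp\left\{\rho\,C_U(x)\frac{(m-1)T^2}{mn^2}\right\},$$ where, with $\tilde x=\frac{[\dot b]_\infty e^{-[\dot b]_\infty T}}{[\dot b]_\infty^2+a_{\Delta b}}x$, $$C_U(x)=\left(C_A[\dot b]_\infty\sqrt{\tfrac{3d(2m-1)}m}+C_BT^{3/2}\sqrt{\tfrac{2(m-1)}m}\right)\Bigg(C_A[\dot b]_\infty\frac{2\ln2}{3\sqrt3}\sqrt{\tfrac{d(2m-1)}m}+C_B\sqrt{\tfrac{(m-1)T}{2m}}\bigg(\frac{(3d+1)(|b(x_0)|+[\dot b]_\infty+\tilde x)^2}{4[\dot b]_\infty^2}+\frac{4d\sqrt T(|b(x_0)|+[\dot b]_\infty+\tilde x)}{3\sqrt\pi[\dot b]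_\infty}+\frac{4dT\ln2}9\bigg)\Bigg).$$
   Context: $d\ge1$, $T\in(0,\infty)$, $x_0\in\mathbb R^d$, $W$ is a $d$-dimensional Brownian motion, $b:\mathbb R^d\to\mathbb R^d$, and $X$ solves $dX_t=b(X_t)dt+dW_t$, $X_0=x_0$. For an integer $n\ge1$, $X^n$ is the Euler scheme driven by the same $W$: $dX^n_t=b(X^n_{\eta_n(t)})dt+dW_t$, $X^n_0=x_0$, $\eta_n(t)=\lfloor nt/T\rfloor T/n$. When $m=\infty$, $X^{mn}$ means $X$, and by convention $\frac m{m-1}=\frac{m-1}m=1$ and $\frac{2m-1}m=2$. When $m=1$ the upper bound on $\rho$ is read as $+\infty$. $|\cdot|$ is the Euclidean norm, $\|\cdot\|$ the induced matrix norm, $\nabla b$ the Jacobian matrix, $\Delta b$ the coordinatewise Laplacian. Assumption (R1): $b\in\mathscr C^2(\mathbb R^d,\mathbb R^d)$ and there are constants $[\dot b]_\infty\in(0,\infty)$, $a_{\Delta b}\in[0,\infty)$ such that for all $x\in\mathbb R^d$, $\|\nabla b(x)\|\le[\dot b]_\infty$ and $|\Delta b(x)|\le2a_{\Delta b}(1+|x-x_0|)$. *)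

theory Defs
  imports "HOL-Probability.Probability" "HOL-Library.Extended_Nat"
begin

definition C2 :: "('a::real_normed_vector \<Rightarrow> 'b::real_normed_vector) \<Rightarrow> bool" where
  "C2 f \<longleftrightarrow> (\<exists>(f' :: 'a \<Rightarrow> 'a \<Rightarrow>\<^sub>L 'b) (f'' :: 'a \<Rightarrow> 'a \<Rightarrow>\<^sub>L ('a \<Rightarrow>\<^sub>L 'b)).
     (\<forall>x. (f has_derivative blinfun_apply (f' x)) (at x)) \<and>
     (\<forall>x. (f' has_derivative blinfun_apply (f'' x)) (at x)) \<and>
     continuous_on UNIV f'')"

definition partial_deriv :: "'d::finite \<Rightarrow> (real^'d \<Rightarrow> real) \<Rightarrow> real^'d \<Rightarrow> real" where
  "partial_deriv i f x = deriv (\<lambda>s. f (x + s *\<^sub>R axis i 1)) 0"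

definition laplacian :: "(real^'d::finite \<Rightarrow> real) \<Rightarrow> real^'d \<Rightarrow> real" where
  "laplacian f x = (\<Sum>i\<in>UNIV. partial_deriv i (partial_deriv i f) x)"

definition vec_laplacian :: "(real^'d::finite \<Rightarrow> real^'d) \<Rightarrow> real^'d \<Rightarrow> real^'d" where
  "vec_laplacian b x = (\<chi> j. laplacian (\<lambda>y. b y $ j) x)"

definition matrix_norm :: "real^'d^'d::finite \<Rightarrow> real" where
  "matrix_norm A = onorm (\<lambda>v. A *v v)"

definition R1 :: "(real^'d::finite \<Rightarrow> real^'d) \<Rightarrow> real^'d \<Rightarrow> real \<Rightarrow> real \<Rightarrow> bool" where
  "R1 b x0 L a \<longleftrightarrow> C2 b \<and> 0 < L \<and> 0 \<le> a \<and>
     (\<forall>x. matrix_norm (jacobian b (at x)) \<le> L) \<and>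
     (\<forall>x. norm (vec_laplacian b x) \<le> 2 * a * (1 + norm (x - x0)))"

definition brownian_motion :: "'w measure \<Rightarrow> (real \<Rightarrow> 'w \<Rightarrow> real^'d::finite) \<Rightarrow> bool" where
  "brownian_motion M W \<longleftrightarrow> prob_space M \<and>
     (\<forall>t\<ge>0. W t \<in> borel_measurable M) \<and>
     (AE \<omega> in M. W 0 \<omega> = 0) \<and>
     (AE \<omega> in M. continuous_on {0..} (\<lambda>t. W t \<omega>)) \<and>
     (\<forall>s t. 0 \<le> s \<and> s < t \<longrightarrow>
        distributed M lborel (\<lambda>\<omega>. W t \<omega> - W s \<omega>)
          (\<lambda>x. ennreal (\<Prod>i\<in>UNIV. normal_density 0 (sqrt (t - s)) (x $ i)))) \<and>
     (\<forall>(\<tau> :: nat \<Rightarrow> real) k. 0 \<le> \<tau> 0 \<and> (\<forall>i<k. \<tau> i < \<tau> (Suc i)) \<longrightarrow>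
        prob_space.indep_vars M (\<lambda>_. borel) (\<lambda>i \<omega>. W (\<tau> (Suc i)) \<omega> - W (\<tau> i) \<omega>) {..<k})"

text \<open>
  A continuous process \<open>Y\<close> on \<open>[0, T]\<close> with \<open>Y\<^sub>t = x\<^sub>0 + \<integral>\<^sub>0\<^sup>t b (Y\<^bsub>\<eta>(s)\<^esub>) ds + W\<^sub>t\<close>. Since the noise
  is additive, the equation is understood path by path, and no stochastic integral is needed. For
  the two time changes used below and a Lipschitz drift, solutions are unique up to
  indistinguishability, so adaptedness to the (completed) filtration of \<open>W\<close> is automatic.
\<close>
definition solves_additive_sde ::
  "'w measure \<Rightarrow> (real \<Rightarrow> 'w \<Rightarrow> real^'d::finite) \<Rightarrow> real \<Rightarrow> (real^'d \<Rightarrow> real^'d) \<Rightarrow> real^'d \<Rightarrow>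
   (real \<Rightarrow> real) \<Rightarrow> (real \<Rightarrow> 'w \<Rightarrow> real^'d) \<Rightarrow> bool" where
  "solves_additive_sde M W T b x0 \<eta> Y \<longleftrightarrow>
     (\<forall>t\<in>{0..T}. Y t \<in> borel_measurable M) \<and>
     (AE \<omega> in M. continuous_on {0..T} (\<lambda>t. Y t \<omega>) \<and>
        (\<forall>t\<in>{0..T}. (\<lambda>s. b (Y (\<eta> s) \<omega>)) integrable_on {0..t} \<and>
           Y t \<omega> = x0 + integral {0..t} (\<lambda>s. b (Y (\<eta> s) \<omega>)) + W t \<omega>))"

definition sde_solution where
  "sde_solution M W T b x0 X \<longleftrightarrow> solves_additive_sde M W T b x0 (\<lambda>t. t) X"

definition eta :: "real \<Rightarrow> nat \<Rightarrow> real \<Rightarrow> real" where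
  "eta T n t = of_int \<lfloor>real n * t / T\<rfloor> * T / real n"

definition euler_scheme where
  "euler_scheme M W T b x0 n Y \<longleftrightarrow> solves_additive_sde M W T b x0 (eta T n) Y"

text \<open>
  At \<open>m = \<infinity>\<close> the ratios take their limits. The value of \<open>m / (m - 1)\<close> at \<open>m = 1\<close> is meaningless: there
  the upper bound on \<open>\<rho>\<close> is \<open>+\<infinity>\<close>, and \<open>rho_bound\<close> must not be imposed.
\<close>
definition m_over_pred :: "enat \<Rightarrow> real" where
  "m_over_pred m = (case m of enat k \<Rightarrow> real k / (real k - 1) | \<infinity> \<Rightarrow> 1)"

definition pred_over_m :: "enat \<Rightarrow> real" where
  "pred_over_m m = (case m of enat k \<Rightarrow> (real k - 1) / real k | \<infinity> \<Rightarrow> 1)"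

definition double_pred_over_m :: "enat \<Rightarrow> real" where
  "double_pred_over_m m = (case m of enat k \<Rightarrow> (2 * real k - 1) / real k | \<infinity> \<Rightarrow> 2)"

text \<open>The process \<open>X\<^bsup>mn\<^esup>\<close>, given the solution \<open>X\<close> and the family \<open>XE\<close> of Euler schemes.\<close>
definition fine_process :: "(real \<Rightarrow> 'w \<Rightarrow> 'b) \<Rightarrow> (nat \<Rightarrow> real \<Rightarrow> 'w \<Rightarrow> 'b) \<Rightarrow> enat \<Rightarrow> nat \<Rightarrow> real \<Rightarrow> 'w \<Rightarrow> 'b"
  where "fine_process X XE m n = (case m of enat k \<Rightarrow> XE (k * n) | \<infinity> \<Rightarrow> X)"

definition C_A :: "real \<Rightarrow> real \<Rightarrow> real" where
  "C_A T L = sqrt T + L * integral {0..T} (\<lambda>t. exp (L * (T - t)) * sqrt t)"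

definition C_B :: "real \<Rightarrow> real \<Rightarrow> real \<Rightarrow> real" where
  "C_B T L a = exp (T * L) * (L\<^sup>2 + a)"

text \<open>The factor common to the bound on \<open>\<rho>\<close> and to \<open>C\<^sub>U\<close>.\<close>
definition C_AB :: "real \<Rightarrow> real \<Rightarrow> real \<Rightarrow> nat \<Rightarrow> enat \<Rightarrow> real" where
  "C_AB T L a d m =
     C_A T L * L * sqrt (3 * real d * double_pred_over_m m)
     + C_B T L a * T powr (3/2) * sqrt (2 * pred_over_m m)"

definition rho_bound :: "real \<Rightarrow> real \<Rightarrow> real \<Rightarrow> nat \<Rightarrow> enat \<Rightarrow> nat \<Rightarrow> real" where
  "rho_bound T L a d m n =
     9 * m_over_pred m * (real n)\<^sup>2 / (4 * T\<^sup>2 * (C_AB T L a d m)\<^sup>2)"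

definition x_tilde :: "real \<Rightarrow> real \<Rightarrow> real \<Rightarrow> real \<Rightarrow> real" where
  "x_tilde T L a x = L * exp (- L * T) / (L\<^sup>2 + a) * x"

text \<open>The argument \<open>\<beta>\<close> stands for \<open>|b(x\<^sub>0)|\<close>.\<close>
definition C_U :: "real \<Rightarrow> real \<Rightarrow> real \<Rightarrow> nat \<Rightarrow> real \<Rightarrow> enat \<Rightarrow> real \<Rightarrow> real" where
  "C_U T L a d \<beta> m x =
     C_AB T L a d m *
     (C_A T L * L * (2 * ln 2 / (3 * sqrt 3)) * sqrt (real d * double_pred_over_m m)
      + C_B T L a * sqrt (pred_over_m m * T / 2) *
        ((3 * real d + 1) * (\<beta> + L + x_tilde T L a x)\<^sup>2 / (4 * L\<^sup>2)
         + 4 * real d * sqrt T * (\<beta> + L + x_tilde T L a x) / (3 * sqrt pi * L)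
         + 4 * real d * T * ln 2 / 9))"

end

theory Submission
  imports Defs
begin

text \<open>
Write the difference of the two schemes at the coarse times by Abel summation in terms of the increments of \<open>b\<close> along
the finer one. On a grid that is \<open>p\<close> times finer still, each increment of \<open>b\<close> is a martingale increment
\<open>\<nabla>b dW\<close>, a drift \<open>\<nabla>b b + \<Delta>b / 2\<close> and an Ito remainder, whose weighted sum tends to \<open>0\<close> in
probability as \<open>p\<close> grows; thus no stochastic integral is needed. Gronwall's lemma bounds the difference by a
mixture of maxima of martingale transforms and of maxima of the Brownian path. The transforms have conditionally
Gaussian increments with bounded variance, so the potential of the reflection principle gives their running maxima twice
the Gaussian tail; Levy's inequality does the same for the Brownian path. These tails yield exponential moments of the
squares, and convexity of the exponential combines them with exactly the weights that appear in the constants. Fatou's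
lemma removes the remainder, and, when \<open>m = \<infinity>\<close>, lets the ratio of the two step sizes tend to infinity.
\<close>

section \<open>Gaussian tails and the reflection principle\<close>

text \<open>As \<open>\<rho>\<close> tends to 0 both sides of the claim tend to 1, so no bound with
  a prefactor, such as the 2 of a reflection inequality, is good enough. The way out is that the
  doubling affects only tails at positive levels, while the value at level 0 is counted once. This
  leaves \<open>2 * E - 1\<close> for a Gaussian moment \<open>E\<close> that is close to 1, hence
  an exponential without prefactor; every \<open>ln 2\<close> in the constants has this origin. The
  Gaussian estimates hold for parameters up to 1/8. The parameter in question is
  \<open>\<rho> * (K1 + K2)\<^sup>2\<close> with
  \<open>K1 + K2 = T / n * sqrt u * C_AB / sqrt 18\<close>, where \<open>u\<close> is
  \<open>(m - 1) / m\<close>, so the assumed bound on \<open>\<rho>\<close> is precisely this range,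
  and 18 / 8 is its factor 9/4. The constants are total masses of mixtures: a maximum up to time
  \<open>t\<close> has size \<open>sqrt t\<close>, which the weights of Gronwall's lemma integrate
  to \<open>C_A\<close>, and whose average over \<open>[0, T]\<close> is
  \<open>2 / 3 * sqrt T\<close>. The shift by \<open>x\<close> is treated as an increase of
  \<open>|b(x0)|\<close> by \<open>x_tilde\<close>.\<close>

abbreviation gamma1 :: "real measure" where "gamma1 \<equiv> std_normal_distribution"

text \<open>An image measure rather than a density, so that \<open>s = 0\<close> (the Dirac mass at
  0) is allowed: the vector whose inner product with an increment is taken may vanish.\<close>

definition gauss :: "real \<Rightarrow> real measure" where
  "gauss s = distr gamma1 borel (\<lambda>z. s * z)"

lemma prob_space_gamma1: "prob_space gamma1"
  by (rule prob_space_normal_density) simp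

lemma sets_gauss [simp, measurable_cong]: "sets (gauss s) = sets borel"
  and space_gauss [simp]: "space (gauss s) = UNIV"
  by (simp_all add: gauss_def)

lemma real_distribution_gauss: "real_distribution (gauss s)"
  unfolding gauss_def
  by (intro prob_space.real_distribution_distr prob_space_gamma1) simp

lemma nn_integral_gauss:
  "f \<in> borel_measurable borel \<Longrightarrow> (\<integral>\<^sup>+x. f x \<partial>gauss s) = (\<integral>\<^sup>+z. f (s * z) \<partial>gamma1)"
  unfolding gauss_def by (subst nn_integral_distr) auto

lemma char_gauss: "char (gauss s) t = exp (- ((s * t)\<^sup>2) / 2)"
proof -
  have "char (gauss s) t = char gamma1 (s * t)"
    unfolding char_def gauss_def
    by (subst integral_distr) (auto simp: mult_ac)
  then show ?thesis
    by (simp add: char_std_normal_distribution)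
qed

text \<open>Characteristic functions determine a law and multiply under independence. The argument
  covers vanishing coefficients and \<open>s = 0\<close>, where a density would not exist.\<close>

lemma (in prob_space) gauss_linear_combination:
  assumes ind: "indep_vars (\<lambda>_. borel) X I" and fin: "finite I"
    and law: "\<And>i. i \<in> I \<Longrightarrow> distr M borel (X i) = gauss s"
  shows "distr M borel (\<lambda>\<omega>. \<Sum>i\<in>I. a i * X i \<omega>) = gauss (s * sqrt (\<Sum>i\<in>I. (a i)\<^sup>2))"
proof (rule Levy_uniqueness)
  have X[measurable]: "X i \<in> borel_measurable M" if "i \<in> I" for i
    using ind that by (auto simp: indep_vars_def)
  have [measurable]: "(\<lambda>\<omega>. \<Sum>i\<in>I. a i * X i \<omega>) \<in> borel_measurable M"
    by (intro borel_measurable_sum borel_measurable_times X) auto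
  show "real_distribution (distr M borel (\<lambda>\<omega>. \<Sum>i\<in>I. a i * X i \<omega>))"
    by (rule real_distribution_distr) simp
  show "real_distribution (gauss (s * sqrt (\<Sum>i\<in>I. (a i)\<^sup>2)))"
    by (rule real_distribution_gauss)
  show "char (distr M borel (\<lambda>\<omega>. \<Sum>i\<in>I. a i * X i \<omega>)) = char (gauss (s * sqrt (\<Sum>i\<in>I. (a i)\<^sup>2)))"
  proof
    fix t
    have ind': "indep_vars (\<lambda>_. borel) (\<lambda>i \<omega>. a i * X i \<omega>) I"
      using indep_vars_compose2[OF ind, of "\<lambda>i x. a i * x" "\<lambda>_. borel"] by simp
    have one: "char (distr M borel (\<lambda>\<omega>. a i * X i \<omega>)) t = exp (- ((s * (a i * t))\<^sup>2) / 2)" if i: "i \<in> I" for i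
    proof -
      have "char (distr M borel (\<lambda>\<omega>. a i * X i \<omega>)) t = char (distr M borel (X i)) (a i * t)"
        using X[OF i] unfolding char_def by (simp add: integral_distr mult_ac)
      then show ?thesis
        by (simp add: law[OF i] char_gauss)
    qed
    have "char (distr M borel (\<lambda>\<omega>. \<Sum>i\<in>I. a i * X i \<omega>)) t = (\<Prod>i\<in>I. char (distr M borel (\<lambda>\<omega>. a i * X i \<omega>)) t)"
      by (rule char_distr_sum[OF ind'])
    also have "\<dots> = (\<Prod>i\<in>I. complex_of_real (exp (- ((s * (a i * t))\<^sup>2) / 2)))"
      by (intro prod.cong refl) (simp add: one)
    also have "\<dots> = complex_of_real (exp (\<Sum>i\<in>I. - ((s * (a i * t))\<^sup>2) / 2))"
      by (simp add: exp_sum fin)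
    also have "(\<Sum>i\<in>I. - ((s * (a i * t))\<^sup>2) / 2) = - ((s * sqrt (\<Sum>i\<in>I. (a i)\<^sup>2) * t)\<^sup>2) / 2"
      by (simp add: power_mult_distrib sum_nonneg sum_distrib_left sum_distrib_right
            sum_negf sum_divide_distrib algebra_simps)
    finally show "char (distr M borel (\<lambda>\<omega>. \<Sum>i\<in>I. a i * X i \<omega>)) t = char (gauss (s * sqrt (\<Sum>i\<in>I. (a i)\<^sup>2))) t"
      by (simp add: char_gauss)
  qed
qed

text \<open>On the product space the two coordinates are independent standard normals, and the
  double integral is an integral against the law of their linear combination.\<close>

lemma nn_integral_gamma1_convolution:
  fixes f :: "real \<Rightarrow> ennreal"
  assumes [measurable]: "f \<in> borel_measurable borel"
  shows "(\<integral>\<^sup>+x. \<integral>\<^sup>+y. f (s * x + t * y) \<partial>gamma1 \<partial>gamma1) = (\<integral>\<^sup>+z. f (sqrt (s\<^sup>2 + t\<^sup>2) * z) \<partial>gamma1)"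
proof -
  interpret g: prob_space gamma1 by (rule prob_space_gamma1)
  interpret gg: pair_prob_space gamma1 gamma1 ..
  let ?P = "gamma1 \<Otimes>\<^sub>M gamma1"
  have "distr ?P borel snd = gamma1"
  proof (rule measure_eqI)
    fix A assume "A \<in> sets (distr ?P borel snd)"
    then have [measurable]: "A \<in> sets borel" by simp
    have "emeasure (distr ?P borel snd) A = emeasure ?P (snd -` A \<inter> space ?P)"
      by (rule emeasure_distr) auto
    also have "snd -` A \<inter> space ?P = UNIV \<times> A" by (auto simp: space_pair_measure)
    also have "emeasure ?P (UNIV \<times> A) = emeasure gamma1 A"
      using g.emeasure_space_1 by (subst g.emeasure_pair_measure_Times) auto
    finally show "emeasure (distr ?P borel snd) A = emeasure gamma1 A" .
  qed simp
  moreover have "distr ?P borel fst = gamma1"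
    using g.distr_pair_fst[of gamma1] by (simp cong: distr_cong)
  ultimately have d: "distr ?P borel fst = gamma1" "distr ?P borel snd = gamma1"
    by simp_all
  have ind: "gg.indep_var borel fst borel snd"
  proof -
    have "distr ?P (borel \<Otimes>\<^sub>M borel) (\<lambda>x. (fst x, snd x)) = distr ?P ?P (\<lambda>x. x)"
      by (rule distr_cong) (auto intro!: sets_pair_measure_cong)
    then show ?thesis
      by (subst gg.indep_var_distribution_eq) (auto simp: d distr_id)
  qed
  \<comment> \<open>The two coordinates are indexed by \<open>bool\<close> to fit the lemma on
    finite families.\<close>
  define X where "X = (\<lambda>b::bool. if b then fst else (snd :: real \<times> real \<Rightarrow> real))"
  define a where "a = (\<lambda>b::bool. if b then s else t)"
  have "gg.indep_vars (\<lambda>_. borel) X UNIV"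
  proof -
    have "gg.indep_vars (case_bool borel borel) (case_bool fst snd) UNIV"
      using ind by (simp add: gg.indep_var_def)
    also have "case_bool borel borel = (\<lambda>_. borel :: real measure)"
      by (auto simp: fun_eq_iff split: bool.split)
    also have "case_bool fst snd = X"
      by (auto simp: X_def fun_eq_iff split: bool.split)
    finally show ?thesis .
  qed
  moreover have "gauss 1 = gamma1"
    unfolding gauss_def mult_1 by (rule distr_id2) simp
  then have "distr ?P borel (X b) = gauss 1" for b
    using d by (cases b) (simp_all add: X_def)
  ultimately have "distr ?P borel (\<lambda>\<omega>. \<Sum>b\<in>UNIV. a b * X b \<omega>) = gauss (sqrt (\<Sum>b\<in>UNIV. (a b)\<^sup>2))"
    using gg.gauss_linear_combination[of X UNIV 1 a] by simp
  then have "distr ?P borel (\<lambda>\<omega>. s * fst \<omega> + t * snd \<omega>) = gauss (sqrt (s\<^sup>2 + t\<^sup>2))"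
    by (simp add: UNIV_bool a_def X_def add.commute)
  then have "(\<integral>\<^sup>+z. f z \<partial>gauss (sqrt (s\<^sup>2 + t\<^sup>2))) = (\<integral>\<^sup>+z. f z \<partial>distr ?P borel (\<lambda>\<omega>. s * fst \<omega> + t * snd \<omega>))"
    by simp
  also have "\<dots> = (\<integral>\<^sup>+\<omega>. f (s * fst \<omega> + t * snd \<omega>) \<partial>?P)"
    by (rule nn_integral_distr) auto
  also have "\<dots> = (\<integral>\<^sup>+x. \<integral>\<^sup>+y. f (s * x + t * y) \<partial>gamma1 \<partial>gamma1)"
    by (subst g.nn_integral_fst[symmetric]) auto
  finally show ?thesis
    by (simp add: nn_integral_gauss)
qed

text \<open>The conditional probability, given by the reflection principle, that a Brownian path which is at \<open>x\<close> and
has time \<open>v\<close> left reaches the level \<open>a\<close>.\<close>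
definition reach :: "real \<Rightarrow> real \<Rightarrow> real \<Rightarrow> ennreal" where
  "reach a v x = (if a \<le> x then 1 else 2 * (\<integral>\<^sup>+z. indicator {a..} (x + sqrt v * z) \<partial>gamma1))"

lemma reach_measurable [measurable]: "reach a v \<in> borel_measurable borel"
proof -
  interpret g: prob_space gamma1 by (rule prob_space_gamma1)
  show ?thesis unfolding reach_def by measurable
qed

lemma nn_integral_gamma1_uminus:
  assumes [measurable]: "f \<in> borel_measurable borel"
  shows "(\<integral>\<^sup>+z. f (- z) \<partial>gamma1) = (\<integral>\<^sup>+z. f z \<partial>gamma1)"
proof -
  have "(\<integral>\<^sup>+z. f z \<partial>gamma1) = (\<integral>\<^sup>+z. ennreal (std_normal_density z) * f z \<partial>lborel)"
    by (subst nn_integral_density) auto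
  also have "\<dots> = (\<integral>\<^sup>+z. ennreal (std_normal_density (- z)) * f (- z) \<partial>lborel)"
    by (subst nn_integral_real_affine[where c="-1" and t=0]) auto
  also have "\<dots> = (\<integral>\<^sup>+z. f (- z) \<partial>gamma1)"
    by (subst nn_integral_density) (auto simp: std_normal_density_def)
  finally show ?thesis by simp
qed

text \<open>At or beyond the level, one of \<open>z\<close> and \<open>- z\<close> does not lower
  \<open>x\<close>, so by symmetry twice the tail is at least 1.\<close>

lemma reach_le_two_tail: "reach a v x \<le> 2 * (\<integral>\<^sup>+z. indicator {a..} (x + sqrt v * z) \<partial>gamma1)"
proof (cases "a \<le> x")
  case True
  interpret g: prob_space gamma1 by (rule prob_space_gamma1)
  let ?i = "\<lambda>z. indicator {a..} (x + sqrt v * z) :: ennreal"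
  have "1 = (\<integral>\<^sup>+z. 1 \<partial>gamma1)" using g.emeasure_space_1 by simp
  also have "\<dots> \<le> (\<integral>\<^sup>+z. ?i z + ?i (- z) \<partial>gamma1)"
  proof (rule nn_integral_mono)
    fix z
    have "sqrt v * z \<ge> 0 \<or> sqrt v * (- z) \<ge> 0" by auto
    then show "1 \<le> ?i z + ?i (- z)" using True by (auto simp: indicator_def)
  qed
  also have "\<dots> = 2 * (\<integral>\<^sup>+z. ?i z \<partial>gamma1)"
    using nn_integral_gamma1_uminus[of ?i] by (subst nn_integral_add) (auto simp: mult_2)
  finally show ?thesis using True by (simp add: reach_def)
qed (simp add: reach_def)

text \<open>From below the level only positive \<open>z\<close> lead to it, and for these
  \<open>sqrt v * z\<close> increases with \<open>v\<close>.\<close>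

lemma reach_mono:
  assumes "0 \<le> v" "v \<le> w" shows "reach a v x \<le> reach a w x"
proof (cases "a \<le> x")
  case False
  have "(\<integral>\<^sup>+z. indicator {a..} (x + sqrt v * z) \<partial>gamma1) \<le> (\<integral>\<^sup>+z. indicator {a..} (x + sqrt w * z) \<partial>gamma1)"
  proof (rule nn_integral_mono)
    fix z :: real
    show "(indicator {a..} (x + sqrt v * z) :: ennreal) \<le> indicator {a..} (x + sqrt w * z)"
    proof (cases "a \<le> x + sqrt v * z")
      case True
      with False assms have "0 < sqrt v * z" by simp
      then have "0 < z" using assms by (simp add: zero_less_mult_iff)
      then have "sqrt v * z \<le> sqrt w * z" using assms by simp
      with True show ?thesis by (simp add: indicator_def)
    qed (simp add: indicator_def)
  qed
  then show ?thesis using False by (simp add: reach_def mult_left_mono)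
qed (simp add: reach_def)

text \<open>This is the one-step supermartingale inequality. Twice the tail dominates
  \<open>reach\<close>, a Gaussian average of tails just adds the variances, and at a starting point
  below the level twice the tail is \<open>reach\<close> again.\<close>

lemma reach_step:
  assumes "x < a" "0 \<le> v"
  shows "(\<integral>\<^sup>+y. reach a v (x + s * y) \<partial>gamma1) \<le> reach a (s\<^sup>2 + v) x"
proof -
  interpret g: prob_space gamma1 by (rule prob_space_gamma1)
  have "(\<integral>\<^sup>+y. reach a v (x + s * y) \<partial>gamma1)
      \<le> (\<integral>\<^sup>+y. 2 * (\<integral>\<^sup>+z. indicator {a..} (x + s * y + sqrt v * z) \<partial>gamma1) \<partial>gamma1)"
    by (intro nn_integral_mono reach_le_two_tail)
  also have "\<dots> = 2 * (\<integral>\<^sup>+y. \<integral>\<^sup>+z. indicator {a..} (x + (s * y + sqrt v * z)) \<partial>gamma1 \<partial>gamma1)"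
    by (subst nn_integral_cmult) (auto simp: add.assoc)
  also have "\<dots> = 2 * (\<integral>\<^sup>+z. indicator {a..} (x + sqrt (s\<^sup>2 + (sqrt v)\<^sup>2) * z) \<partial>gamma1)"
    using nn_integral_gamma1_convolution[of "\<lambda>u. indicator {a..} (x + u)" s "sqrt v"] by simp
  also have "\<dots> = reach a (s\<^sup>2 + v) x"
    using assms by (simp add: reach_def)
  finally show ?thesis .
qed

text \<open>Independence of the increment \<open>G j\<close> from the past enters only as the Fubini-type identity
\<open>decouple\<close>: the increment may be replaced by an independent copy.\<close>
locale gaussian_walk = prob_space M for M :: "'w measure" +
  fixes Fil :: "nat \<Rightarrow> 'w measure" and G :: "nat \<Rightarrow> 'w \<Rightarrow> real^'d::finite"
    and J :: nat and \<delta> :: real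
  assumes delta_nonneg: "0 \<le> \<delta>"
    and subalgebra_Fil: "\<And>j. j \<le> J \<Longrightarrow> subalgebra M (Fil j)"
    and Fil_mono: "\<And>i j. i \<le> j \<Longrightarrow> j \<le> J \<Longrightarrow> subalgebra (Fil j) (Fil i)"
    and increment_measurable: "\<And>j. j < J \<Longrightarrow> G j \<in> borel_measurable (Fil (Suc j))"
    and decouple: "\<And>j F. j < J \<Longrightarrow> F \<in> borel_measurable (Fil j \<Otimes>\<^sub>M borel) \<Longrightarrow>
      (\<integral>\<^sup>+\<omega>. F (\<omega>, G j \<omega>) \<partial>M) = (\<integral>\<^sup>+\<omega>. \<integral>\<^sup>+\<omega>'. F (\<omega>, G j \<omega>') \<partial>M \<partial>M)"
    and increment_law: "\<And>j a. j < J \<Longrightarrow> distr M borel (\<lambda>\<omega>. a \<bullet> G j \<omega>) = gauss (sqrt \<delta> * norm a)"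
begin

lemma Fil_measurable_mono:
  assumes "f \<in> measurable (Fil i) N" "i \<le> j" "j \<le> J" shows "f \<in> measurable (Fil j) N"
  using measurable_from_subalg[OF Fil_mono[OF assms(2,3)] assms(1)] .

lemma Fil_measurable:
  assumes "f \<in> measurable (Fil j) N" "j \<le> J" shows "f \<in> measurable M N"
  using measurable_from_subalg[OF subalgebra_Fil[OF assms(2)] assms(1)] .

lemma space_Fil: "j \<le> J \<Longrightarrow> space (Fil j) = space M"
  using subalgebra_Fil by (simp add: subalgebra_def)

lemma increment_measurable_M [measurable]: "j < J \<Longrightarrow> G j \<in> borel_measurable M"
  using Fil_measurable[OF increment_measurable] by simp

lemma nn_integral_increment:
  assumes "j < J" "f \<in> borel_measurable borel"
  shows "(\<integral>\<^sup>+\<omega>. f (a \<bullet> G j \<omega>) \<partial>M) = (\<integral>\<^sup>+z. f (sqrt \<delta> * norm a * z) \<partial>gamma1)"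
proof -
  have "(\<integral>\<^sup>+z. f z \<partial>distr M borel (\<lambda>\<omega>. a \<bullet> G j \<omega>)) = (\<integral>\<^sup>+\<omega>. f (a \<bullet> G j \<omega>) \<partial>M)"
    using assms by (subst nn_integral_distr) auto
  then show ?thesis
    using assms by (simp add: increment_law nn_integral_gauss)
qed

context
  fixes A :: "nat \<Rightarrow> 'w \<Rightarrow> real^'d" and v :: "nat \<Rightarrow> real"
  assumes A_measurable: "\<And>j. j < J \<Longrightarrow> A j \<in> borel_measurable (Fil j)"
    and A_bound: "\<And>j \<omega>. j < J \<Longrightarrow> \<omega> \<in> space M \<Longrightarrow> \<delta> * (norm (A j \<omega>))\<^sup>2 \<le> v j"
begin

definition transform :: "nat \<Rightarrow> 'w \<Rightarrow> real" where
  "transform k \<omega> = (\<Sum>j<k. A j \<omega> \<bullet> G j \<omega>)"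

lemma transform_measurable: "k \<le> J \<Longrightarrow> transform k \<in> borel_measurable (Fil k)"
  unfolding transform_def
  by (intro borel_measurable_sum borel_measurable_inner)
     (auto intro: Fil_measurable_mono[OF A_measurable] Fil_measurable_mono[OF increment_measurable])

lemma v_nonneg: "j < J \<Longrightarrow> 0 \<le> v j"
  using A_bound[of j] not_empty delta_nonneg
  by (metis all_not_in_conv order_trans mult_nonneg_nonneg zero_le_power2)

text \<open>Conditioning one increment at a time, \<open>reach a v\<close> along the walk is a supermartingale. Only an upper bound
on the conditional variances is available, which is enough because \<open>reach\<close> increases with the remaining time.\<close>
lemma transform_tail:
  assumes K: "K \<le> J" and a: "0 < a"
  shows "emeasure M {\<omega>\<in>space M. \<exists>k\<le>K. a \<le> transform k \<omega>}
       \<le> 2 * (\<integral>\<^sup>+z. indicator {a..} (sqrt (\<Sum>j<K. v j) * z) \<partial>gamma1)"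
proof -
  \<comment> \<open>The variance budget that is left after \<open>k\<close> steps.\<close>
  define V where "V k = (\<Sum>j=k..<K. v j)" for k
  define hit where "hit k = {\<omega>\<in>space M. \<exists>i\<le>k. a \<le> transform i \<omega>}" for k
  \<comment> \<open>After a hit the value is frozen at 1: the event concerns the whole past, and the
    walk may have dropped below the level again.\<close>
  define \<Psi> where "\<Psi> k \<omega> = (if \<omega> \<in> hit k then 1 else reach a (V k) (transform k \<omega>))" for k \<omega>
  have Vnn: "0 \<le> V k" for k
    unfolding V_def using K by (intro sum_nonneg v_nonneg) auto
  have hit_meas: "hit k \<in> sets (Fil k)" if "k \<le> J" for k
  proof -
    have "hit k = (\<Union>i\<in>{..k}. {\<omega>\<in>space (Fil k). a \<le> transform i \<omega>})"
      using space_Fil[OF that] by (auto simp: hit_def)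
    also have "\<dots> \<in> sets (Fil k)"
    proof (intro sets.finite_UN ballI)
      fix i assume "i \<in> {..k}"
      then have [measurable]: "transform i \<in> borel_measurable (Fil k)"
        using that Fil_measurable_mono[OF transform_measurable, of i k] by auto
      show "{\<omega>\<in>space (Fil k). a \<le> transform i \<omega>} \<in> sets (Fil k)" by measurable
    qed simp
    finally show ?thesis .
  qed
  have step: "(\<integral>\<^sup>+\<omega>. \<Psi> (Suc k) \<omega> \<partial>M) \<le> (\<integral>\<^sup>+\<omega>. \<Psi> k \<omega> \<partial>M)" if k: "k < K" for k
  proof -
    from k K have kJ: "k < J" by simp
    \<comment> \<open>\<open>\<Psi> (Suc k)\<close> as a function of the past and of the next
      increment, which is the form that \<open>decouple\<close> takes.\<close>
    define F where "F = (\<lambda>(\<omega>, g). if \<omega> \<in> hit k then 1 else reach a (V (Suc k)) (transform k \<omega> + A k \<omega> \<bullet> g))"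
    have [measurable]: "A k \<in> borel_measurable (Fil k)" "transform k \<in> borel_measurable (Fil k)" "hit k \<in> sets (Fil k)"
      using kJ by (auto intro: A_measurable transform_measurable hit_meas)
    have F: "F \<in> borel_measurable (Fil k \<Otimes>\<^sub>M borel)"
      unfolding F_def by measurable
    have "(\<integral>\<^sup>+\<omega>. \<Psi> (Suc k) \<omega> \<partial>M) = (\<integral>\<^sup>+\<omega>. F (\<omega>, G k \<omega>) \<partial>M)"
    proof (rule nn_integral_cong)
      fix \<omega> assume "\<omega> \<in> space M"
      moreover have "\<omega> \<in> hit (Suc k) \<longleftrightarrow> \<omega> \<in> hit k \<or> a \<le> transform (Suc k) \<omega>" if "\<omega> \<in> space M"
        using that by (auto simp: hit_def le_Suc_eq)
      moreover have "transform (Suc k) \<omega> = transform k \<omega> + A k \<omega> \<bullet> G k \<omega>"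
        by (simp add: transform_def)
      ultimately show "\<Psi> (Suc k) \<omega> = F (\<omega>, G k \<omega>)"
        by (auto simp: \<Psi>_def F_def reach_def)
    qed
    also have "\<dots> = (\<integral>\<^sup>+\<omega>. \<integral>\<^sup>+\<omega>'. F (\<omega>, G k \<omega>') \<partial>M \<partial>M)"
      by (rule decouple[OF kJ F])
    also have "\<dots> \<le> (\<integral>\<^sup>+\<omega>. \<Psi> k \<omega> \<partial>M)"
    proof (rule nn_integral_mono)
      fix \<omega> assume \<omega>: "\<omega> \<in> space M"
      show "(\<integral>\<^sup>+\<omega>'. F (\<omega>, G k \<omega>') \<partial>M) \<le> \<Psi> k \<omega>"
      proof (cases "\<omega> \<in> hit k")
        case True
        then show ?thesis by (simp add: F_def \<Psi>_def emeasure_space_1)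
      next
        case False
        with \<omega> have less: "transform k \<omega> < a" by (auto simp: hit_def not_le)
        let ?s = "sqrt \<delta> * norm (A k \<omega>)"
        have "(\<integral>\<^sup>+\<omega>'. F (\<omega>, G k \<omega>') \<partial>M) = (\<integral>\<^sup>+y. reach a (V (Suc k)) (transform k \<omega> + ?s * y) \<partial>gamma1)"
          using False nn_integral_increment[OF kJ, of "\<lambda>y. reach a (V (Suc k)) (transform k \<omega> + y)" "A k \<omega>"]
          by (simp add: F_def)
        also have "\<dots> \<le> reach a (?s\<^sup>2 + V (Suc k)) (transform k \<omega>)"
          by (rule reach_step[OF less Vnn])
        also have "\<dots> \<le> reach a (V k) (transform k \<omega>)"
        proof (rule reach_mono)
          have "V k = v k + V (Suc k)"
            using k by (simp add: V_def sum.atLeast_Suc_lessThan)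
          then show "?s\<^sup>2 + V (Suc k) \<le> V k"
            using A_bound[OF kJ \<omega>] delta_nonneg by (simp add: power_mult_distrib)
        qed (use Vnn in simp)
        finally show ?thesis using False by (simp add: \<Psi>_def)
      qed
    qed
    finally show ?thesis .
  qed
  have le0: "(\<integral>\<^sup>+\<omega>. \<Psi> k \<omega> \<partial>M) \<le> (\<integral>\<^sup>+\<omega>. \<Psi> 0 \<omega> \<partial>M)" if "k \<le> K" for k
    using that
  proof (induction k)
    case (Suc k)
    with step[of k] show ?case by (auto intro: order_trans)
  qed simp
  have [measurable]: "hit K \<in> sets M"
    using hit_meas[OF K] subalgebra_Fil[OF K] by (auto simp: subalgebra_def)
  have "emeasure M (hit K) = (\<integral>\<^sup>+\<omega>. indicator (hit K) \<omega> \<partial>M)" by simp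
  also have "\<dots> \<le> (\<integral>\<^sup>+\<omega>. \<Psi> K \<omega> \<partial>M)"
    by (intro nn_integral_mono) (auto simp: \<Psi>_def indicator_def)
  also have "\<dots> \<le> (\<integral>\<^sup>+\<omega>. \<Psi> 0 \<omega> \<partial>M)" by (rule le0) simp
  also have "\<dots> = (\<integral>\<^sup>+\<omega>. reach a (V 0) 0 \<partial>M)"
    using a by (intro nn_integral_cong) (auto simp: \<Psi>_def hit_def transform_def)
  also have "\<dots> = 2 * (\<integral>\<^sup>+z. indicator {a..} (sqrt (V 0) * z) \<partial>gamma1)"
    using a by (simp add: reach_def emeasure_space_1)
  also have "V 0 = (\<Sum>j<K. v j)" by (simp add: V_def atLeast0LessThan)
  finally show ?thesis by (simp add: hit_def)
qed

end
end

section \<open>Exponential moments from tails\<close>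

text \<open>The fundamental theorem of calculus up to \<open>X \<omega>\<close>, followed by
  Tonelli. The value at 0 stays apart from the integral over the levels, because tail estimates act
  on the latter alone.\<close>

lemma layer_cake:
  fixes \<Phi> \<phi> :: "real \<Rightarrow> real"
  assumes "prob_space M" and [measurable]: "X \<in> borel_measurable M" "\<phi> \<in> borel_measurable borel"
    and X: "\<And>\<omega>. \<omega> \<in> space M \<Longrightarrow> 0 \<le> X \<omega>"
    and deriv: "\<And>x. 0 \<le> x \<Longrightarrow> (\<Phi> has_real_derivative \<phi> x) (at x)"
    and \<phi>: "\<And>x. 0 \<le> x \<Longrightarrow> 0 \<le> \<phi> x" and \<Phi>0: "0 \<le> \<Phi> 0"
  shows "(\<integral>\<^sup>+\<omega>. ennreal (\<Phi> (X \<omega>)) \<partial>M)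
    = ennreal (\<Phi> 0) + (\<integral>\<^sup>+a. ennreal (\<phi> a) * indicator {0..} a * emeasure M {\<omega>\<in>space M. a \<le> X \<omega>} \<partial>lborel)"
proof -
  interpret prob_space M by fact
  interpret pair_sigma_finite M lborel ..
  have "ennreal (\<Phi> (X \<omega>)) = ennreal (\<Phi> 0) + (\<integral>\<^sup>+a. ennreal (\<phi> a) * indicator {0..X \<omega>} a \<partial>lborel)"
    if \<omega>: "\<omega> \<in> space M" for \<omega>
  proof -
    have "(\<integral>\<^sup>+a. ennreal (\<phi> a) * indicator {0..X \<omega>} a \<partial>lborel) = ennreal (\<Phi> (X \<omega>) - \<Phi> 0)"
      using X[OF \<omega>] by (intro nn_integral_FTC_Icc deriv \<phi>) auto
    moreover have "\<Phi> 0 \<le> \<Phi> (X \<omega>)"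
      using X[OF \<omega>] deriv \<phi> by (intro DERIV_nonneg_imp_nondecreasing[of 0 "X \<omega>" \<Phi>]) auto
    ultimately show ?thesis
      using \<Phi>0 by (simp flip: ennreal_plus)
  qed
  then have "(\<integral>\<^sup>+\<omega>. ennreal (\<Phi> (X \<omega>)) \<partial>M)
      = (\<integral>\<^sup>+\<omega>. ennreal (\<Phi> 0) + (\<integral>\<^sup>+a. ennreal (\<phi> a) * indicator {0..X \<omega>} a \<partial>lborel) \<partial>M)"
    by (intro nn_integral_cong) auto
  \<comment> \<open>Separating the condition \<open>a \<le> X \<omega>\<close> makes the integrand
    visibly measurable on the product space.\<close>
  also have "\<dots> = (\<integral>\<^sup>+\<omega>. ennreal (\<Phi> 0) + (\<integral>\<^sup>+a. ennreal (\<phi> a) * indicator {0..} a * indicator {a..} (X \<omega>) \<partial>lborel) \<partial>M)"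
    by (intro nn_integral_cong arg_cong2[where f=plus] refl) (auto simp: indicator_def)
  also have "\<dots> = ennreal (\<Phi> 0) + (\<integral>\<^sup>+\<omega>. \<integral>\<^sup>+a. ennreal (\<phi> a) * indicator {0..} a * indicator {a..} (X \<omega>) \<partial>lborel \<partial>M)"
    unfolding atLeast_def by (subst nn_integral_add) (auto simp: emeasure_space_1)
  also have "(\<integral>\<^sup>+\<omega>. \<integral>\<^sup>+a. ennreal (\<phi> a) * indicator {0..} a * indicator {a..} (X \<omega>) \<partial>lborel \<partial>M)
      = (\<integral>\<^sup>+a. \<integral>\<^sup>+\<omega>. ennreal (\<phi> a) * indicator {0..} a * indicator {a..} (X \<omega>) \<partial>M \<partial>lborel)"
    unfolding atLeast_def by (rule Fubini'[symmetric]) measurable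
  also have "\<dots> = (\<integral>\<^sup>+a. ennreal (\<phi> a) * indicator {0..} a * emeasure M {\<omega>\<in>space M. a \<le> X \<omega>} \<partial>lborel)"
  proof (rule nn_integral_cong)
    fix a :: real
    have "(\<integral>\<^sup>+\<omega>. indicator {a..} (X \<omega>) \<partial>M) = (\<integral>\<^sup>+\<omega>. indicator {\<omega>\<in>space M. a \<le> X \<omega>} \<omega> \<partial>M)"
      by (intro nn_integral_cong) (auto simp: indicator_def)
    then show "(\<integral>\<^sup>+\<omega>. ennreal (\<phi> a) * indicator {0..} a * indicator {a..} (X \<omega>) \<partial>M)
        = ennreal (\<phi> a) * indicator {0..} a * emeasure M {\<omega>\<in>space M. a \<le> X \<omega>}"
      by (subst nn_integral_cmult) auto
  qed
  finally show ?thesis .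
qed

text \<open>By \<open>layer_cake\<close> only the integral over the levels is doubled, not the value
  \<open>exp (lam * q\<^sup>2)\<close> at 0, which therefore can be added on the left. Without this
  term the bound would tend to 2 instead of 1 as \<open>lam\<close> tends to 0.\<close>

lemma two_tail_exp_square:
  fixes X :: "'a \<Rightarrow> real" and Y :: "'b \<Rightarrow> real"
  assumes M: "prob_space M" and N: "prob_space N"
    and X[measurable]: "X \<in> borel_measurable M" and Y[measurable]: "Y \<in> borel_measurable N"
    and X0: "\<And>\<omega>. \<omega> \<in> space M \<Longrightarrow> 0 \<le> X \<omega>" and Y0: "\<And>\<omega>. \<omega> \<in> space N \<Longrightarrow> 0 \<le> Y \<omega>"
    and tail: "\<And>a. 0 < a \<Longrightarrow> emeasure M {\<omega>\<in>space M. a \<le> X \<omega>} \<le> 2 * emeasure N {\<omega>\<in>space N. a \<le> Y \<omega>}"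
    and "0 \<le> lam" "0 \<le> q"
  shows "(\<integral>\<^sup>+\<omega>. ennreal (exp (lam * (q + X \<omega>)\<^sup>2)) \<partial>M) + ennreal (exp (lam * q\<^sup>2))
    \<le> 2 * (\<integral>\<^sup>+\<omega>. ennreal (exp (lam * (q + Y \<omega>)\<^sup>2)) \<partial>N)"
proof -
  let ?\<Phi> = "\<lambda>x. exp (lam * (q + x)\<^sup>2)" and ?\<phi> = "\<lambda>x. 2 * lam * (q + x) * exp (lam * (q + x)\<^sup>2)"
  have d: "(?\<Phi> has_real_derivative ?\<phi> x) (at x)" for x
    by (auto intro!: derivative_eq_intros simp: algebra_simps)
  let ?I = "\<lambda>M X. \<integral>\<^sup>+a. ennreal (?\<phi> a) * indicator {0..} a * emeasure M {\<omega>\<in>space M. a \<le> X \<omega>} \<partial>lborel"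
  have MX: "(\<integral>\<^sup>+\<omega>. ennreal (?\<Phi> (X \<omega>)) \<partial>M) = ennreal (?\<Phi> 0) + ?I M X"
    using assms by (intro layer_cake[OF M X _ X0 d]) auto
  have NY: "(\<integral>\<^sup>+\<omega>. ennreal (?\<Phi> (Y \<omega>)) \<partial>N) = ennreal (?\<Phi> 0) + ?I N Y"
    using assms by (intro layer_cake[OF N Y _ Y0 d]) auto
  have "?I M X \<le> (\<integral>\<^sup>+a. 2 * (ennreal (?\<phi> a) * indicator {0..} a * emeasure N {\<omega>\<in>space N. a \<le> Y \<omega>}) \<partial>lborel)"
  \<comment> \<open>Level 0, at which no tail estimate is assumed, is a null set.\<close>
  proof (rule nn_integral_mono_AE, rule AE_mp[OF AE_lborel_singleton[of 0]], rule AE_I2, rule impI)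
    fix a :: real assume "a \<noteq> 0"
    then show "ennreal (?\<phi> a) * indicator {0..} a * emeasure M {\<omega>\<in>space M. a \<le> X \<omega>}
       \<le> 2 * (ennreal (?\<phi> a) * indicator {0..} a * emeasure N {\<omega>\<in>space N. a \<le> Y \<omega>})"
      using tail[of a] by (auto simp: indicator_def mult.left_commute[of 2] intro!: mult_left_mono)
  qed
  also have "\<dots> = 2 * ?I N Y"
  proof (rule nn_integral_cmult)
    interpret N: prob_space N by fact
    have [simp]: "emeasure N {\<omega>\<in>space N. a \<le> Y \<omega>} = (\<integral>\<^sup>+\<omega>. indicator {x. a \<le> x} (Y \<omega>) \<partial>N)" for a
    proof -
      have "(\<integral>\<^sup>+\<omega>. indicator {x. a \<le> x} (Y \<omega>) \<partial>N) = (\<integral>\<^sup>+\<omega>. indicator {\<omega>\<in>space N. a \<le> Y \<omega>} \<omega> \<partial>N)"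
        by (intro nn_integral_cong) (auto simp: indicator_def)
      then show ?thesis by simp
    qed
    show "(\<lambda>a. ennreal (?\<phi> a) * indicator {0..} a * emeasure N {\<omega>\<in>space N. a \<le> Y \<omega>}) \<in> borel_measurable lborel"
      by simp
  qed
  finally have "?I M X \<le> 2 * ?I N Y" .
  moreover have "x \<le> 2 * y \<Longrightarrow> e + x + e \<le> 2 * (e + y)" for e x y :: ennreal
    by (simp add: distrib_left mult_2[of e] add.assoc add.commute[of x e])
  ultimately show ?thesis
    unfolding MX NY by simp
qed

text \<open>Completing the square turns the two half-lines into pieces of Gaussians with variance
  \<open>u\<^sup>2\<close> centred at \<open>m\<close> and \<open>- m\<close>. Their masses add up
  to 1 plus the mass of \<open>{-m..m}\<close> under the centred law, and the latter is at most the
  length of the interval times the peak of the density. From \<open>lam \<le> 1/8\<close> one gets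
  \<open>u\<^sup>2 \<le> 4/3\<close>, which yields the 1/3 and allows \<open>u / sqrt 2\<close> to
  be dropped.\<close>

lemma nn_integral_gamma1_exp_bound:
  assumes lam: "0 \<le> lam" "lam \<le> 1/8" and q: "0 \<le> q"
  shows "(\<integral>\<^sup>+z. ennreal (exp (lam * (z\<^sup>2 + 2 * q * \<bar>z\<bar>))) \<partial>gamma1)
    \<le> ennreal (1 / sqrt (1 - 2 * lam) * exp (lam * (q\<^sup>2 / 3 + 4 * q / sqrt pi)))"
proof -
  define u where "u = 1 / sqrt (1 - 2 * lam)"
  define m where "m = 2 * lam * q * u\<^sup>2"
  define C where "C = u * exp (2 * lam\<^sup>2 * q\<^sup>2 * u\<^sup>2)"
  have u0: "0 < u" using lam by (simp add: u_def)
  have u2: "u\<^sup>2 = 1 / (1 - 2 * lam)" using lam by (simp add: u_def power_divide)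
  have u2le: "u\<^sup>2 \<le> 4/3" using lam by (simp add: u2 field_simps)
  have m0: "0 \<le> m" using lam q by (simp add: m_def)
  have C0: "0 \<le> C" using u0 by (simp add: C_def)
  let ?p = "normal_density 0 u"
  \<comment> \<open>Used with \<open>y = \<bar>z\<bar>\<close>; only
    \<open>y\<^sup>2 = z\<^sup>2\<close> enters the completion of the square.\<close>
  have key: "std_normal_density z * exp (lam * (z\<^sup>2 + 2 * q * y)) = C * ?p (y - m)" if "y\<^sup>2 = z\<^sup>2" for z y
  proof -
    have l: "lam = (1 - 1 / u\<^sup>2) / 2" using lam by (simp add: u2 field_simps)
    have "- (z\<^sup>2) / 2 + lam * (z\<^sup>2 + 2 * q * y) = 2 * lam\<^sup>2 * q\<^sup>2 * u\<^sup>2 + (- ((y - m)\<^sup>2) / (2 * u\<^sup>2))"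
    proof -
      have "- (z\<^sup>2) / 2 + lam * z\<^sup>2 = - (y\<^sup>2) / (2 * u\<^sup>2)"
        using that u0 by (simp add: l field_simps)
      moreover have "(y - m)\<^sup>2 / (2 * u\<^sup>2) = y\<^sup>2 / (2 * u\<^sup>2) - 2 * lam * q * y + 2 * lam\<^sup>2 * q\<^sup>2 * u\<^sup>2"
        using u0 by (simp add: m_def power2_eq_square field_simps)
      ultimately show ?thesis by (simp add: algebra_simps)
    qed
    then have "exp (- (z\<^sup>2) / 2) * exp (lam * (z\<^sup>2 + 2 * q * y)) = exp (2 * lam\<^sup>2 * q\<^sup>2 * u\<^sup>2) * exp (- ((y - m)\<^sup>2) / (2 * u\<^sup>2))"
      by (simp add: exp_add[symmetric])
    then show ?thesis
      using u0 by (simp add: std_normal_density_def normal_density_def C_def real_sqrt_mult mult_ac)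
  qed
  have "(\<integral>\<^sup>+z. ennreal (exp (lam * (z\<^sup>2 + 2 * q * \<bar>z\<bar>))) \<partial>gamma1)
      = (\<integral>\<^sup>+z. ennreal (std_normal_density z * exp (lam * (z\<^sup>2 + 2 * q * \<bar>z\<bar>))) \<partial>lborel)"
    by (subst nn_integral_density) (auto simp: ennreal_mult)
  also have "\<dots> = (\<integral>\<^sup>+z. ennreal (C * ?p (\<bar>z\<bar> - m)) \<partial>lborel)"
    by (simp add: key)
  also have "\<dots> \<le> (\<integral>\<^sup>+z. ennreal C * (ennreal (?p (z - m)) * indicator {0..} z + ennreal (?p (z + m)) * indicator {..0} z) \<partial>lborel)"
  proof (rule nn_integral_mono)
    fix z
    have "?p (- z - m) = ?p (z + m)" by (simp add: normal_density_def power2_eq_square algebra_simps)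
    then show "ennreal (C * ?p (\<bar>z\<bar> - m)) \<le> ennreal C * (ennreal (?p (z - m)) * indicator {0..} z + ennreal (?p (z + m)) * indicator {..0} z)"
      using C0 by (cases "0 \<le> z") (auto simp: ennreal_mult indicator_def intro!: mult_left_mono)
  qed
  also have "\<dots> = ennreal C * ((\<integral>\<^sup>+z. ennreal (?p (z - m)) * indicator {0..} z \<partial>lborel) + (\<integral>\<^sup>+z. ennreal (?p (z + m)) * indicator {..0} z \<partial>lborel))"
    by (simp add: nn_integral_cmult nn_integral_add)
  also have "(\<integral>\<^sup>+z. ennreal (?p (z - m)) * indicator {0..} z \<partial>lborel) = (\<integral>\<^sup>+w. ennreal (?p w) * indicator {-m..} w \<partial>lborel)"
    by (subst nn_integral_real_affine[where c=1 and t=m]) (auto intro!: nn_integral_cong simp: indicator_def)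
  also have "(\<integral>\<^sup>+z. ennreal (?p (z + m)) * indicator {..0} z \<partial>lborel) = (\<integral>\<^sup>+w. ennreal (?p w) * indicator {..m} w \<partial>lborel)"
    by (subst nn_integral_real_affine[where c=1 and t="-m"]) (auto intro!: nn_integral_cong simp: indicator_def)
  also have "(\<integral>\<^sup>+w. ennreal (?p w) * indicator {-m..} w \<partial>lborel) + (\<integral>\<^sup>+w. ennreal (?p w) * indicator {..m} w \<partial>lborel)
     = (\<integral>\<^sup>+w. ennreal (?p w) + ennreal (?p w) * indicator {-m..m} w \<partial>lborel)"
    using m0 by (subst nn_integral_add[symmetric]) (auto intro!: nn_integral_cong simp: indicator_def)
  also have "\<dots> = (\<integral>\<^sup>+w. ennreal (?p w) \<partial>lborel) + (\<integral>\<^sup>+w. ennreal (?p w) * indicator {-m..m} w \<partial>lborel)"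
    by (rule nn_integral_add) auto
  also have "(\<integral>\<^sup>+w. ennreal (?p w) \<partial>lborel) = 1"
  proof -
    have "(\<integral>\<^sup>+w. ennreal (?p w) \<partial>lborel) = ennreal (\<integral>w. ?p w \<partial>lborel)"
      using u0 by (intro nn_integral_eq_integral integrable_normal_density) auto
    then show ?thesis using u0 by (simp add: integral_normal_density)
  qed
  also have "(\<integral>\<^sup>+w. ennreal (?p w) * indicator {-m..m} w \<partial>lborel) \<le> (\<integral>\<^sup>+w. ennreal (1 / sqrt (2 * pi * u\<^sup>2)) * indicator {-m..m} w \<partial>lborel)"
    by (intro nn_integral_mono mult_right_mono ennreal_leI) (auto simp: normal_density_def intro!: divide_right_mono)
  also have "\<dots> = ennreal (1 / sqrt (2 * pi * u\<^sup>2) * (2 * m))"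
    using m0 by (subst nn_integral_cmult) (auto simp: ennreal_mult[symmetric])
  also have "ennreal C * (1 + ennreal (1 / sqrt (2 * pi * u\<^sup>2) * (2 * m))) = ennreal (C * (1 + 1 / sqrt (2 * pi * u\<^sup>2) * (2 * m)))"
    using C0 m0 by (simp add: ennreal_mult ennreal_plus[symmetric] del: ennreal_plus flip: ennreal_1)
  also have "\<dots> \<le> ennreal (u * exp (lam * (q\<^sup>2 / 3 + 4 * q / sqrt pi)))"
  proof (rule ennreal_leI)
    have "1 / sqrt (2 * pi * u\<^sup>2) * (2 * m) = lam * (4 * q / sqrt pi) * (u / sqrt 2)"
      using u0 lam by (simp add: m_def real_sqrt_mult power2_eq_square field_simps)
    also have "\<dots> \<le> lam * (4 * q / sqrt pi) * 1"
    proof (intro mult_left_mono)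
      have "u \<le> sqrt 2" using u2le u0 by (intro real_le_rsqrt) auto
      then show "u / sqrt 2 \<le> 1" by simp
    qed (use lam q in auto)
    finally have 1: "1 + 1 / sqrt (2 * pi * u\<^sup>2) * (2 * m) \<le> exp (lam * (4 * q / sqrt pi))"
      using exp_ge_add_one_self[of "lam * (4 * q / sqrt pi)"] by linarith
    have "2 * lam\<^sup>2 * q\<^sup>2 * u\<^sup>2 = lam * q\<^sup>2 * (2 * lam * u\<^sup>2)" by (simp add: power2_eq_square)
    also have "\<dots> \<le> lam * q\<^sup>2 * (1/3)"
    proof (intro mult_left_mono)
      have "2 * lam * u\<^sup>2 \<le> 2 * (1/8) * (4/3)" using lam u2le by (intro mult_mono) auto
      then show "2 * lam * u\<^sup>2 \<le> 1/3" by simp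
    qed (use lam in auto)
    finally have 2: "exp (2 * lam\<^sup>2 * q\<^sup>2 * u\<^sup>2) \<le> exp (lam * (q\<^sup>2 / 3))" by simp
    have "C * (1 + 1 / sqrt (2 * pi * u\<^sup>2) * (2 * m)) \<le> u * exp (lam * (q\<^sup>2 / 3)) * exp (lam * (4 * q / sqrt pi))"
      unfolding C_def using 1 2 u0 m0 by (intro mult_mono) auto
    then show "C * (1 + 1 / sqrt (2 * pi * u\<^sup>2) * (2 * m)) \<le> u * exp (lam * (q\<^sup>2 / 3 + 4 * q / sqrt pi))"
      by (simp add: exp_add distrib_left mult.assoc)
  qed
  finally show ?thesis
    by (simp add: u_def add_left_mono mult_left_mono)
qed

text \<open>Reflection subtracts 1 only once from a product of \<open>d\<close> moments; this
  distributes the subtraction over the factors.\<close>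

lemma two_power_minus_one_le: "1 \<le> z \<Longrightarrow> 2 * z ^ d - 1 \<le> (2 * z - 1) ^ d" for z :: real
proof (induction d)
  case (Suc d)
  have "0 \<le> 2 * (z - 1) * (z ^ d - 1)" using Suc.prems by (intro mult_nonneg_nonneg) auto
  then have "2 * z ^ Suc d - 1 \<le> (2 * z - 1) * (2 * z ^ d - 1)"
    by (simp add: algebra_simps)
  also have "\<dots> \<le> (2 * z - 1) * (2 * z - 1) ^ d"
    using Suc by (intro mult_left_mono) auto
  finally show ?case by simp
qed simp

text \<open>The left side is what \<open>two_tail_exp_square\<close> leaves when the Gaussian moment
  is a product of \<open>d\<close> factors bounded by \<open>nn_integral_gamma1_exp_bound\<close>.
  It equals 1 for \<open>lam = A = 0\<close>, so an exponential without prefactor can dominate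
  it.\<close>

lemma reflected_gaussian_constant:
  assumes lam: "0 \<le> lam" "lam \<le> 1/8" and A: "0 \<le> A"
  shows "2 * (1 / sqrt (1 - 2 * lam) * exp A) ^ d - 1 \<le> exp (real d * (4 * lam * ln 2 + 2 * A))"
proof -
  define u where "u = 1 / sqrt (1 - 2 * lam)"
  have u2: "u\<^sup>2 = 1 / (1 - 2 * lam)" using lam by (simp add: u_def power_divide)
  have u1: "1 \<le> u" using lam by (simp add: u_def)
  have eA: "1 \<le> exp A" using A by simp
  \<comment> \<open>The slope must be at least about 1.24 for the line to reach \<open>u\<close> at
    \<open>lam = 1/8\<close>, and its double must not exceed 4 times 2/3, the lower bound for
    \<open>4 * ln 2\<close> used below; 5/4 satisfies both.\<close>
  have u: "u \<le> 1 + 5/4 * lam"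
  proof (rule power2_le_imp_le)
    have "lam * lam \<le> lam * (1/8)" "lam * lam * lam \<le> lam * (1/8 * (1/8))"
      using lam by (auto simp only: mult.assoc intro!: mult_left_mono mult_mono)
    moreover have "(1 + 5/4 * lam)\<^sup>2 * (1 - 2 * lam) - 1 = lam / 2 - 55/16 * (lam * lam) - 25/8 * (lam * lam * lam)"
      by (simp add: power2_eq_square field_simps)
    ultimately have "1 \<le> (1 + 5/4 * lam)\<^sup>2 * (1 - 2 * lam)"
      using lam by linarith
    then show "u\<^sup>2 \<le> (1 + 5/4 * lam)\<^sup>2" using lam by (simp add: u2 field_simps)
  qed (use lam in simp)
  have "2 * u - 1 \<le> 1 + 4 * lam * ln 2"
    using u mult_left_mono[OF ln2_ge_two_thirds lam(1)] lam by (simp add: algebra_simps)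
  also have "\<dots> \<le> exp (4 * lam * ln 2)" by (rule exp_ge_add_one_self)
  finally have u': "2 * u - 1 \<le> exp (4 * lam * ln 2)" .
  \<comment> \<open>Expanding the product separates \<open>u\<close> from \<open>A\<close>: it says
    \<open>2 * u * exp A - 1 \<le> (2 * u - 1) * exp (2 * A)\<close>.\<close>
  have "0 \<le> (exp A - 1) * ((2 * u - 1) * exp A - 1)"
    using eA u1 mult_mono[of 1 "2*u-1" 1 "exp A"] by (intro mult_nonneg_nonneg) auto
  then have "2 * (u * exp A) - 1 \<le> (2 * u - 1) * exp (2 * A)"
    unfolding exp_double power2_eq_square by (simp add: algebra_simps)
  also have "\<dots> \<le> exp (4 * lam * ln 2) * exp (2 * A)"
    using u' by (intro mult_right_mono) auto
  finally have *: "2 * (u * exp A) - 1 \<le> exp (4 * lam * ln 2 + 2 * A)" by (simp add: exp_add)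
  have z1: "1 \<le> u * exp A" using u1 eA mult_mono[of 1 u 1 "exp A"] by simp
  have "2 * (u * exp A) ^ d - 1 \<le> (2 * (u * exp A) - 1) ^ d"
    by (rule two_power_minus_one_le[OF z1])
  also have "\<dots> \<le> exp (4 * lam * ln 2 + 2 * A) ^ d"
    using * z1 by (intro power_mono) auto
  finally show ?thesis by (simp add: u_def exp_of_nat_mult[symmetric])
qed

section \<open>Brownian increments\<close>

text \<open>Regard the identity as a random variable with values in the generated sub-sigma-algebra.
  It is independent of \<open>Y\<close>, so the law of the pair is a product and Tonelli applies.
  This takes the place of conditional expectations.\<close>

lemma (in prob_space) decouple_vimage_algebra:
  fixes Y :: "'a \<Rightarrow> 'b::{second_countable_topology, t2_space}"
  assumes X: "X \<in> measurable M N" and Y[measurable]: "Y \<in> borel_measurable M"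
    and ind: "\<And>A B. A \<in> sets N \<Longrightarrow> B \<in> sets borel \<Longrightarrow>
      prob ((X -` A \<inter> space M) \<inter> (Y -` B \<inter> space M)) = prob (X -` A \<inter> space M) * prob (Y -` B \<inter> space M)"
    and F: "F \<in> borel_measurable (vimage_algebra (space M) X N \<Otimes>\<^sub>M borel)"
  shows "(\<integral>\<^sup>+\<omega>. F (\<omega>, Y \<omega>) \<partial>M) = (\<integral>\<^sup>+\<omega>. \<integral>\<^sup>+\<omega>'. F (\<omega>, Y \<omega>') \<partial>M \<partial>M)"
proof -
  let ?F = "vimage_algebra (space M) X N"
  have sets: "sets ?F = {X -` A \<inter> space M |A. A \<in> sets N}"
    using measurable_space[OF X] by (intro sets_vimage_algebra2) auto
  have [measurable]: "(\<lambda>\<omega>. \<omega>) \<in> measurable M ?F"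
    using X by (intro measurable_vimage_algebra2) auto
  let ?P = "distr M ?F (\<lambda>\<omega>. \<omega>)" and ?Q = "distr M borel Y"
  interpret P: prob_space ?P by (rule prob_space_distr) simp
  interpret Q: prob_space ?Q by (rule prob_space_distr) simp
  have joint: "?P \<Otimes>\<^sub>M ?Q = distr M (?F \<Otimes>\<^sub>M borel) (\<lambda>\<omega>. (\<omega>, Y \<omega>))"
  proof (rule pair_measure_eqI)
    show "sigma_finite_measure ?P" "sigma_finite_measure ?Q" by unfold_locales
    show "sets (?P \<Otimes>\<^sub>M ?Q) = sets (distr M (?F \<Otimes>\<^sub>M borel) (\<lambda>\<omega>. (\<omega>, Y \<omega>)))"
      by (auto intro!: sets_pair_measure_cong)
    fix A B assume "A \<in> sets ?P" "B \<in> sets ?Q"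
    then have A[measurable]: "A \<in> sets ?F" and B[measurable]: "B \<in> sets borel" by auto
    from A obtain A' where A': "A' \<in> sets N" "A = X -` A' \<inter> space M"
      unfolding sets by auto
    have "emeasure (distr M (?F \<Otimes>\<^sub>M borel) (\<lambda>\<omega>. (\<omega>, Y \<omega>))) (A \<times> B)
        = emeasure M ((\<lambda>\<omega>. (\<omega>, Y \<omega>)) -` (A \<times> B) \<inter> space M)"
      by (rule emeasure_distr) auto
    also have "(\<lambda>\<omega>. (\<omega>, Y \<omega>)) -` (A \<times> B) \<inter> space M = (X -` A' \<inter> space M) \<inter> (Y -` B \<inter> space M)"
      by (auto simp: A')
    also have "emeasure M ((X -` A' \<inter> space M) \<inter> (Y -` B \<inter> space M)) = emeasure M (X -` A' \<inter> space M) * emeasure M (Y -` B \<inter> space M)"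
      using ind[OF A'(1) B] by (simp add: emeasure_eq_measure ennreal_mult)
    also have "\<dots> = emeasure ?P A * emeasure ?Q B"
    proof -
      have "emeasure ?P A = emeasure M (X -` A' \<inter> space M)"
        using A by (subst emeasure_distr) (auto simp: A' intro!: arg_cong2[where f=emeasure])
      then show ?thesis by (simp add: emeasure_distr)
    qed
    finally show "emeasure ?P A * emeasure ?Q B = emeasure (distr M (?F \<Otimes>\<^sub>M borel) (\<lambda>\<omega>. (\<omega>, Y \<omega>))) (A \<times> B)"
      by simp
  qed
  note F[measurable]
  have "(\<integral>\<^sup>+\<omega>. F (\<omega>, Y \<omega>) \<partial>M) = (\<integral>\<^sup>+p. F p \<partial>distr M (?F \<Otimes>\<^sub>M borel) (\<lambda>\<omega>. (\<omega>, Y \<omega>)))"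
    by (subst nn_integral_distr) auto
  also have "\<dots> = (\<integral>\<^sup>+p. F p \<partial>(?P \<Otimes>\<^sub>M ?Q))"
    by (simp add: joint)
  also have "\<dots> = (\<integral>\<^sup>+\<omega>. \<integral>\<^sup>+y. F (\<omega>, y) \<partial>?Q \<partial>?P)"
    by (subst Q.nn_integral_fst[symmetric]) (auto cong: measurable_cong_sets)
  also have "\<dots> = (\<integral>\<^sup>+\<omega>. \<integral>\<^sup>+y. F (\<omega>, y) \<partial>?Q \<partial>M)"
    by (subst nn_integral_distr) (auto intro!: Q.borel_measurable_nn_integral_fst cong: measurable_cong_sets)
  also have "\<dots> = (\<integral>\<^sup>+\<omega>. \<integral>\<^sup>+\<omega>'. F (\<omega>, Y \<omega>') \<partial>M \<partial>M)"
  proof (rule nn_integral_cong)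
    fix \<omega> assume "\<omega> \<in> space M"
    then have [measurable]: "(\<lambda>y. F (\<omega>, y)) \<in> borel_measurable borel"
      using measurable_compose[OF measurable_Pair1' F, of \<omega>] by simp
    show "(\<integral>\<^sup>+y. F (\<omega>, y) \<partial>?Q) = (\<integral>\<^sup>+\<omega>'. F (\<omega>, Y \<omega>') \<partial>M)"
      by (subst nn_integral_distr) auto
  qed
  finally show ?thesis .
qed

lemma borel_measurable_vec_nth [measurable]: "(\<lambda>x::real^'d::finite. x $ i) \<in> borel_measurable borel"
  by (intro borel_measurable_continuous_onI continuous_intros)

lemma prod_Basis_vec: "(\<Prod>b\<in>(Basis :: (real^'d) set). f b) = (\<Prod>i\<in>UNIV. f (axis i 1))"
proof -
  have "(Basis :: (real^'d) set) = (\<lambda>i. axis i 1) ` UNIV"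
    by (auto simp: Basis_vec_def)
  moreover have "inj (\<lambda>i::'d. axis i (1::real))"
    by (auto simp: inj_on_def axis_eq_axis)
  ultimately show ?thesis
    unfolding \<open>Basis = _\<close> by (subst prod.reindex) auto
qed

lemma nn_integral_normal_density_scale:
  assumes s: "0 < s" and [measurable]: "f \<in> borel_measurable borel"
  shows "(\<integral>\<^sup>+x. ennreal (normal_density 0 s x) * f x \<partial>lborel) = (\<integral>\<^sup>+z. f (s * z) \<partial>gamma1)"
proof -
  have "(\<integral>\<^sup>+x. ennreal (normal_density 0 s x) * f x \<partial>lborel)
      = ennreal s * (\<integral>\<^sup>+z. ennreal (normal_density 0 s (s * z)) * f (s * z) \<partial>lborel)"
    using s by (subst nn_integral_real_affine[where c=s and t=0]) auto
  also have "\<dots> = (\<integral>\<^sup>+z. ennreal s * (ennreal (normal_density 0 s (s * z)) * f (s * z)) \<partial>lborel)"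
    by (rule nn_integral_cmult[symmetric]) simp
  also have "\<dots> = (\<integral>\<^sup>+z. ennreal (std_normal_density z) * f (s * z) \<partial>lborel)"
  proof (rule nn_integral_cong)
    fix z
    have "s * normal_density 0 s (s * z) = std_normal_density z"
      using s by (simp add: normal_density_def real_sqrt_mult power_mult_distrib)
    then show "ennreal s * (ennreal (normal_density 0 s (s * z)) * f (s * z)) = ennreal (std_normal_density z) * f (s * z)"
      using s by (simp add: mult.assoc[symmetric] ennreal_mult'[symmetric])
  qed
  also have "\<dots> = (\<integral>\<^sup>+z. f (s * z) \<partial>gamma1)"
    by (subst nn_integral_density) auto
  finally show ?thesis .
qed

section \<open>Gaussian vectors with independent coordinates\<close>

context
  fixes M :: "'w measure" and V :: "'w \<Rightarrow> real^'d::finite" and s :: real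
  assumes M: "prob_space M" and s: "0 < s"
    and dist: "distributed M lborel V (\<lambda>x. ennreal (\<Prod>i\<in>UNIV. normal_density 0 s (x $ i)))"
begin

interpretation prob_space M by (rule M)

lemma gaussian_vector_measurable: "V \<in> borel_measurable M"
  using distributed_measurable[OF dist] by simp

lemma nn_integral_gaussian_vector_prod:
  assumes [measurable]: "\<And>i. f i \<in> borel_measurable borel"
  shows "(\<integral>\<^sup>+\<omega>. (\<Prod>i\<in>UNIV. f i (V \<omega> $ i)) \<partial>M) = (\<Prod>i\<in>UNIV. \<integral>\<^sup>+z. f i (s * z) \<partial>gamma1)"
proof -
  \<comment> \<open>The product formula for \<open>lborel\<close> runs over \<open>Basis\<close>, so
    the factor of coordinate \<open>i\<close> is attached to the vector
    \<open>axis i 1\<close>.\<close>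
  define h where "h b = (\<lambda>y. \<Prod>i\<in>UNIV. if axis i 1 = b then ennreal (normal_density 0 s y) * f i y else 1)" for b :: "real^'d"
  have h_axis: "h (axis i 1) = (\<lambda>y. ennreal (normal_density 0 s y) * f i y)" for i
  proof
    fix y
    have "h (axis i 1) y = (\<Prod>j\<in>UNIV. if j = i then ennreal (normal_density 0 s y) * f j y else 1)"
      unfolding h_def by (intro prod.cong refl) (simp add: axis_eq_axis)
    then show "h (axis i 1) y = ennreal (normal_density 0 s y) * f i y" by simp
  qed
  have "(\<integral>\<^sup>+\<omega>. (\<Prod>i\<in>UNIV. f i (V \<omega> $ i)) \<partial>M)
      = (\<integral>\<^sup>+x. ennreal (\<Prod>i\<in>UNIV. normal_density 0 s (x $ i)) * (\<Prod>i\<in>UNIV. f i (x $ i)) \<partial>lborel)"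
    by (rule distributed_nn_integral[OF dist, symmetric]) simp
  also have "\<dots> = (\<integral>\<^sup>+x. (\<Prod>b\<in>Basis. h b (x \<bullet> b)) \<partial>lborel)"
    by (intro nn_integral_cong) (simp add: prod_Basis_vec h_axis inner_axis prod.distrib prod_ennreal)
  also have "\<dots> = (\<Prod>b\<in>Basis. \<integral>\<^sup>+y. h b y \<partial>lborel)"
    by (rule nn_integral_lborel_prod) (auto simp: h_def)
  also have "\<dots> = (\<Prod>i\<in>UNIV. \<integral>\<^sup>+z. f i (s * z) \<partial>gamma1)"
    using s by (simp add: prod_Basis_vec h_axis nn_integral_normal_density_scale)
  finally show ?thesis .
qed

lemma emeasure_gaussian_vector_box:
  assumes A: "\<And>i. A i \<in> sets borel"
  shows "emeasure M {\<omega>\<in>space M. \<forall>i. V \<omega> $ i \<in> A i} = (\<Prod>i\<in>UNIV. emeasure (gauss s) (A i))"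
proof -
  note gaussian_vector_measurable[measurable] A[measurable]
  have "emeasure M {\<omega>\<in>space M. \<forall>i. V \<omega> $ i \<in> A i} = (\<integral>\<^sup>+\<omega>. indicator {\<omega>\<in>space M. \<forall>i. V \<omega> $ i \<in> A i} \<omega> \<partial>M)"
    by (intro nn_integral_indicator[symmetric]) measurable
  also have "\<dots> = (\<integral>\<^sup>+\<omega>. (\<Prod>i\<in>UNIV. indicator (A i) (V \<omega> $ i)) \<partial>M)"
    by (intro nn_integral_cong) (auto simp: indicator_def prod_zero_iff)
  also have "\<dots> = (\<Prod>i\<in>UNIV. \<integral>\<^sup>+z. indicator (A i) (s * z) \<partial>gamma1)"
    by (rule nn_integral_gaussian_vector_prod) simp
  also have "\<dots> = (\<Prod>i\<in>UNIV. emeasure (gauss s) (A i))"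
    by (intro prod.cong refl) (simp add: nn_integral_gauss[symmetric])
  finally show ?thesis .
qed

lemma gaussian_vector_component_law: "distr M borel (\<lambda>\<omega>. V \<omega> $ i) = gauss s"
proof (rule measure_eqI)
  note gaussian_vector_measurable[measurable]
  fix A assume "A \<in> sets (distr M borel (\<lambda>\<omega>. V \<omega> $ i))"
  then have [measurable]: "A \<in> sets borel" by simp
  interpret g: real_distribution "gauss s" by (rule real_distribution_gauss)
  have "emeasure (distr M borel (\<lambda>\<omega>. V \<omega> $ i)) A = emeasure M {\<omega>\<in>space M. \<forall>j. V \<omega> $ j \<in> (if j = i then A else UNIV)}"
    by (subst emeasure_distr) (auto intro!: arg_cong2[where f=emeasure] split: if_splits)
  also have "\<dots> = (\<Prod>j\<in>UNIV. emeasure (gauss s) (if j = i then A else UNIV))"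
    by (rule emeasure_gaussian_vector_box) simp
  also have "\<dots> = (\<Prod>j\<in>UNIV. if j = i then emeasure (gauss s) A else 1)"
    using g.emeasure_space_1 by (intro prod.cong refl) auto
  finally show "emeasure (distr M borel (\<lambda>\<omega>. V \<omega> $ i)) A = emeasure (gauss s) A"
    by simp
qed simp

lemma gaussian_vector_indep: "indep_vars (\<lambda>_. borel) (\<lambda>i \<omega>. V \<omega> $ i) UNIV"
proof -
  note gaussian_vector_measurable[measurable]
  have em: "emeasure M ((\<lambda>\<omega>. V \<omega> $ i) -` A \<inter> space M) = emeasure (gauss s) A" if "A \<in> sets borel" for A i
    using that by (simp flip: gaussian_vector_component_law[of i] add: emeasure_distr)
  show ?thesis
  proof (subst indep_vars_finite[where E="\<lambda>_. sets borel"])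
    show "\<forall>A\<in>UNIV \<rightarrow> sets borel. prob (\<Inter>j\<in>UNIV. (\<lambda>\<omega>. V \<omega> $ j) -` A j \<inter> space M)
        = (\<Prod>j\<in>UNIV. prob ((\<lambda>\<omega>. V \<omega> $ j) -` A j \<inter> space M))"
    proof
      fix A :: "'d \<Rightarrow> real set" assume A: "A \<in> UNIV \<rightarrow> sets borel"
      have "ennreal (prob (\<Inter>j\<in>UNIV. (\<lambda>\<omega>. V \<omega> $ j) -` A j \<inter> space M)) = emeasure M {\<omega>\<in>space M. \<forall>i. V \<omega> $ i \<in> A i}"
        unfolding emeasure_eq_measure[symmetric] by (rule arg_cong2[where f=emeasure]) auto
      also have "\<dots> = (\<Prod>i\<in>UNIV. emeasure M ((\<lambda>\<omega>. V \<omega> $ i) -` A i \<inter> space M))"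
        using A by (subst emeasure_gaussian_vector_box) (auto simp: em Pi_iff)
      also have "\<dots> = ennreal (\<Prod>j\<in>UNIV. prob ((\<lambda>\<omega>. V \<omega> $ j) -` A j \<inter> space M))"
        by (simp add: emeasure_eq_measure prod_ennreal)
      finally show "prob (\<Inter>j\<in>UNIV. (\<lambda>\<omega>. V \<omega> $ j) -` A j \<inter> space M)
        = (\<Prod>j\<in>UNIV. prob ((\<lambda>\<omega>. V \<omega> $ j) -` A j \<inter> space M))"
        by (simp add: prod_nonneg)
    qed
  qed (auto simp: sets.sigma_sets_eq[of borel, simplified] Int_stable_def)
qed

lemma gaussian_vector_inner_law: "distr M borel (\<lambda>\<omega>. a \<bullet> V \<omega>) = gauss (s * norm a)"
proof -
  have "distr M borel (\<lambda>\<omega>. \<Sum>i\<in>UNIV. a $ i * V \<omega> $ i) = gauss (s * sqrt (\<Sum>i\<in>UNIV. (a $ i)\<^sup>2))"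
    by (rule gauss_linear_combination[OF gaussian_vector_indep]) (auto simp: gaussian_vector_component_law)
  then show ?thesis
    by (simp add: inner_vec_def norm_vec_def L2_set_def)
qed

text \<open>The density is even; this is the symmetry of the remaining increment on which Levy's
  inequality rests.\<close>

lemma gaussian_vector_uminus_norm_tail:
  "emeasure M {\<omega>\<in>space M. c \<le> norm (x + V \<omega>)} = emeasure M {\<omega>\<in>space M. c \<le> norm (x - V \<omega>)}"
proof -
  note gaussian_vector_measurable[measurable]
  let ?p = "\<lambda>x::real^'d. ennreal (\<Prod>i\<in>UNIV. normal_density 0 s (x $ i))"
  have em: "emeasure M {\<omega>\<in>space M. c \<le> norm (x + k *\<^sub>R V \<omega>)} = (\<integral>\<^sup>+y. ?p y * indicator {c..} (norm (x + k *\<^sub>R y)) \<partial>lborel)" for k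
  proof -
    have "emeasure M {\<omega>\<in>space M. c \<le> norm (x + k *\<^sub>R V \<omega>)} = (\<integral>\<^sup>+\<omega>. indicator {\<omega>\<in>space M. c \<le> norm (x + k *\<^sub>R V \<omega>)} \<omega> \<partial>M)"
      by (intro nn_integral_indicator[symmetric]) measurable
    also have "\<dots> = (\<integral>\<^sup>+\<omega>. indicator {c..} (norm (x + k *\<^sub>R V \<omega>)) \<partial>M)"
      by (intro nn_integral_cong) (auto simp: indicator_def)
    also have "\<dots> = (\<integral>\<^sup>+y. ?p y * indicator {c..} (norm (x + k *\<^sub>R y)) \<partial>lborel)"
      by (rule distributed_nn_integral[OF dist, symmetric]) simp
    finally show ?thesis .
  qed
  have "(\<integral>\<^sup>+y. ?p y * indicator {c..} (norm (x + y)) \<partial>lborel) = (\<integral>\<^sup>+y. ?p y * indicator {c..} (norm (x + y)) \<partial>distr lborel borel uminus)"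
    using lborel_affine[of "-1" "0 :: real^'d"] by (simp add: density_1)
  also have "\<dots> = (\<integral>\<^sup>+y. ?p y * indicator {c..} (norm (x - y)) \<partial>lborel)"
    by (subst nn_integral_distr) (auto simp: normal_density_def)
  finally show ?thesis
    using em[of 1] em[of "-1"] by simp
qed

end

text \<open>Generated by increments instead of values of \<open>W\<close>, because independence is
  assumed for increments. The times are arbitrary, so that after index \<open>k\<close> the path can
  also be continued by one long increment.\<close>

definition incr_sigma :: "'w measure \<Rightarrow> (real \<Rightarrow> 'w \<Rightarrow> real^'d::finite) \<Rightarrow> (nat \<Rightarrow> real) \<Rightarrow> nat \<Rightarrow> 'w measure" where
  "incr_sigma M W \<tau> k = vimage_algebra (space M) (\<lambda>\<omega>. \<lambda>i\<in>{..<k}. W (\<tau> (Suc i)) \<omega> - W (\<tau> i) \<omega>) (\<Pi>\<^sub>M i\<in>{..<k}. borel)"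

lemma incr_sigma_cong: "(\<And>i. i \<le> k \<Longrightarrow> \<tau> i = \<tau>' i) \<Longrightarrow> incr_sigma M W \<tau> k = incr_sigma M W \<tau>' k"
  unfolding incr_sigma_def by (intro arg_cong2[where f="vimage_algebra (space M)"] ext restrict_ext refl) auto

context
  fixes M :: "'w measure" and W :: "real \<Rightarrow> 'w \<Rightarrow> real^'d::finite"
  assumes bm: "brownian_motion M W"
begin

interpretation prob_space M using bm by (simp add: brownian_motion_def)

lemma bm_measurable: "0 \<le> t \<Longrightarrow> W t \<in> borel_measurable M"
  using bm by (simp add: brownian_motion_def)

lemma bm_distributed: "0 \<le> s \<Longrightarrow> s < t \<Longrightarrow> distributed M lborel (\<lambda>\<omega>. W t \<omega> - W s \<omega>)
    (\<lambda>x. ennreal (\<Prod>i\<in>UNIV. normal_density 0 (sqrt (t - s)) (x $ i)))"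
  using bm by (simp add: brownian_motion_def)

lemma bm_decouple:
  assumes \<tau>0: "0 \<le> \<tau> 0" and \<tau>: "\<And>i. i \<le> k \<Longrightarrow> \<tau> i < \<tau> (Suc i)"
    and F: "F \<in> borel_measurable (incr_sigma M W \<tau> k \<Otimes>\<^sub>M borel)"
  shows "(\<integral>\<^sup>+\<omega>. F (\<omega>, W (\<tau> (Suc k)) \<omega> - W (\<tau> k) \<omega>) \<partial>M)
      = (\<integral>\<^sup>+\<omega>. \<integral>\<^sup>+\<omega>'. F (\<omega>, W (\<tau> (Suc k)) \<omega>' - W (\<tau> k) \<omega>') \<partial>M \<partial>M)"
proof -
  let ?D = "\<lambda>i \<omega>. W (\<tau> (Suc i)) \<omega> - W (\<tau> i) \<omega>"
  let ?R = "\<lambda>A \<omega>. \<lambda>i\<in>A. ?D i \<omega>"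
  have ind: "indep_vars (\<lambda>_. borel) ?D {..<Suc k}"
    using bm \<tau>0 \<tau> by (auto simp: brownian_motion_def less_Suc_eq_le)
  have D[measurable]: "?D i \<in> borel_measurable M" if "i \<le> k" for i
    using ind that by (auto simp: indep_vars_def)
  have iv: "indep_var (\<Pi>\<^sub>M i\<in>{..<k}. borel) (?R {..<k}) (\<Pi>\<^sub>M i\<in>{k}. borel) (?R {k})"
    using indep_var_restrict[OF ind, of "{..<k}" "{k}"] by auto
  show ?thesis
  proof (rule decouple_vimage_algebra[OF _ _ _ F[unfolded incr_sigma_def]])
    show "?R {..<k} \<in> measurable M (\<Pi>\<^sub>M i\<in>{..<k}. borel)"
      using iv by (rule indep_var_rv1)
    show "?D k \<in> borel_measurable M" by simp
    fix A :: "(nat \<Rightarrow> real^'d) set" and B :: "(real^'d) set"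
    assume A: "A \<in> sets (\<Pi>\<^sub>M i\<in>{..<k}. borel)" and B: "B \<in> sets borel"
    let ?B = "(\<lambda>f. f k) -` B \<inter> space (\<Pi>\<^sub>M i\<in>{k}. borel)"
    have B': "?B \<in> sets (\<Pi>\<^sub>M i\<in>{k}. borel)"
      using B by (intro measurable_sets[OF measurable_component_singleton]) auto
    have "?R {k} -` ?B \<inter> space M = ?D k -` B \<inter> space M"
      by (auto simp: space_PiM PiE_iff extensional_def)
    moreover have "(\<lambda>x. (?R {..<k} x, ?R {k} x)) -` (A \<times> ?B) \<inter> space M = (?R {..<k} -` A \<inter> space M) \<inter> (?D k -` B \<inter> space M)"
      by (auto simp: space_PiM PiE_iff extensional_def)
    ultimately show "prob ((?R {..<k} -` A \<inter> space M) \<inter> (?D k -` B \<inter> space M))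
      = prob (?R {..<k} -` A \<inter> space M) * prob (?D k -` B \<inter> space M)"
      using indep_varD[OF iv A B'] by simp
  qed
qed

lemma bm_gaussian_walk:
  assumes \<delta>: "0 < \<delta>"
  shows "gaussian_walk M (incr_sigma M W (\<lambda>j. real j * \<delta>)) (\<lambda>j \<omega>. W (real (Suc j) * \<delta>) \<omega> - W (real j * \<delta>) \<omega>) J \<delta>"
proof unfold_locales
  let ?\<tau> = "\<lambda>j. real j * \<delta>"
  let ?D = "\<lambda>i \<omega>. W (?\<tau> (Suc i)) \<omega> - W (?\<tau> i) \<omega>"
  let ?R = "\<lambda>k \<omega>. \<lambda>i\<in>{..<k}. ?D i \<omega>"
  show "0 \<le> \<delta>" using \<delta> by simp
  have D[measurable]: "?D i \<in> borel_measurable M" for i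
    using \<delta> by (intro borel_measurable_diff bm_measurable) auto
  have R: "?R k \<in> measurable M (\<Pi>\<^sub>M i\<in>{..<k}. borel)" for k
    by (rule measurable_restrict) (rule D)
  have space: "space (incr_sigma M W ?\<tau> k) = space M" for k
    by (simp add: incr_sigma_def)
  have RF: "?R k \<in> measurable (incr_sigma M W ?\<tau> k) (\<Pi>\<^sub>M i\<in>{..<k}. borel)" for k
    unfolding incr_sigma_def using measurable_space[OF R[of k]] by (intro measurable_vimage_algebra1) auto
  have DF: "?D j \<in> borel_measurable (incr_sigma M W ?\<tau> k)" if "j < k" for j k
  proof -
    have "(\<lambda>\<omega>. ?R k \<omega> j) \<in> borel_measurable (incr_sigma M W ?\<tau> k)"
      using that by (intro measurable_compose[OF RF measurable_component_singleton]) simp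
    then show ?thesis using that by simp
  qed
  have sub: "subalgebra N (incr_sigma M W ?\<tau> k)" if "space N = space M" "\<And>j. j < k \<Longrightarrow> ?D j \<in> borel_measurable N" for N k
  proof -
    have "?R k \<in> measurable N (\<Pi>\<^sub>M i\<in>{..<k}. borel)"
      using that by (intro measurable_restrict) auto
    then have id: "(\<lambda>\<omega>. \<omega>) \<in> measurable N (incr_sigma M W ?\<tau> k)"
      unfolding incr_sigma_def using that(1) by (intro measurable_vimage_algebra2) auto
    have "A \<in> sets N" if A: "A \<in> sets (incr_sigma M W ?\<tau> k)" for A
    proof -
      have "(\<lambda>\<omega>. \<omega>) -` A \<inter> space N = A"
        using sets.sets_into_space[OF A] space \<open>space N = space M\<close> by auto
      then show ?thesis using measurable_sets[OF id A] by simp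
    qed
    then show ?thesis
      using space that(1) by (auto simp: subalgebra_def)
  qed
  show "subalgebra M (incr_sigma M W ?\<tau> j)" for j
    by (rule sub[OF refl D])
  show "subalgebra (incr_sigma M W ?\<tau> j) (incr_sigma M W ?\<tau> i)" if "i \<le> j" for i j
    using that by (intro sub DF) (auto simp: space)
  show "?D j \<in> borel_measurable (incr_sigma M W ?\<tau> (Suc j))" for j
    by (rule DF) simp
  show "(\<integral>\<^sup>+\<omega>. F (\<omega>, ?D j \<omega>) \<partial>M) = (\<integral>\<^sup>+\<omega>. \<integral>\<^sup>+\<omega>'. F (\<omega>, ?D j \<omega>') \<partial>M \<partial>M)"
    if "F \<in> borel_measurable (incr_sigma M W ?\<tau> j \<Otimes>\<^sub>M borel)" for j F
    by (rule bm_decouple[OF _ _ that]) (use \<delta> in auto)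
  show "distr M borel (\<lambda>\<omega>. a \<bullet> ?D j \<omega>) = gauss (sqrt \<delta> * norm a)" for j a
  proof -
    have "distributed M lborel (?D j) (\<lambda>x. ennreal (\<Prod>i\<in>UNIV. normal_density 0 (sqrt \<delta>) (x $ i)))"
      using bm_distributed[of "?\<tau> j" "?\<tau> (Suc j)"] \<delta> by (simp add: algebra_simps)
    from gaussian_vector_inner_law[OF prob_space_axioms _ this] \<delta> show ?thesis by simp
  qed
qed

text \<open>Let \<open>x\<close> be the position at the first passage and \<open>\<Delta>\<close>
  the increment from there to the last time. Since \<open>x + \<Delta>\<close> and
  \<open>x - \<Delta>\<close> add up to \<open>2 x\<close>, one of them has at least the norm of
  \<open>x\<close>. As \<open>\<Delta>\<close> is symmetric and independent of the past, the final
  position is beyond the level with conditional probability at least 1/2.\<close>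

lemma levy_maximal_inequality:
  assumes \<delta>: "0 < \<delta>" and a: "0 < a"
  shows "emeasure M {\<omega>\<in>space M. \<exists>k\<le>K. a \<le> norm (W (real k * \<delta>) \<omega> - W 0 \<omega>)}
    \<le> 2 * emeasure M {\<omega>\<in>space M. a \<le> norm (W (real K * \<delta>) \<omega> - W 0 \<omega>)}"
proof -
  let ?\<tau> = "\<lambda>j. real j * \<delta>"
  let ?V = "\<lambda>k \<omega>. W (?\<tau> k) \<omega> - W 0 \<omega>"
  define E where "E k = {\<omega>\<in>space M. a \<le> norm (?V k \<omega>)}" for k
  \<comment> \<open>The event that the first passage occurs at \<open>k\<close>; these events are
    disjoint.\<close>
  define H where "H k = {\<omega>\<in>space M. a \<le> norm (?V k \<omega>) \<and> (\<forall>i<k. norm (?V i \<omega>) < a)}" for k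
  interpret gaussian_walk M "incr_sigma M W ?\<tau>" "\<lambda>j \<omega>. W (?\<tau> (Suc j)) \<omega> - W (?\<tau> j) \<omega>" K \<delta>
    by (rule bm_gaussian_walk[OF \<delta>])
  have V_meas: "?V i \<in> borel_measurable (incr_sigma M W ?\<tau> k)" if "i \<le> k" "k \<le> K" for i k
  proof -
    have "?V i = (\<lambda>\<omega>. \<Sum>j<i. W (?\<tau> (Suc j)) \<omega> - W (?\<tau> j) \<omega>)"
    proof
      fix \<omega> show "?V i \<omega> = (\<Sum>j<i. W (?\<tau> (Suc j)) \<omega> - W (?\<tau> j) \<omega>)"
        using sum_lessThan_telescope[of "\<lambda>j. W (?\<tau> j) \<omega>" i] by simp
    qed
    moreover have "(\<lambda>\<omega>. \<Sum>j<i. W (?\<tau> (Suc j)) \<omega> - W (?\<tau> j) \<omega>) \<in> borel_measurable (incr_sigma M W ?\<tau> k)"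
      using that by (intro borel_measurable_sum Fil_measurable_mono[OF increment_measurable]) auto
    ultimately show ?thesis by simp
  qed
  have H_sets: "H k \<in> sets (incr_sigma M W ?\<tau> k)" if k: "k \<le> K" for k
  proof -
    have [measurable]: "?V i \<in> borel_measurable (incr_sigma M W ?\<tau> k)" if "i \<le> k" for i
      using V_meas[OF that k] .
    have "H k = {\<omega>\<in>space (incr_sigma M W ?\<tau> k). a \<le> norm (?V k \<omega>)} \<inter> (\<Inter>i\<in>{..k}. {\<omega>\<in>space (incr_sigma M W ?\<tau> k). i < k \<longrightarrow> norm (?V i \<omega>) < a})"
      using space_Fil[OF k] by (auto simp: H_def)
    also have "\<dots> \<in> sets (incr_sigma M W ?\<tau> k)"
    proof (intro sets.Int sets.finite_INT)
      show "{\<omega>\<in>space (incr_sigma M W ?\<tau> k). i < k \<longrightarrow> norm (?V i \<omega>) < a} \<in> sets (incr_sigma M W ?\<tau> k)" if "i \<in> {..k}" for i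
      proof -
        have [measurable]: "?V i \<in> borel_measurable (incr_sigma M W ?\<tau> k)" using V_meas[OF _ k] that by auto
        show ?thesis by measurable
      qed
    qed auto
    finally show ?thesis .
  qed
  have H_M[measurable]: "H k \<in> sets M" if "k \<le> K" for k
    using H_sets[OF that] subalgebra_Fil[OF that] by (auto simp: subalgebra_def)
  have E_M[measurable]: "E k \<in> sets M" if "k \<le> K" for k
  proof -
    have [measurable]: "?V k \<in> borel_measurable M" using Fil_measurable[OF V_meas[of k k]] that by auto
    show ?thesis unfolding E_def by measurable
  qed
  have half: "emeasure M (H k) \<le> 2 * emeasure M (H k \<inter> E K)" if k: "k \<le> K" for k
  proof (cases "k = K")
    case True
    then have "H k \<inter> E K = H k" by (auto simp: H_def E_def)
    then show ?thesis by (simp add: mult_2)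
  next
    case False
    with k have kK: "k < K" by simp
    \<comment> \<open>All times after \<open>k\<close> are moved to the last one, which makes the
      rest of the path a single increment. \<open>bm_decouple\<close> asks for strict growth only up
      to index \<open>Suc k\<close>.\<close>
    let ?\<sigma> = "\<lambda>j. if j \<le> k then ?\<tau> j else ?\<tau> K"
    let ?\<Delta> = "\<lambda>\<omega>. W (?\<tau> K) \<omega> - W (?\<tau> k) \<omega>"
    define F where "F = (\<lambda>(\<omega>, g). indicator (H k) \<omega> * indicator {a..} (norm (?V k \<omega> + g)) :: ennreal)"
    have eq: "incr_sigma M W ?\<sigma> k = incr_sigma M W ?\<tau> k" by (rule incr_sigma_cong) simp
    have [measurable]: "?V k \<in> borel_measurable (incr_sigma M W ?\<tau> k)" "H k \<in> sets (incr_sigma M W ?\<tau> k)"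
      using V_meas H_sets k by auto
    have F: "F \<in> borel_measurable (incr_sigma M W ?\<sigma> k \<Otimes>\<^sub>M borel)"
      unfolding F_def eq by measurable
    have \<Delta>: "distributed M lborel ?\<Delta> (\<lambda>x. ennreal (\<Prod>i\<in>UNIV. normal_density 0 (sqrt (?\<tau> K - ?\<tau> k)) (x $ i)))"
      using \<delta> kK by (intro bm_distributed) auto
    have \<Delta>m[measurable]: "?\<Delta> \<in> borel_measurable M" using distributed_measurable[OF \<Delta>] by simp
    have one: "1 \<le> 2 * (\<integral>\<^sup>+\<omega>'. indicator {a..} (norm (x + ?\<Delta> \<omega>')) \<partial>M)" if x: "a \<le> norm x" for x
    proof -
      have em: "(\<integral>\<^sup>+\<omega>'. indicator {a..} (norm (x + ?\<Delta> \<omega>')) \<partial>M) = emeasure M {\<omega>\<in>space M. a \<le> norm (x + ?\<Delta> \<omega>)}"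
      proof -
        have "(\<integral>\<^sup>+\<omega>'. indicator {a..} (norm (x + ?\<Delta> \<omega>')) \<partial>M) = (\<integral>\<^sup>+\<omega>'. indicator {\<omega>\<in>space M. a \<le> norm (x + ?\<Delta> \<omega>)} \<omega>' \<partial>M)"
          by (intro nn_integral_cong) (auto simp: indicator_def)
        also have "\<dots> = emeasure M {\<omega>\<in>space M. a \<le> norm (x + ?\<Delta> \<omega>)}"
          by (rule nn_integral_indicator) measurable
        finally show ?thesis .
      qed
      have "1 = emeasure M (space M)" by (simp add: emeasure_space_1)
      also have "\<dots> \<le> emeasure M ({\<omega>\<in>space M. a \<le> norm (x + ?\<Delta> \<omega>)} \<union> {\<omega>\<in>space M. a \<le> norm (x - ?\<Delta> \<omega>)})"
      proof (rule emeasure_mono)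
        show "space M \<subseteq> {\<omega>\<in>space M. a \<le> norm (x + ?\<Delta> \<omega>)} \<union> {\<omega>\<in>space M. a \<le> norm (x - ?\<Delta> \<omega>)}"
        proof
          fix \<omega> assume "\<omega> \<in> space M"
          moreover have "2 * norm x \<le> norm (x + ?\<Delta> \<omega>) + norm (x - ?\<Delta> \<omega>)"
          proof -
            have "(x + ?\<Delta> \<omega>) + (x - ?\<Delta> \<omega>) = 2 *\<^sub>R x"
              by (simp add: scaleR_2)
            then have "2 * norm x = norm ((x + ?\<Delta> \<omega>) + (x - ?\<Delta> \<omega>))"
              by simp
            then show ?thesis using norm_triangle_ineq by metis
          qed
          ultimately show "\<omega> \<in> {\<omega>\<in>space M. a \<le> norm (x + ?\<Delta> \<omega>)} \<union> {\<omega>\<in>space M. a \<le> norm (x - ?\<Delta> \<omega>)}"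
            using x by auto
        qed
      qed measurable
      also have "\<dots> \<le> emeasure M {\<omega>\<in>space M. a \<le> norm (x + ?\<Delta> \<omega>)} + emeasure M {\<omega>\<in>space M. a \<le> norm (x - ?\<Delta> \<omega>)}"
        by (intro emeasure_subadditive) measurable
      also have "\<dots> = 2 * emeasure M {\<omega>\<in>space M. a \<le> norm (x + ?\<Delta> \<omega>)}"
        using gaussian_vector_uminus_norm_tail[OF prob_space_axioms _ \<Delta>, of a x] \<delta> kK by (simp add: mult_2)
      finally show ?thesis by (simp add: em)
    qed
    have "emeasure M (H k) = (\<integral>\<^sup>+\<omega>. indicator (H k) \<omega> \<partial>M)" using k by simp
    also have "\<dots> \<le> (\<integral>\<^sup>+\<omega>. 2 * (\<integral>\<^sup>+\<omega>'. F (\<omega>, ?\<Delta> \<omega>') \<partial>M) \<partial>M)"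
    proof (rule nn_integral_mono)
      fix \<omega> show "indicator (H k) \<omega> \<le> 2 * (\<integral>\<^sup>+\<omega>'. F (\<omega>, ?\<Delta> \<omega>') \<partial>M)"
        using one[of "?V k \<omega>"] by (auto simp: F_def H_def indicator_def)
    qed
    also have "\<dots> = 2 * (\<integral>\<^sup>+\<omega>. \<integral>\<^sup>+\<omega>'. F (\<omega>, ?\<Delta> \<omega>') \<partial>M \<partial>M)"
    proof (rule nn_integral_cmult)
      have "H k \<in> sets M" "?V k \<in> borel_measurable M" using H_M[OF k] Fil_measurable[OF V_meas[of k k]] k by auto
      note this[measurable]
      show "(\<lambda>\<omega>. \<integral>\<^sup>+\<omega>'. F (\<omega>, ?\<Delta> \<omega>') \<partial>M) \<in> borel_measurable M"
        unfolding F_def by measurable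
    qed
    also have "(\<integral>\<^sup>+\<omega>. \<integral>\<^sup>+\<omega>'. F (\<omega>, ?\<Delta> \<omega>') \<partial>M \<partial>M) = (\<integral>\<^sup>+\<omega>. F (\<omega>, ?\<Delta> \<omega>) \<partial>M)"
      using bm_decouple[of ?\<sigma> k F] F \<delta> kK by simp
    also have "\<dots> = (\<integral>\<^sup>+\<omega>. indicator (H k \<inter> E K) \<omega> \<partial>M)"
      by (intro nn_integral_cong) (auto simp: F_def E_def indicator_def)
    also have "\<dots> = emeasure M (H k \<inter> E K)" using k by simp
    finally show ?thesis .
  qed
  have "{\<omega>\<in>space M. \<exists>k\<le>K. a \<le> norm (?V k \<omega>)} = (\<Union>k\<in>{..K}. H k)"
  proof (intro equalityI subsetI)
    fix \<omega> assume "\<omega> \<in> {\<omega>\<in>space M. \<exists>k\<le>K. a \<le> norm (?V k \<omega>)}"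
    then obtain k where k: "\<omega> \<in> space M" "k \<le> K" "a \<le> norm (?V k \<omega>)" by auto
    define l where "l = (LEAST k. a \<le> norm (?V k \<omega>))"
    have "a \<le> norm (?V l \<omega>)" "l \<le> k" using k(3) unfolding l_def by (auto intro: LeastI Least_le)
    moreover have "norm (?V i \<omega>) < a" if "i < l" for i
      using not_less_Least[OF that[unfolded l_def]] by simp
    ultimately show "\<omega> \<in> (\<Union>k\<in>{..K}. H k)" using k by (auto simp: H_def intro!: bexI[of _ l])
  qed (auto simp: H_def)
  then have "emeasure M {\<omega>\<in>space M. \<exists>k\<le>K. a \<le> norm (?V k \<omega>)} = (\<Sum>k\<in>{..K}. emeasure M (H k))"
  proof (simp, intro sum_emeasure[symmetric])
    show "disjoint_family_on H {..K}"
      by (auto simp: disjoint_family_on_def H_def) (metis linorder_neqE_nat not_le)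
  qed auto
  also have "\<dots> \<le> (\<Sum>k\<in>{..K}. 2 * emeasure M (H k \<inter> E K))"
    by (intro sum_mono half) auto
  also have "\<dots> = 2 * emeasure M (\<Union>k\<in>{..K}. H k \<inter> E K)"
    unfolding sum_distrib_left[symmetric]
  proof (intro arg_cong2[where f="(*)"] refl sum_emeasure)
    show "disjoint_family_on (\<lambda>k. H k \<inter> E K) {..K}"
      by (auto simp: disjoint_family_on_def H_def) (metis linorder_neqE_nat not_le)
  qed auto
  also have "\<dots> \<le> 2 * emeasure M (E K)"
    by (intro mult_left_mono emeasure_mono) auto
  finally show ?thesis by (simp add: E_def)
qed

end

section \<open>Exponential moments of running maxima\<close>

lemma ennreal_le_diff_if_add_le:
  "x + ennreal c \<le> ennreal r \<Longrightarrow> 0 \<le> c \<Longrightarrow> x \<le> ennreal (r - c)"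
  by (cases x) (auto simp: ennreal_plus[symmetric] ennreal_le_iff2 ennreal_leI top_unique simp del: ennreal_plus)

lemma two_mult_ennreal: "2 * ennreal r = ennreal (2 * r)"
  by (simp add: ennreal_mult')

text \<open>\<open>transform_tail\<close> for \<open>A\<close> and for its negative bounds the
  maximum by twice the two-sided tail of a centred Gaussian with variance
  \<open>\<Sum>j<K. v j\<close>. Then \<open>reflected_gaussian_constant\<close> with
  \<open>A = 0\<close> and \<open>d = 1\<close> produces the factor \<open>4 * ln 2\<close>.\<close>

lemma (in gaussian_walk) transform_max_exp_bound:
  fixes A :: "nat \<Rightarrow> 'w \<Rightarrow> real^'d" and v :: "nat \<Rightarrow> real"
  assumes A: "\<And>j. j < J \<Longrightarrow> A j \<in> borel_measurable (Fil j)"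
    and bound: "\<And>j \<omega>. j < J \<Longrightarrow> \<omega> \<in> space M \<Longrightarrow> \<delta> * (norm (A j \<omega>))\<^sup>2 \<le> v j"
    and K: "K \<le> J" and lam: "0 \<le> lam" "lam * (\<Sum>j<K. v j) \<le> 1/8"
  shows "(\<integral>\<^sup>+\<omega>. ennreal (exp (lam * (MAX k\<in>{..K}. \<bar>transform A k \<omega>\<bar>)\<^sup>2)) \<partial>M)
     \<le> ennreal (exp (4 * lam * (\<Sum>j<K. v j) * ln 2))"
proof -
  let ?X = "\<lambda>\<omega>. MAX k\<in>{..K}. \<bar>transform A k \<omega>\<bar>"
  define s where "s = sqrt (\<Sum>j<K. v j)"
  have v0: "0 \<le> v j" if "j < J" for j using v_nonneg[OF A bound that] by simp
  have s2: "s\<^sup>2 = (\<Sum>j<K. v j)" and s0: "0 \<le> s"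
    using K by (auto simp: s_def intro!: sum_nonneg v0)
  have ls: "0 \<le> lam * s\<^sup>2" "lam * s\<^sup>2 \<le> 1/8"
    using lam(1) lam(2)[folded s2] by simp_all
  have uminus: "transform (\<lambda>j \<omega>. - A j \<omega>) k \<omega> = - transform A k \<omega>" for k \<omega>
    by (simp add: transform_def[OF A bound] transform_def[of "\<lambda>j \<omega>. - A j \<omega>" v, OF borel_measurable_uminus[OF A]] bound sum_negf)
  have tm[measurable]: "transform A k \<in> borel_measurable M" if "k \<le> K" for k
    using that K by (intro Fil_measurable[OF transform_measurable[OF A bound]]) auto
  have Xm[measurable]: "?X \<in> borel_measurable M"
    by (intro borel_measurable_Max) auto
  have X0: "0 \<le> ?X \<omega>" for \<omega>
    by (rule order_trans[OF _ Max_ge[of _ "\<bar>transform A 0 \<omega>\<bar>"]]) auto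
  have tail: "emeasure M {\<omega>\<in>space M. a \<le> ?X \<omega>} \<le> 2 * emeasure gamma1 {z\<in>space gamma1. a \<le> s * \<bar>z\<bar>}" if a: "0 < a" for a
  proof -
    let ?I = "\<integral>\<^sup>+z. indicator {a..} (s * z) \<partial>gamma1"
    have sub: "{\<omega>\<in>space M. a \<le> ?X \<omega>} = {\<omega>\<in>space M. \<exists>k\<le>K. a \<le> transform A k \<omega>} \<union> {\<omega>\<in>space M. \<exists>k\<le>K. a \<le> transform (\<lambda>j \<omega>. - A j \<omega>) k \<omega>}"
    proof -
      have "a \<le> \<bar>y\<bar> \<longleftrightarrow> a \<le> y \<or> a \<le> - y" for y :: real by linarith
      then show ?thesis by (auto simp: Max_ge_iff uminus)
    qed
    have "emeasure M {\<omega>\<in>space M. a \<le> ?X \<omega>} \<le> emeasure M {\<omega>\<in>space M. \<exists>k\<le>K. a \<le> transform A k \<omega>} + emeasure M {\<omega>\<in>space M. \<exists>k\<le>K. a \<le> transform (\<lambda>j \<omega>. - A j \<omega>) k \<omega>}"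
      unfolding sub uminus by (intro emeasure_subadditive) measurable
    also have "\<dots> \<le> 2 * ?I + 2 * ?I"
      unfolding s_def by (intro add_mono transform_tail[OF A bound K a] transform_tail[of "\<lambda>j \<omega>. - A j \<omega>" v, OF borel_measurable_uminus[OF A] _ K a]) (auto intro: bound)
    also have "\<dots> = 2 * (?I + ?I)" by (simp add: distrib_left)
    also have "?I + ?I = ?I + (\<integral>\<^sup>+z. indicator {a..} (s * (-z)) \<partial>gamma1)"
      using nn_integral_gamma1_uminus[of "\<lambda>z. indicator {a..} (s * z)"] by simp
    also have "\<dots> = (\<integral>\<^sup>+z. indicator {a..} (s * z) + indicator {a..} (s * (-z)) \<partial>gamma1)"
      by (rule nn_integral_add[symmetric]) auto
    also have "\<dots> = (\<integral>\<^sup>+z. indicator {z. a \<le> s * \<bar>z\<bar>} z \<partial>gamma1)"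
    proof (rule nn_integral_cong)
      fix z
      have "z \<le> 0 \<Longrightarrow> s * z \<le> 0" "0 \<le> z \<Longrightarrow> 0 \<le> s * z"
        using s0 by (auto simp: mult_nonneg_nonpos)
      then have "a \<le> s * z \<Longrightarrow> 0 < z" "a \<le> s * (- z) \<Longrightarrow> z < 0"
        using a by (auto simp: not_le[symmetric])
      then show "indicator {a..} (s * z) + indicator {a..} (s * - z) = (indicator {z. a \<le> s * \<bar>z\<bar>} z :: ennreal)"
        by (cases "0 \<le> z") (auto simp: indicator_def)
    qed
    also have "\<dots> = emeasure gamma1 {z\<in>space gamma1. a \<le> s * \<bar>z\<bar>}"
      by (subst nn_integral_indicator) (auto intro: borel_measurable_le)
    finally show ?thesis .
  qed
  have "(\<integral>\<^sup>+\<omega>. ennreal (exp (lam * (0 + ?X \<omega>)\<^sup>2)) \<partial>M) + ennreal (exp (lam * 0\<^sup>2))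
      \<le> 2 * (\<integral>\<^sup>+z. ennreal (exp (lam * (0 + s * \<bar>z\<bar>)\<^sup>2)) \<partial>gamma1)"
    using s0 lam by (intro two_tail_exp_square prob_space_axioms prob_space_gamma1 X0 tail) auto
  also have "(\<integral>\<^sup>+z. ennreal (exp (lam * (0 + s * \<bar>z\<bar>)\<^sup>2)) \<partial>gamma1) = (\<integral>\<^sup>+z. ennreal (exp (lam * s\<^sup>2 * (z\<^sup>2 + 2 * 0 * \<bar>z\<bar>))) \<partial>gamma1)"
    by (simp add: power_mult_distrib mult.assoc)
  also have "\<dots> \<le> ennreal (1 / sqrt (1 - 2 * (lam * s\<^sup>2)) * exp (lam * s\<^sup>2 * (0\<^sup>2 / 3 + 4 * 0 / sqrt pi)))"
    by (intro nn_integral_gamma1_exp_bound ls) simp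
  finally have "(\<integral>\<^sup>+\<omega>. ennreal (exp (lam * (?X \<omega>)\<^sup>2)) \<partial>M) + ennreal 1 \<le> ennreal (2 * (1 / sqrt (1 - 2 * (lam * s\<^sup>2))))"
    unfolding two_mult_ennreal[symmetric] by (simp add: mult_left_mono)
  then have "(\<integral>\<^sup>+\<omega>. ennreal (exp (lam * (?X \<omega>)\<^sup>2)) \<partial>M) \<le> ennreal (2 * (1 / sqrt (1 - 2 * (lam * s\<^sup>2))) - 1)"
    by (rule ennreal_le_diff_if_add_le) simp
  also have "\<dots> \<le> ennreal (exp (4 * lam * (\<Sum>j<K. v j) * ln 2))"
    using reflected_gaussian_constant[OF ls, of 0 1] by (intro ennreal_leI) (simp add: s2 mult_ac)
  finally show ?thesis .
qed

text \<open>Levy's inequality reduces the maximum to the endpoint. There the squared norm is a sum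
  over coordinates, and in the cross term with \<open>q\<close> the norm is replaced by the larger
  sum of absolute coordinates, so the moment factorizes into \<open>d\<close> one-dimensional
  ones.\<close>

lemma bm_max_exp_bound:
  fixes W :: "real \<Rightarrow> 'w \<Rightarrow> real^'d::finite"
  assumes bm: "brownian_motion M W" and \<delta>: "0 < \<delta>" and K: "0 < K"
    and lam: "0 \<le> lam" "lam \<le> 1/8" and q: "0 \<le> q"
  shows "(\<integral>\<^sup>+\<omega>. ennreal (exp (lam * (q + (MAX k\<in>{..K}. norm (W (real k * \<delta>) \<omega> - W 0 \<omega>)) / sqrt (real K * \<delta>))\<^sup>2)) \<partial>M)
     \<le> ennreal (exp (lam * ((3 * real CARD('d) + 1) * q\<^sup>2 + 8 * real CARD('d) * q / sqrt pi + 4 * real CARD('d) * ln 2)))"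
proof -
  interpret prob_space M using bm by (simp add: brownian_motion_def)
  let ?d = "CARD('d)"
  define t where "t = real K * \<delta>"
  have t0: "0 < t" using \<delta> K by (simp add: t_def)
  let ?V = "\<lambda>k \<omega>. W (real k * \<delta>) \<omega> - W 0 \<omega>"
  let ?S = "\<lambda>\<omega>. MAX k\<in>{..K}. norm (?V k \<omega>)"
  have Vm[measurable]: "?V k \<in> borel_measurable M" for k
    using \<delta> by (intro borel_measurable_diff bm_measurable[OF bm]) auto
  have Sm[measurable]: "?S \<in> borel_measurable M"
    by (intro borel_measurable_Max) auto
  have S0: "0 \<le> ?S \<omega>" for \<omega>
    by (rule order_trans[OF _ Max_ge[of _ "norm (?V K \<omega>)"]]) auto
  have law: "distributed M lborel (?V K) (\<lambda>x. ennreal (\<Prod>i\<in>UNIV. normal_density 0 (sqrt t) (x $ i)))"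
    using bm_distributed[OF bm, of 0 t] t0 by (simp add: t_def)
  have tail: "emeasure M {\<omega>\<in>space M. a \<le> ?S \<omega>} \<le> 2 * emeasure M {\<omega>\<in>space M. a \<le> norm (?V K \<omega>)}" if "0 < a" for a
    using levy_maximal_inequality[OF bm \<delta> that, of K] by (simp add: Max_ge_iff Bex_def)
  define A where "A = lam * (q\<^sup>2 / 3 + 4 * q / sqrt pi)"
  define u where "u = 1 / sqrt (1 - 2 * lam)"
  have A0: "0 \<le> A" using lam q by (simp add: A_def)
  have u0: "0 \<le> u" using lam by (simp add: u_def)
  let ?f = "\<lambda>x. ennreal (exp (lam * ((x / sqrt t)\<^sup>2 + 2 * q * \<bar>x / sqrt t\<bar>)))"
  \<comment> \<open>\<open>two_tail_exp_square\<close> is applied to the path before scaling, where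
    the shift \<open>q\<close> becomes \<open>q * sqrt t\<close>.\<close>
  have resc: "lam / t * (q * sqrt t + y)\<^sup>2 = lam * (q + y / sqrt t)\<^sup>2" for y
  proof -
    have "q + y / sqrt t = (q * sqrt t + y) / sqrt t" using t0 by (simp add: field_simps)
    then show ?thesis using t0 by (simp add: power_divide)
  qed
  have "(\<integral>\<^sup>+\<omega>. ennreal (exp (lam * (q + norm (?V K \<omega>) / sqrt t)\<^sup>2)) \<partial>M)
      \<le> (\<integral>\<^sup>+\<omega>. ennreal (exp (lam * q\<^sup>2)) * (\<Prod>i\<in>UNIV. ?f (?V K \<omega> $ i)) \<partial>M)"
  proof (rule nn_integral_mono)
    fix \<omega>
    let ?x = "?V K \<omega>"
    have "(norm ?x)\<^sup>2 = (\<Sum>i\<in>UNIV. (?x $ i)\<^sup>2)"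
      by (simp add: norm_vec_def L2_set_def sum_nonneg)
    then have n2: "(norm ?x / sqrt t)\<^sup>2 = (\<Sum>i\<in>UNIV. (?x $ i / sqrt t)\<^sup>2)"
      using t0 by (simp add: power_divide sum_divide_distrib)
    have "norm ?x / sqrt t \<le> (\<Sum>i\<in>UNIV. \<bar>?x $ i\<bar>) / sqrt t"
      using t0 norm_le_l1_cart[of ?x] by (intro divide_right_mono) auto
    then have "2 * q * (norm ?x / sqrt t) \<le> 2 * q * ((\<Sum>i\<in>UNIV. \<bar>?x $ i\<bar>) / sqrt t)"
      using q by (intro mult_left_mono) auto
    then have n1: "2 * q * (norm ?x / sqrt t) \<le> (\<Sum>i\<in>UNIV. 2 * q * \<bar>?x $ i / sqrt t\<bar>)"
      using t0 by (simp add: sum_distrib_left[symmetric] sum_divide_distrib[symmetric])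
    have "(q + norm ?x / sqrt t)\<^sup>2 = q\<^sup>2 + (norm ?x / sqrt t)\<^sup>2 + 2 * q * (norm ?x / sqrt t)"
      by (simp add: power2_sum)
    also have "\<dots> \<le> q\<^sup>2 + (\<Sum>i\<in>UNIV. (?x $ i / sqrt t)\<^sup>2 + 2 * q * \<bar>?x $ i / sqrt t\<bar>)"
      unfolding n2 using n1 by (simp add: sum.distrib)
    finally have "exp (lam * (q + norm ?x / sqrt t)\<^sup>2) \<le> exp (lam * (q\<^sup>2 + (\<Sum>i\<in>UNIV. (?x $ i / sqrt t)\<^sup>2 + 2 * q * \<bar>?x $ i / sqrt t\<bar>)))"
      using lam by (simp add: mult_left_mono)
    also have "\<dots> = exp (lam * q\<^sup>2) * (\<Prod>i\<in>UNIV. exp (lam * ((?x $ i / sqrt t)\<^sup>2 + 2 * q * \<bar>?x $ i / sqrt t\<bar>)))"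
      by (simp only: distrib_left[of lam "q\<^sup>2"] exp_add[of "lam * q\<^sup>2"] sum_distrib_left exp_sum finite)
    finally show "ennreal (exp (lam * (q + norm ?x / sqrt t)\<^sup>2)) \<le> ennreal (exp (lam * q\<^sup>2)) * (\<Prod>i\<in>UNIV. ?f (?x $ i))"
      by (simp add: prod_ennreal ennreal_mult[symmetric] prod_nonneg ennreal_leI)
  qed
  also have "\<dots> = ennreal (exp (lam * q\<^sup>2)) * (\<integral>\<^sup>+\<omega>. (\<Prod>i\<in>UNIV. ?f (?V K \<omega> $ i)) \<partial>M)"
  proof (rule nn_integral_cmult)
    show "(\<lambda>\<omega>. \<Prod>i\<in>UNIV. ?f (?V K \<omega> $ i)) \<in> borel_measurable M" by measurable
  qed
  also have "(\<integral>\<^sup>+\<omega>. (\<Prod>i\<in>UNIV. ?f (?V K \<omega> $ i)) \<partial>M) = (\<Prod>i\<in>(UNIV::'d set). \<integral>\<^sup>+z. ?f (sqrt t * z) \<partial>gamma1)"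
    using t0 by (intro nn_integral_gaussian_vector_prod[OF prob_space_axioms _ law]) auto
  also have "\<dots> = (\<integral>\<^sup>+z. ennreal (exp (lam * (z\<^sup>2 + 2 * q * \<bar>z\<bar>))) \<partial>gamma1) ^ ?d"
    using t0 by simp
  also have "\<dots> \<le> ennreal (u * exp A) ^ ?d"
    unfolding u_def A_def by (intro power_mono nn_integral_gamma1_exp_bound lam q) auto
  finally have "(\<integral>\<^sup>+\<omega>. ennreal (exp (lam * (q + norm (?V K \<omega>) / sqrt t)\<^sup>2)) \<partial>M) \<le> ennreal (exp (lam * q\<^sup>2)) * ennreal (u * exp A) ^ ?d"
    by (simp add: mult_left_mono)
  then have VK: "(\<integral>\<^sup>+\<omega>. ennreal (exp (lam * (q + norm (?V K \<omega>) / sqrt t)\<^sup>2)) \<partial>M) \<le> ennreal (exp (lam * q\<^sup>2) * (u * exp A) ^ ?d)"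
    using u0 by (subst (asm) ennreal_power) (simp_all add: ennreal_mult'[symmetric])
  have "(\<integral>\<^sup>+\<omega>. ennreal (exp (lam / t * (q * sqrt t + ?S \<omega>)\<^sup>2)) \<partial>M) + ennreal (exp (lam / t * (q * sqrt t)\<^sup>2))
      \<le> 2 * (\<integral>\<^sup>+\<omega>. ennreal (exp (lam / t * (q * sqrt t + norm (?V K \<omega>))\<^sup>2)) \<partial>M)"
    using t0 lam q by (intro two_tail_exp_square prob_space_axioms S0 tail) auto
  then have "(\<integral>\<^sup>+\<omega>. ennreal (exp (lam * (q + ?S \<omega> / sqrt t)\<^sup>2)) \<partial>M) + ennreal (exp (lam * q\<^sup>2))
      \<le> 2 * (\<integral>\<^sup>+\<omega>. ennreal (exp (lam * (q + norm (?V K \<omega>) / sqrt t)\<^sup>2)) \<partial>M)"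
    using t0 unfolding resc by (simp add: power_mult_distrib)
  also have "\<dots> \<le> 2 * ennreal (exp (lam * q\<^sup>2) * (u * exp A) ^ ?d)"
    by (intro mult_left_mono VK) simp
  also have "\<dots> = ennreal (2 * (exp (lam * q\<^sup>2) * (u * exp A) ^ ?d))"
    by (simp add: ennreal_mult')
  finally have "(\<integral>\<^sup>+\<omega>. ennreal (exp (lam * (q + ?S \<omega> / sqrt t)\<^sup>2)) \<partial>M) \<le> ennreal (2 * (exp (lam * q\<^sup>2) * (u * exp A) ^ ?d) - exp (lam * q\<^sup>2))"
    by (rule ennreal_le_diff_if_add_le) simp
  also have "\<dots> \<le> ennreal (exp (lam * ((3 * real ?d + 1) * q\<^sup>2 + 8 * real ?d * q / sqrt pi + 4 * real ?d * ln 2)))"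
  proof (rule ennreal_leI)
    have "2 * (exp (lam * q\<^sup>2) * (u * exp A) ^ ?d) - exp (lam * q\<^sup>2) = exp (lam * q\<^sup>2) * (2 * (u * exp A) ^ ?d - 1)"
      by (simp add: algebra_simps)
    also have "\<dots> \<le> exp (lam * q\<^sup>2) * exp (real ?d * (4 * lam * ln 2 + 2 * A))"
      unfolding u_def by (intro mult_left_mono reflected_gaussian_constant lam A0) auto
    also have "\<dots> = exp (lam * (q\<^sup>2 + real ?d * (4 * ln 2 + 2 / 3 * q\<^sup>2 + 8 * q / sqrt pi)))"
      by (simp add: exp_add[symmetric] A_def algebra_simps)
    \<comment> \<open>The coefficient 2/3 of \<open>q\<^sup>2\<close> is enlarged to 3 to match the
      \<open>3 * d + 1\<close> in \<open>C_U\<close>.\<close>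
    also have "\<dots> \<le> exp (lam * (q\<^sup>2 + real ?d * (4 * ln 2 + 3 * q\<^sup>2 + 8 * q / sqrt pi)))"
      using lam by (intro exp_le_cancel_iff[THEN iffD2] mult_left_mono add_left_mono add_right_mono mult_right_mono) auto
    also have "\<dots> = exp (lam * ((3 * real ?d + 1) * q\<^sup>2 + 8 * real ?d * q / sqrt pi + 4 * real ?d * ln 2))"
      by (simp add: algebra_simps)
    finally show "2 * (exp (lam * q\<^sup>2) * (u * exp A) ^ ?d) - exp (lam * q\<^sup>2)
       \<le> exp (lam * ((3 * real ?d + 1) * q\<^sup>2 + 8 * real ?d * q / sqrt pi + 4 * real ?d * ln 2))" .
  qed
  finally show ?thesis by (simp add: t_def)
qed

section \<open>Ito's formula on a fine grid\<close>

text \<open>The working form of \<open>R1\<close>: Frechet derivatives replace the Jacobian matrix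
  and the iterated partial derivatives, and the sum in \<open>trace_bound\<close> is the Laplacian
  of \<open>b\<close>.\<close>

locale drift =
  fixes b :: "real^'d::finite \<Rightarrow> real^'d"
    and b' :: "real^'d \<Rightarrow> (real^'d) \<Rightarrow>\<^sub>L (real^'d)"
    and b'' :: "real^'d \<Rightarrow> (real^'d) \<Rightarrow>\<^sub>L ((real^'d) \<Rightarrow>\<^sub>L (real^'d))"
    and x0 :: "real^'d" and L a :: real
  assumes b_deriv: "\<And>x. (b has_derivative blinfun_apply (b' x)) (at x)"
    and b'_deriv: "\<And>x. (b' has_derivative blinfun_apply (b'' x)) (at x)"
    and b''_cont: "continuous_on UNIV b''"
    and b'_bound: "\<And>x. norm (b' x) \<le> L"
    and L_pos: "0 < L" and a_nonneg: "0 \<le> a"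
    and trace_bound: "\<And>x. norm (\<Sum>i\<in>UNIV. b'' x (axis i 1) (axis i 1)) \<le> 2 * a * (1 + norm (x - x0))"

text \<open>A Frechet derivative is unique, so \<open>b'\<close> is the Jacobian matrix as an
  operator. For the Laplacian the chain rule is applied twice along the lines
  \<open>x + s *\<^sub>R axis i 1\<close>.\<close>

lemma R1_imp_drift:
  fixes b :: "real^'d::finite \<Rightarrow> real^'d"
  assumes "R1 b x0 L a"
  obtains b' b'' where "drift b b' b'' x0 L a"
proof -
  from assms have C2: "C2 b" and L: "0 < L" and a: "0 \<le> a"
    and jac: "\<And>x. matrix_norm (jacobian b (at x)) \<le> L"
    and lap: "\<And>x. norm (vec_laplacian b x) \<le> 2 * a * (1 + norm (x - x0))"
    by (auto simp: R1_def)
  from C2 obtain b' b'' where d1: "\<And>x. (b has_derivative blinfun_apply (b' x)) (at x)"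
    and d2: "\<And>x. (b' has_derivative blinfun_apply (b'' x)) (at x)" and cont: "continuous_on UNIV b''"
    unfolding C2_def by blast
  have "norm (b' x) \<le> L" for x
  proof -
    have "(\<lambda>v. jacobian b (at x) *v v) = blinfun_apply (b' x)"
    proof (rule has_derivative_unique[OF _ d1])
      show "(b has_derivative (\<lambda>v. jacobian b (at x) *v v)) (at x)"
        using d1[of x] by (subst jacobian_works[symmetric]) (auto simp: differentiable_def)
    qed
    then show ?thesis using jac[of x] by (simp add: matrix_norm_def norm_blinfun.rep_eq)
  qed
  moreover have "vec_laplacian b x = (\<Sum>i\<in>UNIV. b'' x (axis i 1) (axis i 1))" for x
  proof -
    have p1: "partial_deriv i (\<lambda>y. b y $ j) z = b' z (axis i 1) $ j" for i j z
    proof -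
      have "((\<lambda>s. b (z + s *\<^sub>R axis i 1) $ j) has_derivative (\<lambda>s. b' z (s *\<^sub>R axis i 1) $ j)) (at 0)"
      proof (rule has_derivative_compose[where f="\<lambda>s. z + s *\<^sub>R axis i 1" and g="\<lambda>y. b y $ j" and g'="\<lambda>h. b' z h $ j"])
        show "((\<lambda>y. b y $ j) has_derivative (\<lambda>h. b' z h $ j)) (at (z + 0 *\<^sub>R axis i 1))"
          using bounded_linear.has_derivative[OF bounded_linear_vec_nth d1] by simp
      qed (auto intro!: derivative_eq_intros)
      then have "((\<lambda>s. b (z + s *\<^sub>R axis i 1) $ j) has_field_derivative (b' z (axis i 1) $ j)) (at 0)"
        by (simp add: has_field_derivative_def blinfun.scaleR_right mult_commute_abs)
      then show ?thesis unfolding partial_deriv_def by (rule DERIV_imp_deriv)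
    qed
    have p2: "partial_deriv i (\<lambda>z. b' z (axis i 1) $ j) x = b'' x (axis i 1) (axis i 1) $ j" for i j
    proof -
      have bl: "bounded_linear (\<lambda>A :: (real^'d) \<Rightarrow>\<^sub>L (real^'d). blinfun_apply A (axis i 1) $ j)"
        by (rule bounded_linear_compose[OF bounded_linear_vec_nth blinfun.bounded_linear_left])
      have "((\<lambda>s. b' (x + s *\<^sub>R axis i 1) (axis i 1) $ j) has_derivative (\<lambda>s. b'' x (s *\<^sub>R axis i 1) (axis i 1) $ j)) (at 0)"
      proof (rule has_derivative_compose[where f="\<lambda>s. x + s *\<^sub>R axis i 1" and g="\<lambda>y. b' y (axis i 1) $ j" and g'="\<lambda>h. b'' x h (axis i 1) $ j"])
        show "((\<lambda>y. b' y (axis i 1) $ j) has_derivative (\<lambda>h. b'' x h (axis i 1) $ j)) (at (x + 0 *\<^sub>R axis i 1))"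
          using bounded_linear.has_derivative[OF bl d2] by simp
      qed (auto intro!: derivative_eq_intros)
      then have "((\<lambda>s. b' (x + s *\<^sub>R axis i 1) (axis i 1) $ j) has_field_derivative (b'' x (axis i 1) (axis i 1) $ j)) (at 0)"
        by (simp add: has_field_derivative_def blinfun.scaleR_right blinfun.scaleR_left mult_commute_abs)
      then show ?thesis unfolding partial_deriv_def by (rule DERIV_imp_deriv)
    qed
    have "partial_deriv i (\<lambda>y. b y $ j) = (\<lambda>z. b' z (axis i 1) $ j)" for i j
      by (rule ext) (rule p1)
    then show ?thesis
      by (simp add: vec_eq_iff vec_laplacian_def laplacian_def p2)
  qed
  ultimately have "drift b b' b'' x0 L a"
    using d1 d2 cont L a lap by unfold_locales auto
  then show ?thesis by (rule that)
qed

context drift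
begin

lemma b_lipschitz: "norm (b x - b y) \<le> L * norm (x - y)"
  by (rule differentiable_bound[where S=UNIV and f'="\<lambda>x. blinfun_apply (b' x)"])
     (use b_deriv b'_bound in \<open>auto simp: norm_blinfun.rep_eq[symmetric]\<close>)

lemma b_growth: "norm (b x) \<le> norm (b x0) + L * norm (x - x0)"
  using b_lipschitz[of x x0] norm_triangle_ineq2[of "b x" "b x0"] by linarith

lemma continuous_b: "continuous_on S b"
  using b_deriv by (meson continuous_on_subset has_derivative_continuous_on has_derivative_at_withinI subset_UNIV)

lemma continuous_b': "continuous_on S b'"
  using b'_deriv by (meson continuous_on_subset has_derivative_continuous_on has_derivative_at_withinI subset_UNIV)

text \<open>Two applications of the mean value inequality, first to \<open>b'\<close> and then to
  \<open>b\<close>. As \<open>b''\<close> is merely continuous, the error is expressed by its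
  oscillation \<open>e\<close> on the segment.\<close>

lemma second_order_taylor:
  assumes e: "\<And>s. s \<in> {0..1} \<Longrightarrow> norm (b'' (y + s *\<^sub>R v) - b'' y) \<le> e"
  shows "norm (b (y + v) - b y - b' y v - (1/2) *\<^sub>R b'' y v v) \<le> e * (norm v)\<^sup>2"
proof -
  have e0: "0 \<le> e" using e[of 0] by simp
  have seg: "((\<lambda>s. y + s *\<^sub>R v) has_derivative (\<lambda>h. h *\<^sub>R v)) (at s within {0..1})" for s
    by (auto intro!: derivative_eq_intros)
  have first: "norm (b' (y + s *\<^sub>R v) - b' y - s *\<^sub>R b'' y v) \<le> e * norm v" if s: "s \<in> {0..1}" for s
  proof -
    let ?g = "\<lambda>s. b' (y + s *\<^sub>R v) - s *\<^sub>R b'' y v"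
    have d: "(?g has_derivative (\<lambda>h. h *\<^sub>R (b'' (y + r *\<^sub>R v) v - b'' y v))) (at r within {0..1})" for r
    proof -
      have "((\<lambda>s. b' (y + s *\<^sub>R v)) has_derivative (\<lambda>h. b'' (y + r *\<^sub>R v) (h *\<^sub>R v))) (at r within {0..1})"
        by (rule has_derivative_compose[OF seg b'_deriv])
      then show ?thesis
        by (auto intro!: derivative_eq_intros simp: blinfun.scaleR_right scaleR_diff_right)
    qed
    have "norm (?g s - ?g 0) \<le> (e * norm v) * norm (s - 0)"
    proof (rule differentiable_bound[where S="{0..1}", OF _ d])
      fix r :: real assume r: "r \<in> {0..1}"
      have "norm (b'' (y + r *\<^sub>R v) v - b'' y v) \<le> norm (b'' (y + r *\<^sub>R v) - b'' y) * norm v"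
        using norm_blinfun[of "b'' (y + r *\<^sub>R v) - b'' y" v] by (simp add: blinfun.diff_left)
      also have "\<dots> \<le> e * norm v" using e[OF r] by (intro mult_right_mono) auto
      finally show "onorm (\<lambda>h. h *\<^sub>R (b'' (y + r *\<^sub>R v) v - b'' y v)) \<le> e * norm v"
        by (intro onorm_bound mult_nonneg_nonneg e0) (auto simp: mult.commute intro!: mult_left_mono)
    qed (use s in auto)
    also have "\<dots> \<le> (e * norm v) * 1"
      using s e0 by (intro mult_left_mono) auto
    finally show ?thesis by (simp add: algebra_simps)
  qed
  let ?h = "\<lambda>s. b (y + s *\<^sub>R v) - s *\<^sub>R b' y v - (s\<^sup>2 / 2) *\<^sub>R b'' y v v"
  have d: "(?h has_derivative (\<lambda>h. h *\<^sub>R (b' (y + r *\<^sub>R v) v - b' y v - r *\<^sub>R b'' y v v))) (at r within {0..1})" for r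
  proof -
    have "((\<lambda>s. b (y + s *\<^sub>R v)) has_derivative (\<lambda>h. b' (y + r *\<^sub>R v) (h *\<^sub>R v))) (at r within {0..1})"
      by (rule has_derivative_compose[OF seg b_deriv])
    then show ?thesis
      by (auto intro!: derivative_eq_intros simp: blinfun.scaleR_right scaleR_diff_right algebra_simps)
  qed
  have "norm (?h 1 - ?h 0) \<le> (e * (norm v)\<^sup>2) * norm (1 - 0 :: real)"
  proof (rule differentiable_bound[where S="{0..1}", OF _ d])
    fix r :: real assume r: "r \<in> {0..1}"
    have "norm (b' (y + r *\<^sub>R v) v - b' y v - r *\<^sub>R b'' y v v) \<le> norm (b' (y + r *\<^sub>R v) - b' y - r *\<^sub>R b'' y v) * norm v"
      using norm_blinfun[of "b' (y + r *\<^sub>R v) - b' y - r *\<^sub>R b'' y v" v] by (simp add: blinfun.diff_left blinfun.scaleR_left)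
    also have "\<dots> \<le> (e * norm v) * norm v" using first[OF r] by (intro mult_right_mono) auto
    finally have "norm (b' (y + r *\<^sub>R v) v - b' y v - r *\<^sub>R b'' y v v) \<le> e * norm v * norm v" .
    then show "onorm (\<lambda>h. h *\<^sub>R (b' (y + r *\<^sub>R v) v - b' y v - r *\<^sub>R b'' y v v)) \<le> e * (norm v)\<^sup>2"
    proof (intro onorm_bound)
      fix h :: real
      assume "norm (b' (y + r *\<^sub>R v) v - b' y v - r *\<^sub>R b'' y v v) \<le> e * norm v * norm v"
      then have "\<bar>h\<bar> * norm (b' (y + r *\<^sub>R v) v - b' y v - r *\<^sub>R b'' y v v) \<le> \<bar>h\<bar> * (e * norm v * norm v)"
        by (rule mult_left_mono) simp
      then show "norm (h *\<^sub>R (b' (y + r *\<^sub>R v) v - b' y v - r *\<^sub>R b'' y v v)) \<le> e * (norm v)\<^sup>2 * norm h"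
        by (simp add: power2_eq_square mult_ac)
    qed (use e0 in auto)
  qed auto
  then show ?thesis by (simp add: algebra_simps)
qed

definition ito_remainder :: "real \<Rightarrow> real^'d \<Rightarrow> real^'d \<Rightarrow> real^'d \<Rightarrow> real^'d" where
  "ito_remainder \<delta> \<beta> y g = b (y + \<delta> *\<^sub>R \<beta> + g) - b y - b' y g
     - \<delta> *\<^sub>R (b' y \<beta> + (1/2) *\<^sub>R (\<Sum>i\<in>UNIV. b'' y (axis i 1) (axis i 1)))"

text \<open>The second-order term in \<open>g\<close> minus its mean. One such term has the same
  order \<open>\<delta>\<close> as the drift; only cancellation in the sum makes it vanish.\<close>

definition ito_quadratic :: "real \<Rightarrow> real^'d \<Rightarrow> real^'d \<Rightarrow> real^'d" where
  "ito_quadratic \<delta> y g = (1/2) *\<^sub>R (b'' y g g - \<delta> *\<^sub>R (\<Sum>i\<in>UNIV. b'' y (axis i 1) (axis i 1)))"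

lemma b''_bounded_on_ball:
  obtains C where "0 \<le> C" "\<And>y. norm (y - x0) \<le> R \<Longrightarrow> norm (b'' y) \<le> C"
proof -
  have "compact (b'' ` cball x0 R)"
    by (intro compact_continuous_image continuous_on_subset[OF b''_cont]) auto
  then obtain C where C: "\<And>z. z \<in> b'' ` cball x0 R \<Longrightarrow> norm z \<le> C"
    using compact_imp_bounded bounded_iff by metis
  show ?thesis
  proof
    show "0 \<le> max 0 C" by simp
    show "norm (b'' y) \<le> max 0 C" if "norm (y - x0) \<le> R" for y
      using C[of "b'' y"] that by (force simp: dist_norm norm_minus_commute)
  qed
qed

lemma b''_uniformly_continuous_on_ball:
  assumes "0 < e"
  obtains \<eta> where "0 < \<eta>" "\<And>y w :: real^'d. norm (y - x0) \<le> R \<Longrightarrow> norm w \<le> \<eta> \<Longrightarrow> norm (b'' (y + w) - b'' y) \<le> e"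
proof -
  \<comment> \<open>The larger radius leaves room for \<open>y + w\<close>, since \<open>w\<close>
    will have norm at most 1.\<close>
  have "uniformly_continuous_on (cball x0 (R + 1)) b''"
    by (intro compact_uniformly_continuous continuous_on_subset[OF b''_cont]) auto
  then obtain \<eta> where \<eta>: "0 < \<eta>" "\<And>y z. y \<in> cball x0 (R + 1) \<Longrightarrow> z \<in> cball x0 (R + 1) \<Longrightarrow> dist z y < \<eta> \<Longrightarrow> dist (b'' z) (b'' y) < e"
    unfolding uniformly_continuous_on_def using assms by metis
  show ?thesis
  proof
    show "0 < min 1 (\<eta> / 2)" using \<eta> by simp
    fix y w :: "real^'d" assume y: "norm (y - x0) \<le> R" and w: "norm w \<le> min 1 (\<eta> / 2)"
    have "dist x0 (y + w) \<le> norm (y - x0) + norm w"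
      using norm_triangle_ineq[of "y - x0" w] by (simp add: dist_norm norm_minus_commute algebra_simps)
    then have "dist (b'' (y + w)) (b'' y) < e"
      using y w \<eta>(1) by (intro \<eta>(2)) (auto simp: dist_norm norm_minus_commute)
    then show "norm (b'' (y + w) - b'' y) \<le> e" by (simp add: dist_norm)
  qed
qed

text \<open>Apart from the quadratic term in \<open>g\<close>, only the Taylor error and
  second-order terms that contain the drift \<open>\<delta> *\<^sub>R \<beta>\<close> remain; the
  latter are of higher order.\<close>

lemma ito_remainder_bound:
  assumes y: "norm (y - x0) \<le> R" and \<beta>: "norm \<beta> \<le> B" and \<delta>: "0 \<le> \<delta>" and C: "norm (b'' y) \<le> C"
    and v: "norm (\<delta> *\<^sub>R \<beta> + g) \<le> \<eta>"
    and \<eta>: "\<And>w. norm w \<le> \<eta> \<Longrightarrow> norm (b'' (y + w) - b'' y) \<le> e"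
  shows "norm (ito_remainder \<delta> \<beta> y g - ito_quadratic \<delta> y g)
    \<le> e * (norm (\<delta> *\<^sub>R \<beta> + g))\<^sup>2 + C * (2 * \<delta> * B * norm g + \<delta>\<^sup>2 * B\<^sup>2)"
proof -
  let ?v = "\<delta> *\<^sub>R \<beta> + g"
  have B0: "0 \<le> B" using \<beta> norm_ge_zero order_trans by blast
  have C0: "0 \<le> C" using C norm_ge_zero order_trans by blast
  have T: "norm (b (y + ?v) - b y - b' y ?v - (1/2) *\<^sub>R b'' y ?v ?v) \<le> e * (norm ?v)\<^sup>2"
  proof (rule second_order_taylor)
    fix s :: real assume s: "s \<in> {0..1}"
    have "norm (s *\<^sub>R ?v) \<le> 1 * norm ?v" unfolding norm_scaleR using s by (intro mult_right_mono) auto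
    then show "norm (b'' (y + s *\<^sub>R ?v) - b'' y) \<le> e" using v by (intro \<eta>) linarith
  qed
  \<comment> \<open>With \<open>v = \<delta> *\<^sub>R \<beta> + g\<close>, bilinearity gives
    \<open>b''(v, v) - b''(g, g) = b''(\<delta> \<beta>, v) + b''(g, \<delta>
    \<beta>)\<close>.\<close>
  have eq: "ito_remainder \<delta> \<beta> y g - ito_quadratic \<delta> y g
      = (b (y + ?v) - b y - b' y ?v - (1/2) *\<^sub>R b'' y ?v ?v) + (1/2) *\<^sub>R (b'' y (\<delta> *\<^sub>R \<beta>) ?v + b'' y g (\<delta> *\<^sub>R \<beta>))"
    unfolding ito_remainder_def ito_quadratic_def
    by (simp add: blinfun.add_right blinfun.add_left scaleR_add_right scaleR_diff_right blinfun.scaleR_right add.assoc)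
  have bil: "norm (b'' y u w) \<le> C * norm u * norm w" for u w
  proof -
    have "norm (b'' y u w) \<le> norm (b'' y u) * norm w" by (rule norm_blinfun)
    also have "\<dots> \<le> (norm (b'' y) * norm u) * norm w" by (intro mult_right_mono norm_blinfun) auto
    also have "\<dots> \<le> C * norm u * norm w" using C by (intro mult_right_mono) auto
    finally show ?thesis .
  qed
  have nb: "norm (\<delta> *\<^sub>R \<beta>) \<le> \<delta> * B" using \<beta> \<delta> by (simp add: mult_left_mono)
  have "norm (b'' y (\<delta> *\<^sub>R \<beta>) ?v + b'' y g (\<delta> *\<^sub>R \<beta>)) \<le> C * norm (\<delta> *\<^sub>R \<beta>) * norm ?v + C * norm g * norm (\<delta> *\<^sub>R \<beta>)"
    by (intro order_trans[OF norm_triangle_ineq] add_mono bil)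
  also have "\<dots> \<le> C * (\<delta> * B) * (\<delta> * B + norm g) + C * norm g * (\<delta> * B)"
    using nb C0 \<delta> B0 norm_triangle_ineq[of "\<delta> *\<^sub>R \<beta>" g]
    by (intro add_mono mult_mono mult_left_mono mult_nonneg_nonneg) auto
  also have "\<dots> = C * (2 * \<delta> * B * norm g + \<delta>\<^sup>2 * B\<^sup>2)"
    by (simp add: power2_eq_square algebra_simps)
  finally have 2: "norm (b'' y (\<delta> *\<^sub>R \<beta>) ?v + b'' y g (\<delta> *\<^sub>R \<beta>)) \<le> C * (2 * \<delta> * B * norm g + \<delta>\<^sup>2 * B\<^sup>2)" .
  then have "norm ((1/2) *\<^sub>R (b'' y (\<delta> *\<^sub>R \<beta>) ?v + b'' y g (\<delta> *\<^sub>R \<beta>))) \<le> C * (2 * \<delta> * B * norm g + \<delta>\<^sup>2 * B\<^sup>2)"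
    using norm_ge_zero[of "b'' y (\<delta> *\<^sub>R \<beta>) ?v + b'' y g (\<delta> *\<^sub>R \<beta>)"] unfolding norm_scaleR by linarith
  then show ?thesis
    unfolding eq using T by (intro order_trans[OF norm_triangle_ineq] add_mono)
qed

text \<open>Each summand is a coefficient determined by \<open>y\<close> times a centred product of
  coordinates of \<open>g\<close>, so that after summation over time every pair \<open>i\<close>,
  \<open>j\<close> gives a scalar martingale transform.\<close>

lemma ito_quadratic_component:
  "ito_quadratic \<delta> y g $ k = (\<Sum>i\<in>UNIV. \<Sum>j\<in>UNIV. (b'' y (axis i 1) (axis j 1) $ k / 2) * (g $ i * g $ j - (if i = j then \<delta> else 0)))"
proof -
  have g: "g = (\<Sum>i\<in>UNIV. g $ i *\<^sub>R axis i 1)"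
    by (simp add: vec_eq_iff axis_def if_distrib[of "\<lambda>x. _ * x"] cong: if_cong)
  have "b'' y g g = (\<Sum>i\<in>UNIV. \<Sum>j\<in>UNIV. (g $ i * g $ j) *\<^sub>R b'' y (axis i 1) (axis j 1))"
    by (subst (1 2) g, simp add: blinfun.sum_right blinfun.sum_left blinfun.scaleR_right blinfun.scaleR_left scaleR_sum_right,
        subst sum.swap, simp add: mult.commute)
  moreover have "(\<Sum>j\<in>UNIV. X j / 2 * (p j - (if i = j then \<delta> else 0))) = (\<Sum>j\<in>UNIV. X j / 2 * p j) - X i / 2 * \<delta>"
    for X p :: "'d \<Rightarrow> real" and i
    by (simp add: right_diff_distrib sum_subtractf if_distrib[of "\<lambda>x. _ * x"] cong: if_cong)
  ultimately show ?thesis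
    by (simp add: ito_quadratic_def sum_subtractf sum_divide_distrib sum_distrib_left diff_divide_distrib mult_ac)
qed

end

section \<open>Moments of Gaussian increments and of martingale transforms\<close>

lemma emeasure_gt_le_nn_integral:
  assumes [measurable]: "f \<in> borel_measurable M" and r: "0 < r" and c: "(\<integral>\<^sup>+\<omega>. ennreal (f \<omega>) \<partial>M) \<le> ennreal c"
  shows "emeasure M {\<omega>\<in>space M. r < f \<omega>} \<le> ennreal (c / r)"
proof -
  have "emeasure M {\<omega>\<in>space M. r < f \<omega>} \<le> emeasure M {\<omega>\<in>space M. 1 \<le> ennreal (1 / r) * ennreal (f \<omega>)}"
    using r by (intro emeasure_mono) (auto simp: ennreal_mult'[symmetric] ennreal_1[symmetric] field_simps simp del: ennreal_1)
  also have "\<dots> \<le> ennreal (1 / r) * (\<integral>\<^sup>+\<omega>. ennreal (f \<omega>) \<partial>M)"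
    using nn_integral_Markov_inequality[of "\<lambda>\<omega>. ennreal (f \<omega>)" "space M" M "ennreal (1 / r)"] by (simp add: Collect_conj_eq[symmetric] conj_ac cong: conj_cong)
  also have "\<dots> \<le> ennreal (1 / r) * ennreal c"
    by (intro mult_left_mono c) simp
  also have "\<dots> = ennreal (c / r)"
    using r by (simp add: ennreal_mult'[symmetric])
  finally show ?thesis .
qed

context gaussian_walk
begin

lemma increment_moment:
  assumes j: "j < J"
  shows "integrable M (\<lambda>\<omega>. (u \<bullet> G j \<omega>) ^ k)"
    and "(LINT \<omega>|M. (u \<bullet> G j \<omega>) ^ k) = (sqrt \<delta> * norm u) ^ k * (LINT z|gamma1. z ^ k)"
proof -
  have [measurable]: "(\<lambda>\<omega>. u \<bullet> G j \<omega>) \<in> borel_measurable M" using j by simp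
  have "integrable (gauss (sqrt \<delta> * norm u)) (\<lambda>x. x ^ k)"
    unfolding gauss_def by (subst integrable_distr_eq) (auto simp: power_mult_distrib integrable_std_normal_distribution_moment)
  then show "integrable M (\<lambda>\<omega>. (u \<bullet> G j \<omega>) ^ k)"
    unfolding increment_law[OF j, symmetric] by (subst (asm) integrable_distr_eq) auto
  have "(LINT \<omega>|M. (u \<bullet> G j \<omega>) ^ k) = (LINT x|gauss (sqrt \<delta> * norm u). x ^ k)"
    unfolding increment_law[OF j, symmetric] by (subst integral_distr) auto
  also have "\<dots> = (LINT z|gamma1. (sqrt \<delta> * norm u * z) ^ k)"
    unfolding gauss_def by (subst integral_distr) auto
  finally show "(LINT \<omega>|M. (u \<bullet> G j \<omega>) ^ k) = (sqrt \<delta> * norm u) ^ k * (LINT z|gamma1. z ^ k)"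
    by (simp add: power_mult_distrib)
qed

lemma increment_second_moment: "j < J \<Longrightarrow> (LINT \<omega>|M. (u \<bullet> G j \<omega>)\<^sup>2) = \<delta> * (norm u)\<^sup>2"
  using increment_moment(2)[of j u 2] std_normal_distribution_even_moments(1)[of 1] delta_nonneg
  by (simp add: power_mult_distrib)

lemma increment_fourth_moment: "j < J \<Longrightarrow> (LINT \<omega>|M. (u \<bullet> G j \<omega>) ^ 4) = 3 * \<delta>\<^sup>2 * (norm u) ^ 4"
proof -
  have "sqrt \<delta> ^ 4 = (sqrt \<delta> ^ 2) ^ 2" by (simp flip: power_mult)
  then have "sqrt \<delta> ^ 4 = \<delta>\<^sup>2" using delta_nonneg by simp
  moreover have "(LINT z|gamma1. z ^ 4) = 3"
    using std_normal_distribution_even_moments(1)[of 2] by (simp add: fact_numeral)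
  ultimately show "j < J \<Longrightarrow> ?thesis"
    using increment_moment(2)[of j u 4] by (simp add: power_mult_distrib)
qed

definition centered_product :: "'d \<Rightarrow> 'd \<Rightarrow> real^'d \<Rightarrow> real" where
  "centered_product i k g = g $ i * g $ k - (if i = k then \<delta> else 0)"

lemma centered_product_measurable [measurable]: "centered_product i k \<in> borel_measurable borel"
  unfolding centered_product_def by (intro borel_measurable_continuous_onI continuous_intros)

text \<open>The locale provides only the laws of inner products with increments, so products of
  coordinates are recovered by polarization. The 8 is 3 + 3 from two fourth moments plus 2 from the
  centring.\<close>

lemma centered_product_moments:
  assumes j: "j < J"
  shows "integrable M (\<lambda>\<omega>. centered_product i k (G j \<omega>))"
    and "(LINT \<omega>|M. centered_product i k (G j \<omega>)) = 0"
    and "integrable M (\<lambda>\<omega>. (centered_product i k (G j \<omega>))\<^sup>2)"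
    and "(LINT \<omega>|M. (centered_product i k (G j \<omega>))\<^sup>2) \<le> 8 * \<delta>\<^sup>2"
proof -
  have [measurable]: "G j \<in> borel_measurable M" using j by simp
  let ?a = "\<lambda>i. axis i (1::real) :: real^'d"
  have c: "g $ i = ?a i \<bullet> g" for g :: "real^'d" and i by (simp add: inner_axis')
  have eq: "g $ i * g $ k = (((?a i + ?a k) \<bullet> g)\<^sup>2 - (?a i \<bullet> g)\<^sup>2 - (?a k \<bullet> g)\<^sup>2) / 2" for g :: "real^'d"
    unfolding c by (simp add: inner_add_left power2_eq_square algebra_simps)
  have nm: "(norm (?a i + ?a k))\<^sup>2 = 2 + 2 * (if i = k then 1 else 0)"
    by (simp add: power2_norm_eq_inner inner_add_left inner_add_right inner_axis_axis)
  show "integrable M (\<lambda>\<omega>. centered_product i k (G j \<omega>))"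
    unfolding centered_product_def eq using j by (intro Bochner_Integration.integrable_diff integrable_divide increment_moment(1)) auto
  have "(LINT \<omega>|M. centered_product i k (G j \<omega>))
      = (\<delta> * (norm (?a i + ?a k))\<^sup>2 - \<delta> * (norm (?a i))\<^sup>2 - \<delta> * (norm (?a k))\<^sup>2) / 2 - (if i = k then \<delta> else 0)"
    unfolding centered_product_def eq using j
    by (simp add: increment_moment(1) increment_second_moment prob_space)
  then show "(LINT \<omega>|M. centered_product i k (G j \<omega>)) = 0"
    unfolding nm by simp
  let ?H = "\<lambda>\<omega>. (?a i \<bullet> G j \<omega>) ^ 4 + (?a k \<bullet> G j \<omega>) ^ 4 + 2 * \<delta>\<^sup>2"
  have Hi: "integrable M ?H" using j by (intro Bochner_Integration.integrable_add increment_moment(1)) auto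
  have le: "(centered_product i k g)\<^sup>2 \<le> (?a i \<bullet> g) ^ 4 + (?a k \<bullet> g) ^ 4 + 2 * \<delta>\<^sup>2" for g
  proof -
    define x where "x = g $ i"
    define y where "y = g $ k"
    define e where "e = (if i = k then \<delta> else 0)"
    have "(x * y - e)\<^sup>2 \<le> 2 * (x * y)\<^sup>2 + 2 * e\<^sup>2"
      using zero_le_power2[of "x * y + e"] by (simp add: power2_eq_square algebra_simps)
    moreover have "2 * (x * y)\<^sup>2 \<le> x ^ 4 + y ^ 4"
      using zero_le_power2[of "x\<^sup>2 - y\<^sup>2"] by (simp add: power2_eq_square power4_eq_xxxx algebra_simps)
    moreover have "e\<^sup>2 \<le> \<delta>\<^sup>2" by (simp add: e_def)
    ultimately show ?thesis
      by (simp add: centered_product_def c[symmetric] x_def y_def e_def)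
  qed
  show int: "integrable M (\<lambda>\<omega>. (centered_product i k (G j \<omega>))\<^sup>2)"
    using le by (intro Bochner_Integration.integrable_bound[OF Hi]) (auto intro!: AE_I2 order_trans[OF _ abs_ge_self])
  have "(LINT \<omega>|M. (centered_product i k (G j \<omega>))\<^sup>2) \<le> (LINT \<omega>|M. ?H \<omega>)"
    by (intro integral_mono int Hi le)
  also have "\<dots> = 8 * \<delta>\<^sup>2"
    using j by (simp add: increment_moment(1) increment_fourth_moment prob_space)
  finally show "(LINT \<omega>|M. (centered_product i k (G j \<omega>))\<^sup>2) \<le> 8 * \<delta>\<^sup>2" .
qed

text \<open>Orthogonality of martingale increments: after \<open>decouple\<close> the cross term is
  a multiple of the mean of \<open>\<zeta>\<close>, which is 0.\<close>

lemma martingale_second_moment: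
  fixes \<phi> :: "nat \<Rightarrow> 'w \<Rightarrow> real" and \<zeta> :: "real^'d \<Rightarrow> real"
  assumes \<phi>: "\<And>j. j < J \<Longrightarrow> \<phi> j \<in> borel_measurable (Fil j)"
    and C: "\<And>j \<omega>. j < J \<Longrightarrow> \<omega> \<in> space M \<Longrightarrow> \<bar>\<phi> j \<omega>\<bar> \<le> C"
    and [measurable]: "\<zeta> \<in> borel_measurable borel"
    and int: "\<And>j. j < J \<Longrightarrow> integrable M (\<lambda>\<omega>. \<zeta> (G j \<omega>))" "\<And>j. j < J \<Longrightarrow> (LINT \<omega>|M. \<zeta> (G j \<omega>)) = 0"
      "\<And>j. j < J \<Longrightarrow> integrable M (\<lambda>\<omega>. (\<zeta> (G j \<omega>))\<^sup>2)" "\<And>j. j < J \<Longrightarrow> (LINT \<omega>|M. (\<zeta> (G j \<omega>))\<^sup>2) \<le> s"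
    and s: "0 \<le> s" and K: "K \<le> J"
  shows "(\<integral>\<^sup>+\<omega>. ennreal ((\<Sum>j<K. \<phi> j \<omega> * \<zeta> (G j \<omega>))\<^sup>2) \<partial>M) \<le> ennreal (real K * (C\<^sup>2 * s))"
  using K
proof (induction K)
  case (Suc k)
  then have k: "k < J" by simp
  let ?U = "\<lambda>\<omega>. \<Sum>j<k. \<phi> j \<omega> * \<zeta> (G j \<omega>)"
  have Um: "?U \<in> borel_measurable (Fil k)"
  proof (intro borel_measurable_sum borel_measurable_times)
    fix j assume "j \<in> {..<k}"
    then show "\<phi> j \<in> borel_measurable (Fil k)"
      using k by (intro Fil_measurable_mono[OF \<phi>]) auto
    have "G j \<in> borel_measurable (Fil k)"
      using k \<open>j \<in> _\<close> by (intro Fil_measurable_mono[OF increment_measurable]) auto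
    then show "(\<lambda>\<omega>. \<zeta> (G j \<omega>)) \<in> borel_measurable (Fil k)" by measurable
  qed
  note [measurable] = Um \<phi>[OF k]
  define F where "F = (\<lambda>(\<omega>, g). ennreal ((?U \<omega> + \<phi> k \<omega> * \<zeta> g)\<^sup>2))"
  have F: "F \<in> borel_measurable (Fil k \<Otimes>\<^sub>M borel)"
    unfolding F_def by measurable
  have "(\<integral>\<^sup>+\<omega>. ennreal ((\<Sum>j<Suc k. \<phi> j \<omega> * \<zeta> (G j \<omega>))\<^sup>2) \<partial>M) = (\<integral>\<^sup>+\<omega>. F (\<omega>, G k \<omega>) \<partial>M)"
    by (simp add: F_def)
  also have "\<dots> = (\<integral>\<^sup>+\<omega>. \<integral>\<^sup>+\<omega>'. F (\<omega>, G k \<omega>') \<partial>M \<partial>M)"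
    by (rule decouple[OF k F])
  also have "\<dots> \<le> (\<integral>\<^sup>+\<omega>. ennreal ((?U \<omega>)\<^sup>2) + ennreal (C\<^sup>2 * s) \<partial>M)"
  proof (rule nn_integral_mono)
    fix \<omega> assume \<omega>: "\<omega> \<in> space M"
    let ?u = "?U \<omega>" and ?p = "\<phi> k \<omega>"
    have sq: "(?u + ?p * z)\<^sup>2 = ?u\<^sup>2 + 2 * ?u * ?p * z + ?p\<^sup>2 * z\<^sup>2" for z
      by (simp add: power2_eq_square algebra_simps)
    have I: "integrable M (\<lambda>\<omega>'. (?u + ?p * \<zeta> (G k \<omega>'))\<^sup>2)"
      unfolding sq using int k by (intro Bochner_Integration.integrable_add integrable_mult_right) auto
    have "(\<integral>\<^sup>+\<omega>'. F (\<omega>, G k \<omega>') \<partial>M) = ennreal (LINT \<omega>'|M. (?u + ?p * \<zeta> (G k \<omega>'))\<^sup>2)"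
      unfolding F_def prod.case by (intro nn_integral_eq_integral I) auto
    also have "(LINT \<omega>'|M. (?u + ?p * \<zeta> (G k \<omega>'))\<^sup>2) = ?u\<^sup>2 + ?p\<^sup>2 * (LINT \<omega>'|M. (\<zeta> (G k \<omega>'))\<^sup>2)"
      unfolding sq using int k by (simp add: prob_space)
    also have "\<dots> \<le> ?u\<^sup>2 + C\<^sup>2 * s"
    proof (intro add_left_mono mult_mono)
      have "\<bar>?p\<bar>\<^sup>2 \<le> C\<^sup>2" by (intro power_mono C k \<omega>) simp
      then show "?p\<^sup>2 \<le> C\<^sup>2" by simp
    qed (use int k s in auto)
    finally show "(\<integral>\<^sup>+\<omega>'. F (\<omega>, G k \<omega>') \<partial>M) \<le> ennreal (?u\<^sup>2) + ennreal (C\<^sup>2 * s)"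
      using s by (simp add: ennreal_leI ennreal_plus[symmetric] del: ennreal_plus)
  qed
  also have "\<dots> = (\<integral>\<^sup>+\<omega>. ennreal ((?U \<omega>)\<^sup>2) \<partial>M) + ennreal (C\<^sup>2 * s)"
    using Fil_measurable[OF Um] k by (subst nn_integral_add) (auto simp: emeasure_space_1)
  also have "\<dots> \<le> ennreal (real k * (C\<^sup>2 * s)) + ennreal (C\<^sup>2 * s)"
    using Suc by (intro add_right_mono) auto
  also have "\<dots> = ennreal (real (Suc k) * (C\<^sup>2 * s))"
    using s by (simp add: ennreal_plus[symmetric] distrib_right del: ennreal_plus)
  finally show ?case .
qed simp

text \<open>A vector of norm above \<open>r\<close> has a coordinate above \<open>r / d\<close>.
  Fourth moments are used because with \<open>J * \<delta> = T\<close> the bound is then of order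
  \<open>\<delta>\<close>, whereas second moments would leave a constant.\<close>

lemma increments_small_probability:
  assumes r: "0 < r"
  shows "emeasure M {\<omega>\<in>space M. \<exists>j<J. r < norm (G j \<omega>)} \<le> ennreal (real J * (real CARD('d) * (3 * \<delta>\<^sup>2 / (r / real CARD('d)) ^ 4)))"
proof -
  let ?d = "real CARD('d)"
  let ?E = "\<lambda>j i. {\<omega>\<in>space M. (r / ?d) ^ 4 < (axis i 1 \<bullet> G j \<omega>) ^ 4}"
  have "emeasure M {\<omega>\<in>space M. \<exists>j<J. r < norm (G j \<omega>)} \<le> emeasure M (\<Union>j\<in>{..<J}. \<Union>i\<in>UNIV. ?E j i)"
  proof (rule emeasure_mono)
    show "{\<omega>\<in>space M. \<exists>j<J. r < norm (G j \<omega>)} \<subseteq> (\<Union>j\<in>{..<J}. \<Union>i\<in>UNIV. ?E j i)"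
    proof
      fix \<omega> assume "\<omega> \<in> {\<omega>\<in>space M. \<exists>j<J. r < norm (G j \<omega>)}"
      then obtain j where \<omega>: "\<omega> \<in> space M" and j: "j < J" "r < norm (G j \<omega>)" by auto
      have "\<exists>i. r / ?d < \<bar>G j \<omega> $ i\<bar>"
      proof (rule ccontr)
        assume "\<not> (\<exists>i. r / ?d < \<bar>G j \<omega> $ i\<bar>)"
        then have "(\<Sum>i\<in>UNIV. \<bar>G j \<omega> $ i\<bar>) \<le> (\<Sum>i\<in>(UNIV::'d set). r / ?d)"
          by (intro sum_mono) (auto simp: not_less)
        with j norm_le_l1_cart[of "G j \<omega>"] show False by simp
      qed
      then obtain i where "r / ?d < \<bar>G j \<omega> $ i\<bar>" ..
      then have "(r / ?d) ^ 4 < \<bar>G j \<omega> $ i\<bar> ^ 4"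
        using r by (intro power_strict_mono) auto
      then have "(r / ?d) ^ 4 < (axis i 1 \<bullet> G j \<omega>) ^ 4"
        by (simp add: inner_axis')
      with \<omega> j show "\<omega> \<in> (\<Union>j\<in>{..<J}. \<Union>i\<in>UNIV. ?E j i)" by auto
    qed
  qed (auto intro!: sets.finite_UN)
  also have "\<dots> \<le> (\<Sum>j<J. \<Sum>i\<in>UNIV. emeasure M (?E j i))"
    by (intro order_trans[OF emeasure_subadditive_finite] sum_mono) (auto intro!: sets.finite_UN emeasure_subadditive_finite)
  also have "\<dots> \<le> (\<Sum>j<J. \<Sum>i\<in>(UNIV::'d set). ennreal (3 * \<delta>\<^sup>2 / (r / ?d) ^ 4))"
  proof (intro sum_mono emeasure_gt_le_nn_integral)
    fix j :: nat and i :: 'd assume "j \<in> {..<J}"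
    then have j: "j < J" by simp
    then show "(\<lambda>\<omega>. (axis i 1 \<bullet> G j \<omega>) ^ 4) \<in> borel_measurable M" by simp
    show "(\<integral>\<^sup>+\<omega>. ennreal ((axis i 1 \<bullet> G j \<omega>) ^ 4) \<partial>M) \<le> ennreal (3 * \<delta>\<^sup>2)"
      using increment_fourth_moment[OF j, of "axis i 1"]
      by (subst nn_integral_eq_integral) (auto intro!: increment_moment(1) j)
  qed (use r in auto)
  also have "\<dots> = ennreal (real J * (?d * (3 * \<delta>\<^sup>2 / (r / ?d) ^ 4)))"
    by (simp add: ennreal_of_nat_eq_real_of_nat ennreal_mult'[symmetric])
  finally show ?thesis .
qed

text \<open>Here boundedness in probability suffices, so the mean \<open>J * d * \<delta>\<close> is
  enough.\<close>

lemma quadratic_variation_probability: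
  assumes r: "0 < r"
  shows "emeasure M {\<omega>\<in>space M. r < (\<Sum>j<J. (norm (G j \<omega>))\<^sup>2)} \<le> ennreal (real J * (real CARD('d) * \<delta>) / r)"
proof (rule emeasure_gt_le_nn_integral)
  have eq: "(norm (G j \<omega>))\<^sup>2 = (\<Sum>i\<in>UNIV. (axis i 1 \<bullet> G j \<omega>)\<^sup>2)" for j \<omega>
    by (simp add: norm_vec_def L2_set_def sum_nonneg inner_axis')
  have int: "integrable M (\<lambda>\<omega>. \<Sum>j<J. (norm (G j \<omega>))\<^sup>2)"
    unfolding eq by (intro Bochner_Integration.integrable_sum increment_moment(1)) auto
  have "(LINT \<omega>|M. (\<Sum>j<J. (norm (G j \<omega>))\<^sup>2)) = real J * (real CARD('d) * \<delta>)"
    unfolding eq by (simp add: Bochner_Integration.integral_sum Bochner_Integration.integrable_sum increment_moment(1) increment_second_moment)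
  then show "(\<integral>\<^sup>+\<omega>. ennreal (\<Sum>j<J. (norm (G j \<omega>))\<^sup>2) \<partial>M) \<le> ennreal (real J * (real CARD('d) * \<delta>))"
    by (subst nn_integral_eq_integral[OF int]) (auto intro!: sum_nonneg)
qed (use r in auto)

end

section \<open>The Ito remainder along a fine grid\<close>

context drift
begin

lemma b''_component_measurable: "(\<lambda>y. b'' y u v $ k) \<in> borel_measurable borel"
proof -
  have "bounded_linear (\<lambda>A :: (real^'d) \<Rightarrow>\<^sub>L ((real^'d) \<Rightarrow>\<^sub>L (real^'d)). blinfun_apply (blinfun_apply A u) v $ k)"
    by (rule bounded_linear_compose[OF bounded_linear_vec_nth
          bounded_linear_compose[OF blinfun.bounded_linear_left blinfun.bounded_linear_left]])
  then show ?thesis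
    by (intro borel_measurable_continuous_onI bounded_linear.continuous_on[OF _ b''_cont])
qed

lemma b''_component_bound:
  assumes "norm (b'' y) \<le> C" shows "\<bar>b'' y (axis i 1) (axis j 1) $ k\<bar> \<le> C"
proof -
  have "\<bar>b'' y (axis i 1) (axis j 1) $ k\<bar> \<le> norm (b'' y (axis i 1) (axis j 1))"
    by (rule component_le_norm_cart)
  also have "\<dots> \<le> norm (b'' y (axis i 1))" using norm_blinfun[of "b'' y (axis i 1)" "axis j 1"] by simp
  also have "\<dots> \<le> norm (b'' y)" using norm_blinfun[of "b'' y" "axis i 1"] by simp
  finally show ?thesis using assms by simp
qed

text \<open>The deterministic estimate on the event where the scheme stays in a ball, all increments
  are small, the quadratic variation is bounded and the scalar transforms are at most
  \<open>s\<close>. The cube of the dimension counts the output component and the two indices of the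
  transform.\<close>

lemma sum_ito_remainder_le:
  fixes y \<beta> g :: "nat \<Rightarrow> real^'d"
  assumes y: "\<And>j. j < J \<Longrightarrow> norm (y j - x0) \<le> R" and \<beta>: "\<And>j. j < J \<Longrightarrow> norm (\<beta> j) \<le> B"
    and g: "\<And>j. j < J \<Longrightarrow> norm (g j) \<le> \<eta> / 2" and \<delta>: "0 \<le> \<delta>" "\<delta> * B \<le> \<eta> / 2" and B: "0 \<le> B"
    and C: "0 \<le> C" "\<And>z. norm (z - x0) \<le> R \<Longrightarrow> norm (b'' z) \<le> C"
    and \<eta>: "\<And>z w. norm (z - x0) \<le> R \<Longrightarrow> norm w \<le> \<eta> \<Longrightarrow> norm (b'' (z + w) - b'' z) \<le> e" and e: "0 \<le> e"
    and c: "\<And>j. 0 \<le> c j" "\<And>j. c j \<le> cm" and K: "K \<le> J" and Q: "(\<Sum>j<J. (norm (g j))\<^sup>2) \<le> Q"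
    and T: "real J * \<delta> = T"
    and S: "\<And>k i j. \<bar>\<Sum>l<K. c l * (b'' (y l) (axis i 1) (axis j 1) $ k / 2) * (g l $ i * g l $ j - (if i = j then \<delta> else 0))\<bar> \<le> s"
  shows "norm (\<Sum>j<K. c j *\<^sub>R ito_remainder \<delta> (\<beta> j) (y j) (g j))
    \<le> real CARD('d) ^ 3 * s + cm * (e * (2 * Q + 2 * (\<delta> * T) * B\<^sup>2) + C * (B * (sqrt \<delta> * (T + Q)) + \<delta> * T * B\<^sup>2))"
proof -
  let ?d = "real CARD('d)"
  let ?r = "\<lambda>j. ito_remainder \<delta> (\<beta> j) (y j) (g j)" and ?q = "\<lambda>j. ito_quadratic \<delta> (y j) (g j)"
  have cm: "0 \<le> cm" using c[of 0] by linarith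
  have step: "norm (?r j - ?q j) \<le> e * (2 * \<delta>\<^sup>2 * B\<^sup>2 + 2 * (norm (g j))\<^sup>2) + C * (B * (sqrt \<delta> * (\<delta> + (norm (g j))\<^sup>2)) + \<delta>\<^sup>2 * B\<^sup>2)"
    if j: "j < J" for j
  proof -
    have nb: "norm (\<delta> *\<^sub>R \<beta> j) \<le> \<delta> * B" using \<beta>[OF j] \<delta> by (simp add: mult_left_mono)
    have v: "norm (\<delta> *\<^sub>R \<beta> j + g j) \<le> \<delta> * B + norm (g j)"
      using norm_triangle_ineq[of "\<delta> *\<^sub>R \<beta> j" "g j"] nb by linarith
    have "(norm (\<delta> *\<^sub>R \<beta> j + g j))\<^sup>2 \<le> (\<delta> * B + norm (g j))\<^sup>2" using v by (intro power_mono) auto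
    also have "\<dots> \<le> 2 * (\<delta> * B)\<^sup>2 + 2 * (norm (g j))\<^sup>2"
      using zero_le_power2[of "\<delta> * B - norm (g j)"] by (simp add: power2_eq_square algebra_simps)
    finally have v2: "(norm (\<delta> *\<^sub>R \<beta> j + g j))\<^sup>2 \<le> 2 * \<delta>\<^sup>2 * B\<^sup>2 + 2 * (norm (g j))\<^sup>2"
      by (simp add: power_mult_distrib)
    \<comment> \<open>The inequality
      \<open>2 * sqrt \<delta> * norm g \<le> \<delta> + (norm g)\<^sup>2\<close> makes the sum of
      the mixed terms at most \<open>sqrt \<delta> * (T + Q)\<close>, which tends to 0.\<close>
    have "2 * \<delta> * norm (g j) = sqrt \<delta> * (2 * sqrt \<delta> * norm (g j))" using \<delta> by simp
    also have "\<dots> \<le> sqrt \<delta> * (\<delta> + (norm (g j))\<^sup>2)"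
      using zero_le_power2[of "sqrt \<delta> - norm (g j)"] \<delta> by (intro mult_left_mono) (auto simp: power2_diff)
    finally have "2 * \<delta> * B * norm (g j) \<le> B * (sqrt \<delta> * (\<delta> + (norm (g j))\<^sup>2))"
      using mult_left_mono[OF _ B] by (metis mult.assoc mult.commute mult.left_commute)
    moreover have "norm (?r j - ?q j) \<le> e * (norm (\<delta> *\<^sub>R \<beta> j + g j))\<^sup>2 + C * (2 * \<delta> * B * norm (g j) + \<delta>\<^sup>2 * B\<^sup>2)"
      using v g[OF j] \<delta>
      by (intro ito_remainder_bound[OF y[OF j] \<beta>[OF j] _ C(2)[OF y[OF j]], of _ _ \<eta>] \<eta> y j) auto
    ultimately show ?thesis
      using v2 e C by (smt (verit) mult_left_mono)
  qed
  have "norm (\<Sum>j<K. c j *\<^sub>R ?r j) = norm ((\<Sum>j<K. c j *\<^sub>R ?q j) + (\<Sum>j<K. c j *\<^sub>R (?r j - ?q j)))"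
    by (simp add: sum.distrib[symmetric] scaleR_diff_right)
  also have "\<dots> \<le> norm (\<Sum>j<K. c j *\<^sub>R ?q j) + (\<Sum>j<K. norm (c j *\<^sub>R (?r j - ?q j)))"
    by (intro order_trans[OF norm_triangle_ineq] add_left_mono norm_sum)
  also have "norm (\<Sum>j<K. c j *\<^sub>R ?q j) \<le> ?d ^ 3 * s"
  proof -
    have comp: "(\<Sum>l<K. c l *\<^sub>R ?q l) $ k = (\<Sum>i\<in>UNIV. \<Sum>j\<in>UNIV. \<Sum>l<K. c l * (b'' (y l) (axis i 1) (axis j 1) $ k / 2) * (g l $ i * g l $ j - (if i = j then \<delta> else 0)))" for k
    proof -
      have "(\<Sum>l<K. c l *\<^sub>R ?q l) $ k = (\<Sum>l<K. \<Sum>i\<in>UNIV. \<Sum>j\<in>UNIV. c l * (b'' (y l) (axis i 1) (axis j 1) $ k / 2) * (g l $ i * g l $ j - (if i = j then \<delta> else 0)))"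
        by (simp add: ito_quadratic_component sum_distrib_left mult.assoc)
      also have "\<dots> = (\<Sum>i\<in>UNIV. \<Sum>l<K. \<Sum>j\<in>UNIV. c l * (b'' (y l) (axis i 1) (axis j 1) $ k / 2) * (g l $ i * g l $ j - (if i = j then \<delta> else 0)))"
        by (rule sum.swap)
      also have "\<dots> = (\<Sum>i\<in>UNIV. \<Sum>j\<in>UNIV. \<Sum>l<K. c l * (b'' (y l) (axis i 1) (axis j 1) $ k / 2) * (g l $ i * g l $ j - (if i = j then \<delta> else 0)))"
        by (intro sum.cong refl sum.swap)
      finally show ?thesis .
    qed
    have "norm (\<Sum>j<K. c j *\<^sub>R ?q j) \<le> (\<Sum>k\<in>UNIV. \<bar>(\<Sum>j<K. c j *\<^sub>R ?q j) $ k\<bar>)"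
      by (rule norm_le_l1_cart)
    also have "\<dots> \<le> (\<Sum>k\<in>(UNIV::'d set). \<Sum>i\<in>(UNIV::'d set). \<Sum>j\<in>(UNIV::'d set). s)"
      unfolding comp by (intro sum_mono order_trans[OF sum_abs] S)
    finally show ?thesis by (simp add: power3_eq_cube mult.assoc)
  qed
  also have "(\<Sum>j<K. norm (c j *\<^sub>R (?r j - ?q j))) \<le> (\<Sum>j<J. cm * (e * (2 * \<delta>\<^sup>2 * B\<^sup>2 + 2 * (norm (g j))\<^sup>2) + C * (B * (sqrt \<delta> * (\<delta> + (norm (g j))\<^sup>2)) + \<delta>\<^sup>2 * B\<^sup>2)))"
  proof (rule order_trans[OF sum_mono sum_mono2])
    fix j assume "j \<in> {..<K}"
    then show "norm (c j *\<^sub>R (?r j - ?q j)) \<le> cm * (e * (2 * \<delta>\<^sup>2 * B\<^sup>2 + 2 * (norm (g j))\<^sup>2) + C * (B * (sqrt \<delta> * (\<delta> + (norm (g j))\<^sup>2)) + \<delta>\<^sup>2 * B\<^sup>2))"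
      using step[of j] c[of j] cm K by (simp add: mult_mono)
  qed (use K cm e C B \<delta> in auto)
  also have "\<dots> = cm * (e * (2 * (\<Sum>j<J. (norm (g j))\<^sup>2) + 2 * (\<delta> * T) * B\<^sup>2) + C * (B * (sqrt \<delta> * (T + (\<Sum>j<J. (norm (g j))\<^sup>2))) + \<delta> * T * B\<^sup>2))"
  proof -
    have "(\<Sum>j<J. e * (2 * \<delta>\<^sup>2 * B\<^sup>2 + 2 * (norm (g j))\<^sup>2)) = e * (2 * (\<Sum>j<J. (norm (g j))\<^sup>2) + 2 * (\<delta> * (real J * \<delta>)) * B\<^sup>2)"
      by (simp add: sum.distrib sum_distrib_left[symmetric] power2_eq_square algebra_simps)
    moreover have "(\<Sum>j<J. C * (B * (sqrt \<delta> * (\<delta> + (norm (g j))\<^sup>2)) + \<delta>\<^sup>2 * B\<^sup>2)) = C * (B * (sqrt \<delta> * (real J * \<delta> + (\<Sum>j<J. (norm (g j))\<^sup>2))) + \<delta> * (real J * \<delta>) * B\<^sup>2)"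
      by (simp add: sum.distrib sum_distrib_left[symmetric] power2_eq_square algebra_simps)
    ultimately show ?thesis
      unfolding T by (simp only: sum_distrib_left[symmetric] sum.distrib)
  qed
  also have "\<dots> \<le> cm * (e * (2 * Q + 2 * (\<delta> * T) * B\<^sup>2) + C * (B * (sqrt \<delta> * (T + Q)) + \<delta> * T * B\<^sup>2))"
    using Q cm e C B \<delta> by (intro mult_left_mono add_mono add_right_mono add_left_mono) auto
  finally show ?thesis by simp
qed

text \<open>On the ball of radius \<open>R\<close> the second derivative is uniformly continuous, which handles the Taylor error; the
difference between the quadratic term and its trace is a martingale transform whose variance is of order \<open>\<delta>\<close>.\<close>
lemma ito_remainder_in_probability:
  fixes M :: "'w measure"
  assumes \<epsilon>: "0 < \<epsilon>" and p: "0 < p" and T: "0 < T" and cm: "0 \<le> cm" and B: "0 \<le> B"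
  shows "\<exists>\<delta>0>0. \<forall>Fil G J \<delta> y \<beta> c K. gaussian_walk M Fil G J \<delta> \<longrightarrow> 0 < \<delta> \<longrightarrow> \<delta> < \<delta>0 \<longrightarrow> real J * \<delta> = T \<longrightarrow> K \<le> J \<longrightarrow>
     (\<forall>j<J. y j \<in> borel_measurable (Fil j)) \<longrightarrow>
     (\<forall>j<J. \<forall>\<omega>\<in>space M. (\<forall>i\<le>j. norm (y i \<omega> - x0) \<le> R) \<longrightarrow> norm (\<beta> j \<omega>) \<le> B) \<longrightarrow>
     (\<forall>j. 0 \<le> c j \<and> c j \<le> cm) \<longrightarrow>
     emeasure M {\<omega>\<in>space M. \<epsilon> < norm (\<Sum>j<K. c j *\<^sub>R ito_remainder \<delta> (\<beta> j \<omega>) (y j \<omega>) (G j \<omega>))}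
       \<le> emeasure M {\<omega>\<in>space M. \<exists>j<J. R < norm (y j \<omega> - x0)} + ennreal p"
proof -
  let ?d = "real CARD('d)"
  have d: "0 < ?d" by simp
  obtain C where C: "0 \<le> C" "\<And>y. norm (y - x0) \<le> R \<Longrightarrow> norm (b'' y) \<le> C"
    using b''_bounded_on_ball[of R] by blast
  \<comment> \<open>By \<open>quadratic_variation_probability\<close> this level is exceeded with
    probability at most \<open>p / 3\<close>.\<close>
  define Q where "Q = 3 * (?d * T) / p"
  have Q: "0 < Q" using p T d by (simp add: Q_def)
  \<comment> \<open>Makes the part of the Taylor error that does not vanish with
    \<open>\<delta>\<close> at most \<open>\<epsilon> / 4\<close>; the summand 1 covers
    \<open>cm = 0\<close>.\<close>
  define e where "e = \<epsilon> / (8 * (cm * Q + 1))"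
  have e: "0 < e" using \<epsilon> cm Q by (simp add: e_def add_nonneg_pos)
  obtain \<eta> where \<eta>: "0 < \<eta>" "\<And>y w. norm (y - x0) \<le> R \<Longrightarrow> norm w \<le> \<eta> \<Longrightarrow> norm (b'' (y + w) - b'' y) \<le> e"
    using b''_uniformly_continuous_on_ball[OF e] by blast
  define s where "s = \<epsilon> / (2 * ?d ^ 3)"
  have s: "0 < s" using \<epsilon> d by (simp add: s_def)
  let ?D = "\<lambda>\<delta>. cm * (e * (2 * Q + 2 * (\<delta> * T) * B\<^sup>2) + C * (B * (sqrt \<delta> * (T + Q)) + \<delta> * T * B\<^sup>2))"
  let ?p1 = "\<lambda>\<delta>. T * (?d * (3 * \<delta> / (\<eta> / 2 / ?d) ^ 4))"
  let ?p3 = "\<lambda>\<delta>. ?d ^ 3 * (T * ((cm * C)\<^sup>2 * (8 * \<delta>)) / s\<^sup>2)"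
  have D0: "cm * (e * (2 * Q + 2 * (0 * T) * B\<^sup>2) + C * (B * (sqrt 0 * (T + Q)) + 0 * T * B\<^sup>2)) < \<epsilon> / 2"
  proof -
    have "cm * Q / (cm * Q + 1) \<le> 1" using cm Q by (simp add: divide_le_eq add_nonneg_pos)
    then have "\<epsilon> / 4 * (cm * Q / (cm * Q + 1)) \<le> \<epsilon> / 4 * 1" using \<epsilon> by (intro mult_left_mono) auto
    moreover have "cm * (e * (2 * Q)) = \<epsilon> / 4 * (cm * Q / (cm * Q + 1))"
    proof -
      have w0: "cm * Q + 1 \<noteq> 0" using cm Q by (simp add: add_nonneg_eq_0_iff)
      have gen: "w \<noteq> 0 \<Longrightarrow> cm * (\<epsilon> / (8 * w) * (2 * Q)) = \<epsilon> / 4 * (cm * Q / w)" for w :: real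
        by (simp add: field_simps)
      show ?thesis unfolding e_def by (rule gen[OF w0])
    qed
    ultimately show ?thesis using \<epsilon> by simp
  qed
  have "(?D \<longlongrightarrow> cm * (e * (2 * Q + 2 * (0 * T) * B\<^sup>2) + C * (B * (sqrt 0 * (T + Q)) + 0 * T * B\<^sup>2))) (at_right 0)"
    by (intro tendsto_intros)
  then have E1: "eventually (\<lambda>\<delta>. ?D \<delta> < \<epsilon> / 2) (at_right 0)"
    using D0 by (rule order_tendstoD(2))
  have "(?p1 \<longlongrightarrow> T * (?d * (3 * 0 / (\<eta> / 2 / ?d) ^ 4))) (at_right 0)"
    using \<eta> d by (intro tendsto_intros) auto
  then have E2: "eventually (\<lambda>\<delta>. ?p1 \<delta> < p / 3) (at_right 0)"
    by (rule order_tendstoD(2)) (use p in simp)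
  have "(?p3 \<longlongrightarrow> ?d ^ 3 * (T * ((cm * C)\<^sup>2 * (8 * 0)) / s\<^sup>2)) (at_right 0)"
    using s by (intro tendsto_intros) auto
  then have E3: "eventually (\<lambda>\<delta>. ?p3 \<delta> < p / 3) (at_right 0)"
    by (rule order_tendstoD(2)) (use p in simp)
  have "((\<lambda>\<delta>. \<delta> * B) \<longlongrightarrow> 0 * B) (at_right 0)" by (intro tendsto_intros)
  then have E4: "eventually (\<lambda>\<delta>. \<delta> * B < \<eta> / 2) (at_right 0)"
    by (rule order_tendstoD(2)) (use \<eta> in simp)
  have "eventually (\<lambda>\<delta>. ?D \<delta> < \<epsilon> / 2 \<and> ?p1 \<delta> < p / 3 \<and> ?p3 \<delta> < p / 3 \<and> \<delta> * B < \<eta> / 2) (at_right 0)"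
    using E1 E2 E3 E4 by eventually_elim blast
  then obtain \<delta>0 where \<delta>0: "0 < \<delta>0" "\<And>\<delta>. 0 < \<delta> \<Longrightarrow> \<delta> < \<delta>0 \<Longrightarrow> ?D \<delta> < \<epsilon> / 2 \<and> ?p1 \<delta> < p / 3 \<and> ?p3 \<delta> < p / 3 \<and> \<delta> * B < \<eta> / 2"
    unfolding eventually_at_right_field by blast
  show ?thesis
  \<comment> \<open>\<open>\<delta>0\<close> is fixed before the filtration, the processes and the
    weights, all of which change when the grid is refined.\<close>
  proof (intro exI[of _ \<delta>0] conjI allI impI)
    fix Fil :: "nat \<Rightarrow> 'w measure" and G :: "nat \<Rightarrow> 'w \<Rightarrow> real^'d" and J :: nat and \<delta> :: real
      and y \<beta> :: "nat \<Rightarrow> 'w \<Rightarrow> real^'d" and c :: "nat \<Rightarrow> real" and K :: nat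
    assume walk: "gaussian_walk M Fil G J \<delta>" and \<delta>: "0 < \<delta>" "\<delta> < \<delta>0" and JT: "real J * \<delta> = T" and K: "K \<le> J"
      and ym: "\<forall>j<J. y j \<in> borel_measurable (Fil j)"
      and \<beta>: "\<forall>j<J. \<forall>\<omega>\<in>space M. (\<forall>i\<le>j. norm (y i \<omega> - x0) \<le> R) \<longrightarrow> norm (\<beta> j \<omega>) \<le> B"
      and c: "\<forall>j. 0 \<le> c j \<and> c j \<le> cm"
    interpret gaussian_walk M Fil G J \<delta> by (rule walk)
    note small = \<delta>0(2)[OF \<delta>]
    \<comment> \<open>Truncation outside the ball keeps the coefficient bounded by
      \<open>cm * C\<close> and determined by the past. On the good event it changes
      nothing.\<close>
    define \<phi> where "\<phi> k i j l \<omega> = c l * (if norm (y l \<omega> - x0) \<le> R then b'' (y l \<omega>) (axis i 1) (axis j 1) $ k / 2 else 0)" for k i j l \<omega>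
    define S where "S k i j \<omega> = (\<Sum>l<K. \<phi> k i j l \<omega> * centered_product i j (G l \<omega>))" for k i j \<omega>
    have \<phi>m: "\<phi> k i j l \<in> borel_measurable (Fil l)" if "l < J" for k i j l
    proof -
      have y[measurable]: "y l \<in> borel_measurable (Fil l)" using ym that by blast
      have [measurable]: "(\<lambda>\<omega>. b'' (y l \<omega>) (axis i 1) (axis j 1) $ k) \<in> borel_measurable (Fil l)"
        using measurable_compose[OF y b''_component_measurable] by simp
      show ?thesis unfolding \<phi>_def by measurable
    qed
    have \<phi>b: "\<bar>\<phi> k i j l \<omega>\<bar> \<le> cm * C" for k i j l \<omega>
    proof (cases "norm (y l \<omega> - x0) \<le> R")
      case True
      have "\<bar>b'' (y l \<omega>) (axis i 1) (axis j 1) $ k / 2\<bar> \<le> C"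
        using b''_component_bound[OF C(2)[OF True], of i j k] C(1) by simp
      then have "\<bar>c l\<bar> * \<bar>b'' (y l \<omega>) (axis i 1) (axis j 1) $ k / 2\<bar> \<le> cm * C"
        using c cm by (intro mult_mono) (auto simp: abs_of_nonneg)
      then show ?thesis using True by (simp add: \<phi>_def abs_mult)
    qed (simp add: \<phi>_def cm C)
    have [measurable]: "G l \<in> borel_measurable M" if "l < J" for l using that by simp
    have Sm[measurable]: "S k i j \<in> borel_measurable M" for k i j
      unfolding S_def
    proof (intro borel_measurable_sum borel_measurable_times)
      fix l assume "l \<in> {..<K}"
      then have l: "l < J" using K by simp
      show "\<phi> k i j l \<in> borel_measurable M" using Fil_measurable[OF \<phi>m] l by simp
      show "(\<lambda>\<omega>. centered_product i j (G l \<omega>)) \<in> borel_measurable M" using l by measurable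
    qed
    have Sp: "emeasure M {\<omega>\<in>space M. s\<^sup>2 < (S k i j \<omega>)\<^sup>2} \<le> ennreal (T * ((cm * C)\<^sup>2 * (8 * \<delta>)) / s\<^sup>2)" for k i j
    proof (rule emeasure_gt_le_nn_integral)
      have "(\<integral>\<^sup>+\<omega>. ennreal ((S k i j \<omega>)\<^sup>2) \<partial>M) \<le> ennreal (real K * ((cm * C)\<^sup>2 * (8 * \<delta>\<^sup>2)))"
        unfolding S_def
        by (rule martingale_second_moment[OF \<phi>m \<phi>b _ centered_product_moments _ K]) auto
      also have "\<dots> \<le> ennreal (real J * ((cm * C)\<^sup>2 * (8 * \<delta>\<^sup>2)))"
        using K by (intro ennreal_leI mult_right_mono) auto
      also have "real J * ((cm * C)\<^sup>2 * (8 * \<delta>\<^sup>2)) = T * ((cm * C)\<^sup>2 * (8 * \<delta>))"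
        unfolding JT[symmetric] by (simp add: power2_eq_square)
      finally show "(\<integral>\<^sup>+\<omega>. ennreal ((S k i j \<omega>)\<^sup>2) \<partial>M) \<le> ennreal (T * ((cm * C)\<^sup>2 * (8 * \<delta>)))" .
    qed (use s in auto)
    let ?B0 = "{\<omega>\<in>space M. \<exists>j<J. R < norm (y j \<omega> - x0)}"
    let ?B1 = "{\<omega>\<in>space M. \<exists>j<J. \<eta> / 2 < norm (G j \<omega>)}"
    let ?B2 = "{\<omega>\<in>space M. Q < (\<Sum>j<J. (norm (G j \<omega>))\<^sup>2)}"
    let ?B3 = "\<Union>k\<in>UNIV. \<Union>i\<in>UNIV. \<Union>j\<in>UNIV. {\<omega>\<in>space M. s\<^sup>2 < (S k i j \<omega>)\<^sup>2}"
    have sets: "?B0 \<in> sets M" "?B1 \<in> sets M" "?B2 \<in> sets M" "?B3 \<in> sets M"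
    proof -
      have [measurable]: "y j \<in> borel_measurable M" if "j < J" for j
        using ym that by (intro Fil_measurable[of _ j]) auto
      have "?B0 = (\<Union>j\<in>{..<J}. {\<omega>\<in>space M. R < norm (y j \<omega> - x0)})" by auto
      also have "\<dots> \<in> sets M" by (intro sets.finite_UN) auto
      finally show "?B0 \<in> sets M" .
      have "?B1 = (\<Union>j\<in>{..<J}. {\<omega>\<in>space M. \<eta> / 2 < norm (G j \<omega>)})" by auto
      also have "\<dots> \<in> sets M" by (intro sets.finite_UN) auto
      finally show "?B1 \<in> sets M" .
      show "?B2 \<in> sets M" by measurable
      show "?B3 \<in> sets M" by (intro sets.finite_UN) auto
    qed
    \<comment> \<open>Outside the four bad events \<open>sum_ito_remainder_le\<close> bounds the sum
      by two contributions, one equal to \<open>\<epsilon> / 2\<close> and one below it.\<close>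
    have "{\<omega>\<in>space M. \<epsilon> < norm (\<Sum>j<K. c j *\<^sub>R ito_remainder \<delta> (\<beta> j \<omega>) (y j \<omega>) (G j \<omega>))} \<subseteq> ?B0 \<union> (?B1 \<union> (?B2 \<union> ?B3))"
    proof (rule subsetI, rule ccontr)
      fix \<omega> assume \<omega>: "\<omega> \<in> {\<omega>\<in>space M. \<epsilon> < norm (\<Sum>j<K. c j *\<^sub>R ito_remainder \<delta> (\<beta> j \<omega>) (y j \<omega>) (G j \<omega>))}"
        and "\<omega> \<notin> ?B0 \<union> (?B1 \<union> (?B2 \<union> ?B3))"
      then have sp: "\<omega> \<in> space M" and y: "\<And>j. j < J \<Longrightarrow> norm (y j \<omega> - x0) \<le> R"
        and g: "\<And>j. j < J \<Longrightarrow> norm (G j \<omega>) \<le> \<eta> / 2" and q: "(\<Sum>j<J. (norm (G j \<omega>))\<^sup>2) \<le> Q"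
        and S: "\<And>k i j. (S k i j \<omega>)\<^sup>2 \<le> s\<^sup>2"
        by (auto simp: not_less) (meson not_less)+
      have b: "norm (\<beta> j \<omega>) \<le> B" if "j < J" for j
        using \<beta> that sp y by auto
      have S': "\<bar>\<Sum>l<K. c l * (b'' (y l \<omega>) (axis i 1) (axis j 1) $ k / 2) * (G l \<omega> $ i * G l \<omega> $ j - (if i = j then \<delta> else 0))\<bar> \<le> s" for k i j
      proof -
        have "(\<Sum>l<K. c l * (b'' (y l \<omega>) (axis i 1) (axis j 1) $ k / 2) * (G l \<omega> $ i * G l \<omega> $ j - (if i = j then \<delta> else 0))) = S k i j \<omega>"
          unfolding S_def using K y by (intro sum.cong refl) (auto simp: \<phi>_def centered_product_def)
        then show ?thesis
          using S[of k i j] s by (simp only: abs_le_square_iff[symmetric] abs_of_pos)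
      qed
      have "norm (\<Sum>j<K. c j *\<^sub>R ito_remainder \<delta> (\<beta> j \<omega>) (y j \<omega>) (G j \<omega>)) \<le> ?d ^ 3 * s + ?D \<delta>"
        by (rule sum_ito_remainder_le[where \<eta>=\<eta> and J=J])
           (use y b g small \<delta> B C \<eta> e c K q JT S' in auto)
      moreover have "?d ^ 3 * s = \<epsilon> / 2" using d by (simp add: s_def)
      ultimately show False using \<omega> small by auto
    qed
    then have "emeasure M {\<omega>\<in>space M. \<epsilon> < norm (\<Sum>j<K. c j *\<^sub>R ito_remainder \<delta> (\<beta> j \<omega>) (y j \<omega>) (G j \<omega>))} \<le> emeasure M (?B0 \<union> (?B1 \<union> (?B2 \<union> ?B3)))"
      by (rule emeasure_mono) (intro sets.Un sets)
    also have "\<dots> \<le> emeasure M ?B0 + (emeasure M ?B1 + (emeasure M ?B2 + emeasure M ?B3))"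
      using sets emeasure_subadditive[of ?B0 M "?B1 \<union> (?B2 \<union> ?B3)"] emeasure_subadditive[of ?B1 M "?B2 \<union> ?B3"]
        emeasure_subadditive[of ?B2 M ?B3]
      by (meson add_left_mono order_trans sets.Un)
    also have "\<dots> \<le> emeasure M ?B0 + (ennreal (p / 3) + (ennreal (p / 3) + ennreal (p / 3)))"
    proof (intro add_left_mono add_mono)
      have "emeasure M ?B1 \<le> ennreal (real J * (?d * (3 * \<delta>\<^sup>2 / (\<eta> / 2 / ?d) ^ 4)))"
        using \<eta> by (intro increments_small_probability) simp
      also have "real J * (?d * (3 * \<delta>\<^sup>2 / (\<eta> / 2 / ?d) ^ 4)) = ?p1 \<delta>"
        unfolding JT[symmetric] by (simp add: power2_eq_square)
      finally show "emeasure M ?B1 \<le> ennreal (p / 3)" using small by (meson ennreal_leI less_imp_le order_trans)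
      have "emeasure M ?B2 \<le> ennreal (real J * (?d * \<delta>) / Q)"
        by (rule quadratic_variation_probability[OF Q])
      also have "real J * (?d * \<delta>) / Q = p / 3"
      proof -
        have "real J * (?d * \<delta>) = ?d * T" unfolding JT[symmetric] by simp
        moreover have "w / (3 * w / p) = p / 3" if "0 < w" for w using that p by (simp add: field_simps)
        moreover have "0 < ?d * T" using T d by simp
        ultimately show ?thesis unfolding Q_def by metis
      qed
      finally show "emeasure M ?B2 \<le> ennreal (p / 3)" .
      have "emeasure M ?B3 \<le> (\<Sum>k\<in>UNIV. \<Sum>i\<in>UNIV. \<Sum>j\<in>UNIV. emeasure M {\<omega>\<in>space M. s\<^sup>2 < (S k i j \<omega>)\<^sup>2})"
        by (intro order_trans[OF emeasure_subadditive_finite] sum_mono) (auto intro!: sets.finite_UN)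
      also have "\<dots> \<le> (\<Sum>k\<in>(UNIV::'d set). \<Sum>i\<in>(UNIV::'d set). \<Sum>j\<in>(UNIV::'d set). ennreal (T * ((cm * C)\<^sup>2 * (8 * \<delta>)) / s\<^sup>2))"
        by (intro sum_mono Sp)
      also have "\<dots> = ennreal (?p3 \<delta>)"
        using T \<delta> by (simp add: ennreal_of_nat_eq_real_of_nat ennreal_mult'[symmetric] power3_eq_cube mult.assoc)
      finally show "emeasure M ?B3 \<le> ennreal (p / 3)" using small by (meson ennreal_leI less_imp_le order_trans)
    qed
    also have "\<dots> = emeasure M ?B0 + ennreal p"
      using p by (simp add: ennreal_plus[symmetric] del: ennreal_plus)
    finally show "emeasure M {\<omega>\<in>space M. \<epsilon> < norm (\<Sum>j<K. c j *\<^sub>R ito_remainder \<delta> (\<beta> j \<omega>) (y j \<omega>) (G j \<omega>))} \<le> emeasure M ?B0 + ennreal p" .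
  qed (rule \<delta>0(1))
qed

end

section \<open>Two Euler schemes along one path\<close>

text \<open>The increment of \<open>f\<close> over step \<open>r\<close> is contained in the value
  at the start of every later block. There are \<open>m - 1 - r div p\<close> such blocks, with
  \<open>p\<close> terms each.\<close>

lemma block_abel_summation:
  fixes f :: "nat \<Rightarrow> 'v::real_vector"
  assumes "0 < p"
  shows "(\<Sum>r<m * p. \<delta> *\<^sub>R (f (p * (r div p)) - f 0))
    = (\<Sum>r<m * p. (real p * \<delta> * (real m - 1 - real (r div p))) *\<^sub>R (f (Suc r) - f r))"
proof (induction m)
  case (Suc m)
  have split: "(\<Sum>r<Suc m * p. g r) = (\<Sum>r<m * p. g r) + (\<Sum>r<p. g (m * p + r))" for g :: "nat \<Rightarrow> 'v"
    using sum.atLeastLessThan_concat[of 0 "m * p" "m * p + p" g] sum.shift_bounds_nat_ivl[of g 0 "m * p" p]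
    by (simp add: atLeast0LessThan add.commute)
  have last: "(m * p + r) div p = m" if "r < p" for r
    using that by simp
  have "(\<Sum>r<Suc m * p. (real p * \<delta> * (real (Suc m) - 1 - real (r div p))) *\<^sub>R (f (Suc r) - f r))
      = (\<Sum>r<m * p. (real p * \<delta> * (real m - real (r div p))) *\<^sub>R (f (Suc r) - f r))"
    unfolding split using last by simp
  also have "\<dots> = (\<Sum>r<m * p. (real p * \<delta> * (real m - 1 - real (r div p))) *\<^sub>R (f (Suc r) - f r) + (real p * \<delta>) *\<^sub>R (f (Suc r) - f r))"
    unfolding scaleR_add_left[symmetric]
    by (intro sum.cong arg_cong2[where f=scaleR] refl) (simp add: algebra_simps)
  also have "\<dots> = (\<Sum>r<m * p. \<delta> *\<^sub>R (f (p * (r div p)) - f 0)) + (real p * \<delta>) *\<^sub>R (f (m * p) - f 0)"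
    unfolding sum.distrib Suc.IH[symmetric]
    by (intro arg_cong2[where f=plus] refl) (simp add: scaleR_sum_right[symmetric] sum_lessThan_telescope)
  also have "\<dots> = (\<Sum>r<Suc m * p. \<delta> *\<^sub>R (f (p * (r div p)) - f 0))"
  proof -
    have "(\<Sum>r<p. \<delta> *\<^sub>R (f (p * ((m * p + r) div p)) - f 0)) = (\<Sum>r<p. \<delta> *\<^sub>R (f (m * p) - f 0))"
      by (intro sum.cong refl) (simp add: last mult.commute[of p])
    also have "\<dots> = (real p * \<delta>) *\<^sub>R (f (m * p) - f 0)"
      by (simp only: sum_constant_scaleR card_lessThan scaleR_scaleR)
    finally show ?thesis unfolding split by simp
  qed
  finally show ?case by simp
qed simp

lemma sum_blocks: "(\<Sum>j<k * q. f j) = (\<Sum>i<k. \<Sum>r<q. f (i * q + r))" for f :: "nat \<Rightarrow> 'v::comm_monoid_add"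
proof (induction k)
  case (Suc k)
  have "(\<Sum>j<Suc k * q. f j) = (\<Sum>j<k * q. f j) + (\<Sum>r<q. f (k * q + r))"
    using sum.atLeastLessThan_concat[of 0 "k * q" "k * q + q" f] sum.shift_bounds_nat_ivl[of f 0 "k * q" q]
    by (simp add: atLeast0LessThan add.commute)
  then show ?case using Suc by simp
qed simp

text \<open>The weights run down from \<open>m - 1\<close> to 0. Their sum is the source of the
  factor \<open>(m - 1) / m\<close>, and their sum of squares brings in
  \<open>(2 * m - 1) / m\<close>.\<close>

lemma sum_weights_block:
  assumes "0 < p"
  shows "(\<Sum>r<m * p. real m - 1 - real (r div p)) = real p * (real m * (real m - 1) / 2)"
    and "(\<Sum>r<m * p. (real m - 1 - real (r div p))\<^sup>2) = real p * (real m * (real m - 1) * (2 * real m - 1) / 6)"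
proof -
  have A: "(\<Sum>r<m * p. F (r div p)) = real p * (\<Sum>l<m. F l)" for F :: "nat \<Rightarrow> real"
    using assms by (simp add: sum_blocks sum_distrib_left)
  have w: "(\<Sum>l<m. F (real m - 1 - real l)) = (\<Sum>l<m. F (real l))" for F :: "real \<Rightarrow> real"
  proof -
    have "(\<Sum>l<m. F (real m - 1 - real l)) = (\<Sum>l<m. F (real (m - Suc l)))"
      by (intro sum.cong refl) (auto simp: of_nat_diff algebra_simps)
    then show ?thesis using sum.nat_diff_reindex[of "\<lambda>l. F (real l)" m] by simp
  qed
  have s1: "2 * (\<Sum>l<m. real l) = real m * (real m - 1)"
    by (induction m) (auto simp: algebra_simps)
  have s2: "6 * (\<Sum>l<m. (real l)\<^sup>2) = real m * (real m - 1) * (2 * real m - 1)"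
    by (induction m) (auto simp: algebra_simps power2_eq_square)
  have "(\<Sum>r<m * p. real m - 1 - real (r div p)) = real p * (\<Sum>l<m. real l)"
    using A[of "\<lambda>l. real m - 1 - real l"] w[of "\<lambda>x. x"] by simp
  also have "(\<Sum>l<m. real l) = real m * (real m - 1) / 2" using s1 by linarith
  finally show "(\<Sum>r<m * p. real m - 1 - real (r div p)) = real p * (real m * (real m - 1) / 2)" .
  have "(\<Sum>r<m * p. (real m - 1 - real (r div p))\<^sup>2) = real p * (\<Sum>l<m. (real l)\<^sup>2)"
    using A[of "\<lambda>l. (real m - 1 - real l)\<^sup>2"] w[of power2] by simp
  also have "(\<Sum>l<m. (real l)\<^sup>2) = real m * (real m - 1) * (2 * real m - 1) / 6" using s2 by linarith
  finally show "(\<Sum>r<m * p. (real m - 1 - real (r div p))\<^sup>2) = real p * (real m * (real m - 1) * (2 * real m - 1) / 6)" .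
qed

lemma geometric_exp_le: "0 \<le> x \<Longrightarrow> x * (\<Sum>i<k. exp (x * real i)) \<le> exp (x * real k) - 1"
proof (induction k)
  case (Suc k)
  have "exp (x * real k) * (1 + x) \<le> exp (x * real k) * exp x"
    by (intro mult_left_mono exp_ge_add_one_self) simp
  also have "\<dots> = exp (x * real (Suc k))" by (simp add: exp_add[symmetric] algebra_simps)
  finally show ?case using Suc by (simp add: algebra_simps)
qed simp

text \<open>The exponents refer to the last index \<open>n\<close> instead of \<open>k\<close>, so
  one bound serves all \<open>k\<close>.\<close>

lemma discrete_gronwall:
  fixes u X :: "nat \<Rightarrow> real"
  assumes u0: "u 0 \<le> 0" and step: "\<And>k. k < n \<Longrightarrow> u (Suc k) \<le> (1 + x) * u k + X k" and x: "0 \<le> x" and X: "\<And>k. 0 \<le> X k"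
    and k: "k \<le> n"
  shows "u k \<le> (\<Sum>i<n. exp (x * (real n - 1 - real i)) * X i)"
proof -
  have "u k \<le> (\<Sum>i<k. exp (x * (real k - 1 - real i)) * X i)"
    using k
  proof (induction k)
    case (Suc k)
    let ?s = "\<Sum>i<k. exp (x * (real k - 1 - real i)) * X i"
    have s0: "0 \<le> ?s" using X by (intro sum_nonneg) auto
    have "u (Suc k) \<le> (1 + x) * u k + X k" using Suc by (intro step) auto
    also have "\<dots> \<le> (1 + x) * ?s + X k" using Suc x by (intro add_right_mono mult_left_mono) auto
    also have "\<dots> \<le> exp x * ?s + X k"
      using s0 exp_ge_add_one_self[of x] by (intro add_right_mono mult_right_mono) auto
    also have "exp x * ?s = (\<Sum>i<k. exp (x * (real (Suc k) - 1 - real i)) * X i)"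
      unfolding sum_distrib_left mult.assoc[symmetric] exp_add[symmetric]
      by (intro sum.cong arg_cong2[where f="(*)"] arg_cong[where f=exp] refl) (simp add: algebra_simps)
    finally show ?case by simp
  qed (use u0 in simp)
  also have "\<dots> \<le> (\<Sum>i<k. exp (x * (real n - 1 - real i)) * X i)"
    using k x X by (intro sum_mono mult_right_mono) (auto intro!: mult_left_mono)
  also have "\<dots> \<le> (\<Sum>i<n. exp (x * (real n - 1 - real i)) * X i)"
    using k X by (intro sum_mono2) auto
  finally show ?thesis .
qed

text \<open>A single path is fixed and everything is deterministic: \<open>g\<close> are its
  increments on the finest grid, \<open>y\<close> is the scheme with \<open>m * n\<close> steps seen
  on that grid, \<open>\<beta>\<close> its frozen drift, \<open>z\<close> the scheme with
  \<open>n\<close> steps, and \<open>S\<close> dominates the path.\<close>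

locale euler_pair = drift b b' b'' x0 L a
  for b :: "real^'d::finite \<Rightarrow> real^'d" and b' b'' x0 L a +
  fixes T \<delta> :: real and m n p :: nat and y \<beta> g z :: "nat \<Rightarrow> real^'d" and S :: "nat \<Rightarrow> real"
  assumes T_pos: "0 < T" and m_pos: "0 < m" and n_pos: "0 < n" and p_pos: "0 < p"
    and delta_eq: "\<delta> = T / (real m * real n * real p)"
    and y0: "y 0 = x0" and y_Suc: "\<And>j. y (Suc j) = y j + \<delta> *\<^sub>R \<beta> j + g j"
    and beta_eq: "\<And>j. \<beta> j = b (y (p * (j div p)))"
    and z0: "z 0 = x0" and z_Suc: "\<And>k. z (Suc k) = z k + (T / real n) *\<^sub>R b (z k) + (\<Sum>r<m * p. g (k * (m * p) + r))"
    and S_bound: "\<And>j. norm (\<Sum>i<j. g i) \<le> S j" and S_mono: "\<And>i j. i \<le> j \<Longrightarrow> S i \<le> S j"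
begin

abbreviation "q \<equiv> m * p"

text \<open>The weight that Abel summation gives to the increment of \<open>b\<close> over step
  \<open>j\<close>; it is 0 on the last fine step of each coarse step.\<close>

definition "c j = (T / (real m * real n)) * (real m - 1 - real ((j div p) mod m))"

definition "mart k = (\<Sum>j<k * q. c j *\<^sub>R b' (y j) (g j))"

definition "rest k = (\<Sum>j<k * q. c j *\<^sub>R ito_remainder \<delta> (\<beta> j) (y j) (g j))"

text \<open>The drift that Ito's formula gives to \<open>b\<close> along the scheme.\<close>

definition "F j = b' (y j) (\<beta> j) + (1/2) *\<^sub>R (\<Sum>i\<in>UNIV. b'' (y j) (axis i 1) (axis i 1))"

text \<open>A Gronwall bound designed to dominate both \<open>norm (\<beta> j) + L\<close> and
  \<open>L * (1 + norm (y j - x0))\<close>, the two quantities that control \<open>F j\<close>;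
  hence the extra \<open>L\<close> next to \<open>norm (b x0)\<close>.\<close>

definition "\<Theta> j = exp (L * (real j * \<delta>)) * (norm (b x0) + L + L * S j)"

lemma delta_pos: "0 < \<delta>"
  using T_pos m_pos n_pos p_pos by (simp add: delta_eq)

lemma S_nonneg: "0 \<le> S j"
  using S_bound[of j] norm_ge_zero order_trans by blast

lemma c_nonneg: "0 \<le> c j"
proof -
  have "(j div p) mod m < m" using m_pos by simp
  then have "real ((j div p) mod m) \<le> real m - 1" by linarith
  then show ?thesis unfolding c_def using T_pos by (intro mult_nonneg_nonneg) auto
qed

lemma c_block: "r < q \<Longrightarrow> c (k * q + r) = (T / (real m * real n)) * (real m - 1 - real (r div p))"
proof -
  assume r: "r < q"
  have "k * q + r = k * m * p + r" by simp
  then have "(k * q + r) div p = k * m + r div p"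
    using p_pos by (metis div_mult_self3 add.commute less_numeral_extra(3) mult.commute)
  moreover have "r div p < m" using r p_pos by (simp add: less_mult_imp_div_less)
  ultimately show ?thesis by (simp add: c_def)
qed

lemma Theta_mono: "i \<le> j \<Longrightarrow> \<Theta> i \<le> \<Theta> j"
  unfolding \<Theta>_def using S_mono[of i j] S_nonneg[of i] L_pos delta_pos
  by (intro mult_mono) (auto intro!: mult_left_mono mult_right_mono add_nonneg_nonneg)

lemma y_expand: "y j = x0 + \<delta> *\<^sub>R (\<Sum>i<j. \<beta> i) + (\<Sum>i<j. g i)"
  by (induction j) (auto simp: y0 y_Suc scaleR_add_right)

lemma y_bound: "norm (b x0) + L + L * norm (y j - x0) \<le> \<Theta> j"
proof (induction j rule: less_induct)
  case (less j)
  have \<beta>: "norm (\<beta> i) \<le> \<Theta> i" if "i < j" for i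
  proof -
    have le: "p * (i div p) \<le> i" by simp
    have "norm (\<beta> i) \<le> norm (b x0) + L * norm (y (p * (i div p)) - x0)"
      unfolding beta_eq by (rule b_growth)
    also have "\<dots> \<le> \<Theta> (p * (i div p))"
      using less[of "p * (i div p)"] le that L_pos by linarith
    also have "\<dots> \<le> \<Theta> i" by (rule Theta_mono[OF le])
    finally show ?thesis .
  qed
  let ?C = "norm (b x0) + L + L * S j"
  have C0: "0 \<le> ?C" using L_pos S_nonneg[of j] by (auto intro!: add_nonneg_nonneg)
  have "norm (y j - x0) \<le> \<delta> * (\<Sum>i<j. norm (\<beta> i)) + S j"
  proof -
    have "y j - x0 = \<delta> *\<^sub>R (\<Sum>i<j. \<beta> i) + (\<Sum>i<j. g i)" by (simp add: y_expand)
    then have "norm (y j - x0) \<le> norm (\<delta> *\<^sub>R (\<Sum>i<j. \<beta> i)) + norm (\<Sum>i<j. g i)"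
      by (simp only: norm_triangle_ineq)
    also have "norm (\<delta> *\<^sub>R (\<Sum>i<j. \<beta> i)) \<le> \<delta> * (\<Sum>i<j. norm (\<beta> i))"
      using delta_pos by (simp add: norm_sum mult_left_mono)
    finally show ?thesis using S_bound[of j] by linarith
  qed
  also have "(\<Sum>i<j. norm (\<beta> i)) \<le> (\<Sum>i<j. exp (L * \<delta> * real i) * ?C)"
  proof (rule sum_mono)
    fix i assume i: "i \<in> {..<j}"
    then have "norm (\<beta> i) \<le> \<Theta> i" using \<beta> by simp
    also have "\<dots> \<le> exp (L * \<delta> * real i) * ?C"
      unfolding \<Theta>_def using S_mono[of i j] i L_pos by (intro mult_mono) (auto simp: mult_ac intro!: mult_left_mono add_nonneg_nonneg mult_nonneg_nonneg S_nonneg)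
    finally show "norm (\<beta> i) \<le> exp (L * \<delta> * real i) * ?C" .
  qed
  also have "\<dots> = (\<Sum>i<j. exp (L * \<delta> * real i)) * ?C" by (simp add: sum_distrib_right)
  finally have "norm (y j - x0) \<le> \<delta> * ((\<Sum>i<j. exp (L * \<delta> * real i)) * ?C) + S j"
    using delta_pos by (simp add: mult_left_mono)
  then have "L * norm (y j - x0) \<le> L * (\<delta> * ((\<Sum>i<j. exp (L * \<delta> * real i)) * ?C) + S j)"
    using L_pos by (intro mult_left_mono) auto
  also have "\<dots> = (L * \<delta> * (\<Sum>i<j. exp (L * \<delta> * real i))) * ?C + L * S j"
    by (simp add: algebra_simps)
  also have "\<dots> \<le> (exp (L * \<delta> * real j) - 1) * ?C + L * S j"
    using geometric_exp_le[of "L * \<delta>" j] L_pos delta_pos C0 by (intro add_right_mono mult_right_mono) auto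
  finally show ?case
    by (simp add: \<Theta>_def algebra_simps)
qed

lemma beta_bound: "norm (\<beta> j) \<le> \<Theta> j - L"
proof -
  have le: "p * (j div p) \<le> j" by simp
  have "norm (\<beta> j) \<le> norm (b x0) + L * norm (y (p * (j div p)) - x0)"
    unfolding beta_eq by (rule b_growth)
  also have "\<dots> \<le> \<Theta> j - L"
    using y_bound[of "p * (j div p)"] Theta_mono[OF le] by linarith
  finally show ?thesis .
qed

text \<open>The gradient term contributes \<open>L * \<Theta>\<close> and the Laplacian
  \<open>a * \<Theta> / L\<close>, by the linear growth in its assumption. This is the origin of
  \<open>L\<^sup>2 + a\<close> in \<open>C_B\<close>.\<close>

lemma F_bound: "norm (F j) \<le> (L\<^sup>2 + a) / L * \<Theta> j"
proof -
  have "norm (F j) \<le> norm (b' (y j) (\<beta> j)) + norm ((1/2) *\<^sub>R (\<Sum>i\<in>UNIV. b'' (y j) (axis i 1) (axis i 1)))"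
    unfolding F_def by (rule norm_triangle_ineq)
  also have "norm (b' (y j) (\<beta> j)) \<le> L * (\<Theta> j - L)"
    using norm_blinfun[of "b' (y j)" "\<beta> j"] b'_bound[of "y j"] beta_bound[of j] L_pos
    by (meson mult_mono norm_ge_zero order_trans less_imp_le)
  also have "norm ((1/2) *\<^sub>R (\<Sum>i\<in>UNIV. b'' (y j) (axis i 1) (axis i 1))) \<le> a * (1 + norm (y j - x0))"
    using trace_bound[of "y j"] by simp
  also have "\<dots> \<le> a * (\<Theta> j / L)"
  proof (rule mult_left_mono[OF _ a_nonneg])
    have "L * (1 + norm (y j - x0)) \<le> \<Theta> j"
      using y_bound[of j] norm_ge_zero[of "b x0"] unfolding distrib_left mult_1_right by linarith
    then show "1 + norm (y j - x0) \<le> \<Theta> j / L" using L_pos by (simp add: field_simps)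
  qed
  also have "L * (\<Theta> j - L) + a * (\<Theta> j / L) \<le> (L\<^sup>2 + a) / L * \<Theta> j"
  proof -
    have "(L\<^sup>2 + a) / L * \<Theta> j = L * \<Theta> j + a * (\<Theta> j / L)"
      using L_pos by (simp add: add_divide_distrib power2_eq_square distrib_right)
    moreover have "L * (\<Theta> j - L) \<le> L * \<Theta> j" using L_pos by (intro mult_left_mono) auto
    ultimately show ?thesis by linarith
  qed
  finally show ?thesis by simp
qed

definition "dB k = (\<Sum>r<q. c (k * q + r) * \<delta> * norm (F (k * q + r)))"

text \<open>Within a coarse step the finer scheme freezes its drift at several points. The deviation
  from \<open>b (y (k * q))\<close> is an Abel sum of increments of \<open>b\<close>, each of which
  splits, by the definition of \<open>ito_remainder\<close>, into a martingale term, a remainder and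
  \<open>\<delta> *\<^sub>R F\<close>.\<close>

lemma difference_step:
  "y (Suc k * q) - z (Suc k) - mart (Suc k) - rest (Suc k)
   = (y (k * q) - z k - mart k - rest k) + (T / real n) *\<^sub>R (b (y (k * q)) - b (z k)) + (\<Sum>r<q. (c (k * q + r) * \<delta>) *\<^sub>R F (k * q + r))"
proof -
  have q\<delta>: "real q * \<delta> = T / real n" using m_pos n_pos p_pos by (simp add: delta_eq field_simps)
  have p\<delta>: "real p * \<delta> = T / (real m * real n)" using m_pos n_pos p_pos by (simp add: delta_eq field_simps)
  have yb: "y (Suc k * q) = y (k * q) + (\<Sum>r<q. \<delta> *\<^sub>R \<beta> (k * q + r)) + (\<Sum>r<q. g (k * q + r))"
  proof -
    have "y (Suc k * q) = y (k * q) + \<delta> *\<^sub>R ((\<Sum>i<Suc k * q. \<beta> i) - (\<Sum>i<k * q. \<beta> i)) + ((\<Sum>i<Suc k * q. g i) - (\<Sum>i<k * q. g i))"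
      unfolding y_expand by (simp add: algebra_simps)
    then show ?thesis unfolding sum_blocks by (simp add: scaleR_sum_right)
  qed
  have \<beta>: "\<beta> (k * q + r) = b (y (k * q + p * (r div p)))" if "r < q" for r
  proof -
    have "k * q + r = k * m * p + r" by simp
    then have "(k * q + r) div p = k * m + r div p"
      using p_pos by (metis div_mult_self3 add.commute less_numeral_extra(3) mult.commute)
    then show ?thesis by (simp add: beta_eq algebra_simps)
  qed
  have "(\<Sum>r<q. \<delta> *\<^sub>R \<beta> (k * q + r)) = (\<Sum>r<q. \<delta> *\<^sub>R b (y (k * q)) + \<delta> *\<^sub>R (b (y (k * q + p * (r div p))) - b (y (k * q + 0))))"
    by (intro sum.cong refl) (simp add: \<beta> scaleR_diff_right)
  also have "\<dots> = (T / real n) *\<^sub>R b (y (k * q)) + (\<Sum>r<q. (real p * \<delta> * (real m - 1 - real (r div p))) *\<^sub>R (b (y (k * q + Suc r)) - b (y (k * q + r))))"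
  proof -
    have "(\<Sum>r<q. \<delta> *\<^sub>R v) = (T / real n) *\<^sub>R v" for v :: "real^'d"
      by (simp only: sum_constant_scaleR card_lessThan scaleR_scaleR q\<delta>)
    then show ?thesis
      using block_abel_summation[OF p_pos, where f="\<lambda>r. b (y (k * q + r))" and m=m and \<delta>=\<delta>]
      by (simp only: sum.distrib)
  qed
  also have "(\<Sum>r<q. (real p * \<delta> * (real m - 1 - real (r div p))) *\<^sub>R (b (y (k * q + Suc r)) - b (y (k * q + r))))
      = (\<Sum>r<q. c (k * q + r) *\<^sub>R b' (y (k * q + r)) (g (k * q + r)) + c (k * q + r) *\<^sub>R ito_remainder \<delta> (\<beta> (k * q + r)) (y (k * q + r)) (g (k * q + r)) + (c (k * q + r) * \<delta>) *\<^sub>R F (k * q + r))"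
  proof (intro sum.cong refl)
    fix r assume "r \<in> {..<q}"
    then have "real p * \<delta> * (real m - 1 - real (r div p)) = c (k * q + r)"
      using c_block[of r k] by (simp add: p\<delta>)
    moreover have "b (y (k * q + Suc r)) - b (y (k * q + r)) = b' (y (k * q + r)) (g (k * q + r)) + ito_remainder \<delta> (\<beta> (k * q + r)) (y (k * q + r)) (g (k * q + r)) + \<delta> *\<^sub>R F (k * q + r)"
      by (simp add: ito_remainder_def F_def y_Suc)
    ultimately show "(real p * \<delta> * (real m - 1 - real (r div p))) *\<^sub>R (b (y (k * q + Suc r)) - b (y (k * q + r)))
      = c (k * q + r) *\<^sub>R b' (y (k * q + r)) (g (k * q + r)) + c (k * q + r) *\<^sub>R ito_remainder \<delta> (\<beta> (k * q + r)) (y (k * q + r)) (g (k * q + r)) + (c (k * q + r) * \<delta>) *\<^sub>R F (k * q + r)"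
      by (simp add: scaleR_add_right)
  qed
  finally show ?thesis
    unfolding yb z_Suc mart_def rest_def sum_blocks
    by (simp add: sum.distrib scaleR_diff_right algebra_simps)
qed

text \<open>Within a block the weights decrease while \<open>\<Theta>\<close> increases, so by Chebyshev's sum inequality the weights may be
replaced by their mean.\<close>
lemma dB_bound:
  "dB k \<le> T * (real m - 1) / (2 * real m * real n) * ((L\<^sup>2 + a) / L) * (\<delta> * (\<Sum>r<q. \<Theta> (k * q + r)))"
proof -
  let ?K = "(L\<^sup>2 + a) / L"
  have K0: "0 \<le> ?K" using L_pos a_nonneg by simp
  have qpos: "0 < real q" using m_pos p_pos by simp
  have "dB k \<le> (\<Sum>r<q. c (k * q + r) * \<delta> * (?K * \<Theta> (k * q + r)))"
    unfolding dB_def using c_nonneg delta_pos by (intro sum_mono mult_left_mono F_bound) auto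
  also have "\<dots> = ?K * \<delta> * (\<Sum>r<q. \<Theta> (k * q + r) * c (k * q + r))"
    unfolding sum_distrib_left by (intro sum.cong refl) simp
  finally have "dB k \<le> ?K * \<delta> * (\<Sum>r<q. \<Theta> (k * q + r) * c (k * q + r))" .
  also have "\<dots> \<le> ?K * \<delta> * (((\<Sum>r<q. \<Theta> (k * q + r)) * (\<Sum>r<q. c (k * q + r))) / real q)"
  proof -
    have "real q * (\<Sum>r=0..<q. \<Theta> (k * q + r) * c (k * q + r)) \<le> (\<Sum>r=0..<q. \<Theta> (k * q + r)) * (\<Sum>r=0..<q. c (k * q + r))"
    proof (rule Chebyshev_sum_upper)
      show "\<Theta> (k * q + i) \<le> \<Theta> (k * q + j)" if "i \<le> j" "j < q" for i j
        using that by (intro Theta_mono) simp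
      show "c (k * q + j) \<le> c (k * q + i)" if "i \<le> j" "j < q" for i j
        using that T_pos m_pos n_pos div_le_mono[OF that(1), of p]
        by (simp add: c_block) (intro divide_right_mono mult_left_mono; simp)
    qed
    then have "(\<Sum>r<q. \<Theta> (k * q + r) * c (k * q + r)) \<le> ((\<Sum>r<q. \<Theta> (k * q + r)) * (\<Sum>r<q. c (k * q + r))) / real q"
      using qpos by (simp only: pos_le_divide_eq atLeast0LessThan mult.commute[of _ "real q"])
    then show ?thesis by (intro mult_left_mono mult_nonneg_nonneg K0 less_imp_le[OF delta_pos])
  qed
  also have "(\<Sum>r<q. c (k * q + r)) = T / (real m * real n) * (real p * (real m * (real m - 1) / 2))"
    unfolding sum_weights_block(1)[OF p_pos, of m, symmetric] sum_distrib_left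
    by (intro sum.cong refl) (simp add: c_block)
  also have "?K * \<delta> * (((\<Sum>r<q. \<Theta> (k * q + r)) * (T / (real m * real n) * (real p * (real m * (real m - 1) / 2)))) / real q) = T * (real m - 1) / (2 * real m * real n) * ?K * (\<delta> * (\<Sum>r<q. \<Theta> (k * q + r)))"
  proof -
    have "mm \<noteq> 0 \<Longrightarrow> pp \<noteq> 0 \<Longrightarrow> nn \<noteq> 0 \<Longrightarrow> (Th * (T / (mm * nn) * (pp * (mm * (mm - 1) / 2)))) / (mm * pp) = T * (mm - 1) / (2 * mm * nn) * Th"
      for mm pp nn Th :: real
      by (simp add: field_simps)
    then have X: "(\<Sum>r<q. \<Theta> (k * q + r)) * (T / (real m * real n) * (real p * (real m * (real m - 1) / 2))) / real q = T * (real m - 1) / (2 * real m * real n) * (\<Sum>r<q. \<Theta> (k * q + r))"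
      using m_pos p_pos n_pos by (simp only: of_nat_mult of_nat_eq_0_iff neq0_conv)
    show ?thesis unfolding X by (simp only: mult_ac)
  qed
  finally show ?thesis .
qed

text \<open>Gronwall's factor covers the time after the coarse step and the exponential in
  \<open>\<Theta>\<close> at most the time up to its end. Their product is at most
  \<open>exp (L * T)\<close>, so \<open>C_B\<close> contains this exponential only once.\<close>

lemma sum_dB_bound:
  "(\<Sum>k<n. exp (L * (T / real n) * (real n - 1 - real k)) * dB k)
   \<le> T * (real m - 1) / (2 * real m * real n) * C_B T L a * (T * (norm (b x0) + L) / L + \<delta> * (\<Sum>j<n * q. S j))"
proof -
  let ?A = "T * (real m - 1) / (2 * real m * real n) * ((L\<^sup>2 + a) / L)"
  have A0: "0 \<le> ?A" using T_pos m_pos n_pos L_pos a_nonneg by simp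
  have "(\<Sum>k<n. exp (L * (T / real n) * (real n - 1 - real k)) * dB k)
      \<le> (\<Sum>k<n. \<Sum>r<q. ?A * (\<delta> * (exp (L * T) * (norm (b x0) + L + L * S (k * q + r)))))"
  proof (rule sum_mono)
    fix k assume "k \<in> {..<n}"
    let ?E = "exp (L * (T / real n) * (real n - 1 - real k))"
    have "?E * dB k \<le> ?E * (?A * (\<delta> * (\<Sum>r<q. \<Theta> (k * q + r))))"
      by (intro mult_left_mono dB_bound) simp
    also have "\<dots> = (\<Sum>r<q. ?A * (\<delta> * (?E * \<Theta> (k * q + r))))"
      unfolding sum_distrib_left by (intro sum.cong refl) (simp only: mult_ac)
    also have "\<dots> \<le> (\<Sum>r<q. ?A * (\<delta> * (exp (L * T) * (norm (b x0) + L + L * S (k * q + r)))))"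
    proof (intro sum_mono mult_left_mono)
      fix r assume r: "r \<in> {..<q}"
      have q\<delta>: "real q * \<delta> = T / real n" using m_pos n_pos p_pos by (simp add: delta_eq field_simps)
      have "k * q + r \<le> Suc k * q" using r by simp
      then have "real (k * q + r) * \<delta> \<le> real (Suc k * q) * \<delta>"
        using delta_pos by (intro mult_right_mono of_nat_mono) auto
      also have "\<dots> = (real k + 1) * (T / real n)" by (simp add: q\<delta>[symmetric] algebra_simps)
      finally have "(T / real n) * (real n - 1 - real k) + real (k * q + r) * \<delta> \<le> (T / real n) * real n"
        by (simp add: algebra_simps)
      then have "(T / real n) * (real n - 1 - real k) + real (k * q + r) * \<delta> \<le> T" using n_pos by simp
      then have "L * ((T / real n) * (real n - 1 - real k) + real (k * q + r) * \<delta>) \<le> L * T"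
        using L_pos by (intro mult_left_mono) auto
      then have "?E * exp (L * (real (k * q + r) * \<delta>)) \<le> exp (L * T)"
        by (simp only: exp_add[symmetric] distrib_left mult.assoc exp_le_cancel_iff)
      then show "?E * \<Theta> (k * q + r) \<le> exp (L * T) * (norm (b x0) + L + L * S (k * q + r))"
        unfolding \<Theta>_def mult.assoc[symmetric] using L_pos S_nonneg by (intro mult_right_mono) (auto intro!: add_nonneg_nonneg)
    qed (use A0 delta_pos in auto)
    finally show "?E * dB k \<le> (\<Sum>r<q. ?A * (\<delta> * (exp (L * T) * (norm (b x0) + L + L * S (k * q + r)))))" .
  qed
  also have "\<dots> = (\<Sum>j<n * q. ?A * (\<delta> * (exp (L * T) * (norm (b x0) + L + L * S j))))"
    by (rule sum_blocks[symmetric])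
  also have "\<dots> = ?A * exp (L * T) * ((real (n * q) * \<delta>) * (norm (b x0) + L) + L * (\<delta> * (\<Sum>j<n * q. S j)))"
  proof -
    have "(\<Sum>j<N. A * (\<delta> * (E * (B + L * S j)))) = A * E * ((real N * \<delta>) * B + L * (\<delta> * (\<Sum>j<N. S j)))" for A E B N
      by (simp add: sum_distrib_left[symmetric] sum.distrib algebra_simps)
    then show ?thesis .
  qed
  also have "real (n * q) * \<delta> = T" using m_pos n_pos p_pos by (simp add: delta_eq)
  also have "?A * exp (L * T) * (T * (norm (b x0) + L) + L * (\<delta> * (\<Sum>j<n * q. S j)))
      = T * (real m - 1) / (2 * real m * real n) * C_B T L a * (T * (norm (b x0) + L) / L + \<delta> * (\<Sum>j<n * q. S j))"
  proof -
    have "(P * (K / L)) * E * (T * B + L * s) = P * (E * K) * (T * B / L + s)" for P K E B s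
      using L_pos by (simp add: field_simps)
    then show ?thesis by (simp only: C_B_def mult.commute[of T L])
  qed
  finally show ?thesis .
qed

text \<open>Gronwall's lemma is applied after subtracting \<open>mart\<close> and
  \<open>rest\<close>, so these enter the recursion only through the Lipschitz term. The martingale
  thus appears once by itself and once in an exponentially weighted sum, which become the two
  summands of \<open>C_A\<close>.\<close>

lemma euler_difference_bound:
  assumes k: "k \<le> n"
  shows "norm (y (k * q) - z k) \<le> norm (mart k) + norm (rest k)
    + (\<Sum>i<n. exp (L * (T / real n) * (real n - 1 - real i)) * (L * (T / real n) * (norm (mart i) + norm (rest i))))
    + T * (real m - 1) / (2 * real m * real n) * C_B T L a * (T * (norm (b x0) + L) / L + \<delta> * (\<Sum>j<n * q. S j))"
proof -
  let ?E = "\<lambda>k. y (k * q) - z k - mart k - rest k" and ?H = "T / real n"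
  let ?X = "\<lambda>k. L * ?H * (norm (mart k) + norm (rest k)) + dB k"
  have H0: "0 \<le> ?H" using T_pos by simp
  have dB0: "0 \<le> dB k" for k unfolding dB_def using c_nonneg delta_pos by (intro sum_nonneg) auto
  have "norm (?E k) \<le> (\<Sum>i<n. exp (L * ?H * (real n - 1 - real i)) * ?X i)"
  proof (rule discrete_gronwall[OF _ _ _ _ k])
    show "norm (?E 0) \<le> 0" by (simp add: y0 z0 mart_def rest_def)
    show "0 \<le> L * ?H" by (rule mult_nonneg_nonneg[OF less_imp_le[OF L_pos] H0])
    then show "0 \<le> ?X k" for k using dB0 by (intro add_nonneg_nonneg mult_nonneg_nonneg[of "L * ?H"]) auto
    fix k
    have "norm (?E (Suc k)) \<le> norm (?E k) + norm (?H *\<^sub>R (b (y (k * q)) - b (z k))) + norm (\<Sum>r<q. (c (k * q + r) * \<delta>) *\<^sub>R F (k * q + r))"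
      unfolding difference_step by (intro order_trans[OF norm_triangle_ineq] add_right_mono norm_triangle_ineq)
    also have "norm (\<Sum>r<q. (c (k * q + r) * \<delta>) *\<^sub>R F (k * q + r)) \<le> dB k"
      unfolding dB_def using c_nonneg delta_pos by (intro order_trans[OF norm_sum] sum_mono) simp
    finally have "norm (?E (Suc k)) \<le> norm (?E k) + norm (?H *\<^sub>R (b (y (k * q)) - b (z k))) + dB k" by simp
    moreover have "norm (?H *\<^sub>R (b (y (k * q)) - b (z k))) \<le> ?H * (L * (norm (?E k) + norm (mart k) + norm (rest k)))"
      unfolding norm_scaleR abs_of_nonneg[OF H0]
    proof (intro mult_left_mono H0 order_trans[OF b_lipschitz])
      show "norm (y (k * q) - z k) \<le> norm (?E k) + norm (mart k) + norm (rest k)"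
        using norm_triangle_ineq[of "?E k" "mart k"] norm_triangle_ineq[of "?E k + mart k" "rest k"] by simp
    qed (use L_pos in simp)
    ultimately show "norm (?E (Suc k)) \<le> (1 + L * ?H) * norm (?E k) + ?X k"
      by (simp only: distrib_left distrib_right mult_1_left mult.assoc mult.commute[of L] mult.left_commute[of L])
  qed
  moreover have "norm (y (k * q) - z k) \<le> norm (?E k) + norm (mart k) + norm (rest k)"
    using norm_triangle_ineq[of "?E k" "mart k"] norm_triangle_ineq[of "?E k + mart k" "rest k"] by simp
  moreover have "(\<Sum>i<n. exp (L * ?H * (real n - 1 - real i)) * ?X i)
     = (\<Sum>i<n. exp (L * ?H * (real n - 1 - real i)) * (L * ?H * (norm (mart i) + norm (rest i)))) + (\<Sum>i<n. exp (L * ?H * (real n - 1 - real i)) * dB i)"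
    by (simp add: sum.distrib distrib_left)
  ultimately show ?thesis using sum_dB_bound by linarith
qed

end

section \<open>Exponential moments of the difference\<close>

definition exp_moment_le :: "'w measure \<Rightarrow> ('w \<Rightarrow> real) \<Rightarrow> real \<Rightarrow> bool" where
  "exp_moment_le M Z c \<longleftrightarrow> Z \<in> borel_measurable M \<and> (\<integral>\<^sup>+\<omega>. ennreal (exp (Z \<omega>)) \<partial>M) \<le> ennreal (exp c)"

lemma exp_moment_leI: "Z \<in> borel_measurable M \<Longrightarrow> (\<integral>\<^sup>+\<omega>. ennreal (exp (Z \<omega>)) \<partial>M) \<le> ennreal (exp c) \<Longrightarrow> exp_moment_le M Z c"
  by (simp add: exp_moment_le_def)

lemma (in prob_space) exp_moment_le_const: "k \<le> c \<Longrightarrow> exp_moment_le M (\<lambda>_. k) c"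
  by (simp add: exp_moment_le_def emeasure_space_1 ennreal_leI)

text \<open>Jensen's inequality with the missing mass \<open>1 - sum w I\<close> placed at 0, where
  the exponential is 1.\<close>

lemma exp_subconvex_sum:
  fixes y w :: "'i \<Rightarrow> real"
  assumes "finite I" and w: "\<And>i. i \<in> I \<Longrightarrow> 0 \<le> w i" and W: "sum w I \<le> 1"
  shows "exp (\<Sum>i\<in>I. w i * y i) \<le> (\<Sum>i\<in>I. w i * exp (y i)) + (1 - sum w I)"
proof -
  define s where "s = (\<Sum>i\<in>I. w i * y i)"
  have tangent: "exp s * (1 + (v - s)) \<le> exp v" for v
  proof -
    have "exp s * (1 + (v - s)) \<le> exp s * exp (v - s)"
      by (intro mult_left_mono exp_ge_add_one_self) simp
    then show ?thesis by (simp add: exp_add[symmetric])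
  qed
  have "exp s = (\<Sum>i\<in>I. w i * (exp s * (1 + (y i - s)))) + (1 - sum w I) * (exp s * (1 + (0 - s)))"
  proof -
    have "(\<Sum>i\<in>I. w i * (exp s * (1 + (y i - s)))) = exp s * (\<Sum>i\<in>I. w i * (1 - s) + w i * y i)"
      unfolding sum_distrib_left by (intro sum.cong refl) (simp add: algebra_simps)
    also have "(\<Sum>i\<in>I. w i * (1 - s) + w i * y i) = sum w I * (1 - s) + s"
      by (simp add: sum.distrib sum_distrib_right s_def)
    finally show ?thesis by (simp add: algebra_simps)
  qed
  also have "\<dots> \<le> (\<Sum>i\<in>I. w i * exp (y i)) + (1 - sum w I) * exp 0"
    using w W tangent tangent[of 0] by (intro add_mono sum_mono mult_left_mono) auto
  finally show ?thesis by (simp add: s_def)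
qed

text \<open>Convexity of the exponential replaces Hoelder's inequality, so that no exponents have to be matched.\<close>
lemma (in prob_space) exp_moment_le_convex:
  fixes w c :: "'i \<Rightarrow> real"
  assumes I: "finite I" and w: "\<And>i. i \<in> I \<Longrightarrow> 0 \<le> w i" and W: "sum w I \<le> 1"
    and Z: "\<And>i. i \<in> I \<Longrightarrow> exp_moment_le M (Z i) (c i)"
  shows "exp_moment_le M (\<lambda>\<omega>. \<Sum>i\<in>I. w i * Z i \<omega>) (\<Sum>i\<in>I. w i * c i)"
proof (rule exp_moment_leI)
  have Zm: "Z i \<in> borel_measurable M" if "i \<in> I" for i using Z[OF that] by (simp add: exp_moment_le_def)
  show "(\<lambda>\<omega>. \<Sum>i\<in>I. w i * Z i \<omega>) \<in> borel_measurable M"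
    by (intro borel_measurable_sum borel_measurable_times Zm) auto
  let ?S = "\<Sum>i\<in>I. w i * c i"
  have one: "(\<integral>\<^sup>+\<omega>. ennreal (exp (Z i \<omega> - c i)) \<partial>M) \<le> 1" if i: "i \<in> I" for i
  proof -
    have [measurable]: "Z i \<in> borel_measurable M" by (rule Zm[OF i])
    have "(\<integral>\<^sup>+\<omega>. ennreal (exp (Z i \<omega> - c i)) \<partial>M) = (\<integral>\<^sup>+\<omega>. ennreal (exp (- c i)) * ennreal (exp (Z i \<omega>)) \<partial>M)"
      by (intro nn_integral_cong) (simp add: ennreal_mult'[symmetric] exp_add[symmetric])
    also have "\<dots> = ennreal (exp (- c i)) * (\<integral>\<^sup>+\<omega>. ennreal (exp (Z i \<omega>)) \<partial>M)"
      by (rule nn_integral_cmult) simp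
    also have "\<dots> \<le> ennreal (exp (- c i)) * ennreal (exp (c i))"
      using Z[OF i] by (intro mult_left_mono) (auto simp: exp_moment_le_def)
    also have "\<dots> = 1" by (simp add: ennreal_mult'[symmetric] exp_add[symmetric])
    finally show ?thesis .
  qed
  have "(\<integral>\<^sup>+\<omega>. ennreal (exp (\<Sum>i\<in>I. w i * Z i \<omega>)) \<partial>M) = (\<integral>\<^sup>+\<omega>. ennreal (exp ?S) * ennreal (exp (\<Sum>i\<in>I. w i * (Z i \<omega> - c i))) \<partial>M)"
    by (intro nn_integral_cong) (simp add: ennreal_mult'[symmetric] exp_add[symmetric] right_diff_distrib sum_subtractf)
  also have "\<dots> \<le> (\<integral>\<^sup>+\<omega>. ennreal (exp ?S) * ((\<Sum>i\<in>I. ennreal (w i) * ennreal (exp (Z i \<omega> - c i))) + ennreal (1 - sum w I)) \<partial>M)"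
  proof (intro nn_integral_mono mult_left_mono)
    fix \<omega>
    have "ennreal (exp (\<Sum>i\<in>I. w i * (Z i \<omega> - c i))) \<le> ennreal ((\<Sum>i\<in>I. w i * exp (Z i \<omega> - c i)) + (1 - sum w I))"
      by (intro ennreal_leI exp_subconvex_sum I w W)
    also have "\<dots> = (\<Sum>i\<in>I. ennreal (w i) * ennreal (exp (Z i \<omega> - c i))) + ennreal (1 - sum w I)"
      using w W I by (subst ennreal_plus) (auto intro!: sum_nonneg simp: sum_ennreal[symmetric] ennreal_mult')
    finally show "ennreal (exp (\<Sum>i\<in>I. w i * (Z i \<omega> - c i))) \<le> (\<Sum>i\<in>I. ennreal (w i) * ennreal (exp (Z i \<omega> - c i))) + ennreal (1 - sum w I)" .
  qed simp
  also have "\<dots> = ennreal (exp ?S) * ((\<Sum>i\<in>I. ennreal (w i) * (\<integral>\<^sup>+\<omega>. ennreal (exp (Z i \<omega> - c i)) \<partial>M)) + ennreal (1 - sum w I))"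
    using Zm by (simp add: nn_integral_cmult nn_integral_add nn_integral_sum emeasure_space_1 cong: measurable_cong)
  also have "\<dots> \<le> ennreal (exp ?S) * ((\<Sum>i\<in>I. ennreal (w i) * 1) + ennreal (1 - sum w I))"
    by (intro mult_left_mono add_right_mono sum_mono one) auto
  also have "(\<Sum>i\<in>I. ennreal (w i) * 1) + ennreal (1 - sum w I) = ennreal (sum w I + (1 - sum w I))"
    using w W by (subst ennreal_plus) (auto intro!: sum_nonneg)
  finally show "(\<integral>\<^sup>+\<omega>. ennreal (exp (\<Sum>i\<in>I. w i * Z i \<omega>)) \<partial>M) \<le> ennreal (exp ?S)" by simp
qed

lemma (in prob_space) exp_moment_le_convex_const:
  fixes w :: "'i \<Rightarrow> real"
  assumes "finite I" "\<And>i. i \<in> I \<Longrightarrow> 0 \<le> w i" "sum w I \<le> 1" "0 \<le> c"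
    and "\<And>i. i \<in> I \<Longrightarrow> exp_moment_le M (Z i) c"
  shows "exp_moment_le M (\<lambda>\<omega>. \<Sum>i\<in>I. w i * Z i \<omega>) c"
proof -
  have "exp_moment_le M (\<lambda>\<omega>. \<Sum>i\<in>I. w i * Z i \<omega>) (\<Sum>i\<in>I. w i * c)"
    by (intro exp_moment_le_convex assms)
  moreover have "(\<Sum>i\<in>I. w i * c) \<le> 1 * c"
    unfolding sum_distrib_right[symmetric] using assms by (intro mult_right_mono) auto
  ultimately show ?thesis
    by (auto simp: exp_moment_le_def intro: order_trans ennreal_leI)
qed

text \<open>The weighted variance about the weighted sum is nonnegative; missing mass only
  helps.\<close>

lemma square_weighted_sum_le:
  fixes w u :: "'i \<Rightarrow> real"
  assumes "finite I" and w: "\<And>i. i \<in> I \<Longrightarrow> 0 \<le> w i" and W: "sum w I \<le> 1"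
  shows "(\<Sum>i\<in>I. w i * u i)\<^sup>2 \<le> (\<Sum>i\<in>I. w i * (u i)\<^sup>2)"
proof -
  define s where "s = (\<Sum>i\<in>I. w i * u i)"
  have "0 \<le> (\<Sum>i\<in>I. w i * (u i - s)\<^sup>2)" using w by (intro sum_nonneg) auto
  also have "\<dots> = (\<Sum>i\<in>I. w i * (u i)\<^sup>2 - 2 * s * (w i * u i) + s\<^sup>2 * w i)"
    by (intro sum.cong refl) (simp add: power2_eq_square algebra_simps)
  also have "\<dots> = (\<Sum>i\<in>I. w i * (u i)\<^sup>2) - 2 * s * s + s\<^sup>2 * sum w I"
    by (simp add: sum.distrib sum_subtractf sum_distrib_left[symmetric] s_def)
  also have "s\<^sup>2 * sum w I \<le> s\<^sup>2 * 1" using W by (intro mult_left_mono) auto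
  finally show ?thesis by (simp add: s_def power2_eq_square)
qed

section \<open>Riemann sums for the constants\<close>

lemma lower_riemann_sum_le:
  fixes f g :: "real \<Rightarrow> real"
  assumes h: "0 \<le> h" and f: "continuous_on {0..real k * h} f"
    and g: "\<And>i s. i < k \<Longrightarrow> real i * h \<le> s \<Longrightarrow> s \<le> real (Suc i) * h \<Longrightarrow> G i \<le> f s"
  shows "(\<Sum>i<k. h * G i) \<le> integral {0..real k * h} f"
  using f g
proof (induction k)
  case (Suc k)
  have sub: "real k * h \<le> real (Suc k) * h" "0 \<le> real k * h" using h by (auto intro: mult_right_mono)
  have c1: "continuous_on {0..real k * h} f" and c2: "continuous_on {real k * h..real (Suc k) * h} f"
    using sub by (auto intro!: continuous_on_subset[OF Suc.prems(1)])
  have "(\<Sum>i<k. h * G i) \<le> integral {0..real k * h} f"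
    using Suc.prems(2) by (intro Suc.IH c1) auto
  moreover have "h * G k \<le> integral {real k * h..real (Suc k) * h} f"
  proof -
    have "integral {real k * h..real (Suc k) * h} (\<lambda>_. G k) \<le> integral {real k * h..real (Suc k) * h} f"
      using Suc.prems(2)[of k] by (intro integral_le integrable_continuous_real c2) auto
    then show ?thesis using h by (simp add: algebra_simps)
  qed
  moreover have "integral {0..real k * h} f + integral {real k * h..real (Suc k) * h} f = integral {0..real (Suc k) * h} f"
    using sub by (intro Henstock_Kurzweil_Integration.integral_combine integrable_continuous_real Suc.prems(1)) auto
  ultimately show ?case by simp
qed simp

lemma sum_sqrt_le:
  assumes T: "0 < T" and J: "0 < J" and \<delta>: "\<delta> = T / real J"
  shows "(\<Sum>j<J. \<delta> * sqrt (real j * \<delta>)) \<le> 2 / 3 * T * sqrt T"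
proof -
  have JT: "real J * \<delta> = T" using J by (simp add: \<delta>)
  have d0: "0 \<le> \<delta>" using T by (simp add: \<delta>)
  have "(\<Sum>j<J. \<delta> * sqrt (real j * \<delta>)) \<le> integral {0..real J * \<delta>} sqrt"
    by (intro lower_riemann_sum_le d0) (auto intro!: continuous_intros)
  also have "\<dots> = 2 / 3 * T * sqrt T"
  proof -
    have "(sqrt has_integral (2 / 3 * (T * sqrt T) - 2 / 3 * (0 * sqrt 0))) {0..T}"
    proof (rule fundamental_theorem_of_calculus_interior)
      show "0 \<le> T" using T by simp
      show "continuous_on {0..T} (\<lambda>x. 2 / 3 * (x * sqrt x))" by (intro continuous_intros)
      fix x assume "x \<in> {0<..<T}"
      then show "((\<lambda>x. 2 / 3 * (x * sqrt x)) has_vector_derivative sqrt x) (at x)"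
        unfolding has_real_derivative_iff_has_vector_derivative[symmetric]
        by (auto intro!: derivative_eq_intros simp: field_simps)
    qed
    then show ?thesis unfolding JT by (simp add: integral_unique)
  qed
  finally show ?thesis .
qed

text \<open>The integrand is not monotone, but in each cell the decreasing exponential is taken at
  the right end and the increasing square root at the left end. The exponent
  \<open>n - 1 - i\<close> from Gronwall's lemma corresponds to the right end.\<close>

lemma sum_exp_sqrt_le_C_A:
  assumes T: "0 < T" and n: "0 < n" and L: "0 < L"
  shows "sqrt T + (\<Sum>i<n. exp (L * (T / real n) * (real n - 1 - real i)) * (L * (T / real n)) * sqrt (real i * (T / real n))) \<le> C_A T L"
proof -
  let ?H = "T / real n"
  have nT: "real n * ?H = T" using n by simp
  have H: "0 \<le> ?H" using T by simp
  have "(\<Sum>i<n. ?H * (exp (L * ?H * (real n - 1 - real i)) * sqrt (real i * ?H))) \<le> integral {0..real n * ?H} (\<lambda>t. exp (L * (T - t)) * sqrt t)"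
  proof (rule lower_riemann_sum_le[OF H])
    fix i s assume i: "i < n" "real i * ?H \<le> s" "s \<le> real (Suc i) * ?H"
    have "?H * (real n - 1 - real i) = T - real (Suc i) * ?H"
      using n by (simp add: field_simps)
    then have "L * ?H * (real n - 1 - real i) \<le> L * (T - s)"
      using i(3) L by (metis diff_left_mono less_imp_le mult.assoc mult_left_mono)
    then show "exp (L * ?H * (real n - 1 - real i)) * sqrt (real i * ?H) \<le> exp (L * (T - s)) * sqrt s"
      using i H T by (intro mult_mono) auto
  qed (intro continuous_intros)
  then have "L * (\<Sum>i<n. ?H * (exp (L * ?H * (real n - 1 - real i)) * sqrt (real i * ?H))) \<le> L * integral {0..T} (\<lambda>t. exp (L * (T - t)) * sqrt t)"
    unfolding nT using L by (intro mult_left_mono) auto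
  moreover have "L * (\<Sum>i<n. ?H * (exp (L * ?H * (real n - 1 - real i)) * sqrt (real i * ?H))) = (\<Sum>i<n. exp (L * ?H * (real n - 1 - real i)) * (L * ?H) * sqrt (real i * ?H))"
    unfolding sum_distrib_left by (intro sum.cong refl) (simp only: mult_ac)
  ultimately show ?thesis by (simp add: C_A_def)
qed

section \<open>The two schemes as functions of a Brownian path\<close>

primrec euler_path :: "(real^'d::finite \<Rightarrow> real^'d) \<Rightarrow> real^'d \<Rightarrow> real \<Rightarrow> (real \<Rightarrow> real^'d) \<Rightarrow> nat \<Rightarrow> real^'d" where
  "euler_path b x0 h w 0 = x0"
| "euler_path b x0 h w (Suc l) = euler_path b x0 h w l + h *\<^sub>R b (euler_path b x0 h w l) + (w (real (Suc l) * h) - w (real l * h))"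

locale euler_bm = drift b b' b'' x0 L a
  for b :: "real^'d::finite \<Rightarrow> real^'d" and b' b'' x0 L a +
  fixes M :: "'w measure" and W :: "real \<Rightarrow> 'w \<Rightarrow> real^'d" and T :: real and m n :: nat
  assumes T_pos: "0 < T" and bm: "brownian_motion M W" and m_ge_2: "2 \<le> m" and n_pos: "0 < n"
begin

sublocale prob_space M using bm by (simp add: brownian_motion_def)

definition "fine_scheme \<omega> = euler_path b x0 (T / real (m * n)) (\<lambda>t. W t \<omega>)"
definition "coarse_scheme \<omega> = euler_path b x0 (T / real n) (\<lambda>t. W t \<omega>)"

definition mesh :: "nat \<Rightarrow> real" where "mesh p = T / (real m * real n * real p)"

text \<open>The scheme with \<open>m n\<close> steps, interpolated continuously and observed on a grid that is \<open>p\<close> times finer.\<close>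
definition interp :: "nat \<Rightarrow> nat \<Rightarrow> 'w \<Rightarrow> real^'d" where
  "interp p j \<omega> = fine_scheme \<omega> (j div p) + (real (j mod p) * mesh p) *\<^sub>R b (fine_scheme \<omega> (j div p))
     + (W (real j * mesh p) \<omega> - W (real (p * (j div p)) * mesh p) \<omega>)"

definition incr :: "nat \<Rightarrow> nat \<Rightarrow> 'w \<Rightarrow> real^'d" where
  "incr p j \<omega> = W (real (Suc j) * mesh p) \<omega> - W (real j * mesh p) \<omega>"

definition drift_at :: "nat \<Rightarrow> nat \<Rightarrow> 'w \<Rightarrow> real^'d" where
  "drift_at p j \<omega> = b (interp p (p * (j div p)) \<omega>)"

definition run_max :: "nat \<Rightarrow> nat \<Rightarrow> 'w \<Rightarrow> real" where
  "run_max p j \<omega> = (MAX i\<in>{..j}. norm (W (real i * mesh p) \<omega> - W 0 \<omega>))"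

lemma mesh_pos: "0 < p \<Longrightarrow> 0 < mesh p"
  using T_pos m_ge_2 n_pos by (simp add: mesh_def)

lemma mesh_fine: "0 < p \<Longrightarrow> real l * (T / real (m * n)) = real (p * l) * mesh p"
  by (simp add: mesh_def)

lemma mesh_coarse: "0 < p \<Longrightarrow> real k * (T / real n) = real (k * (m * p)) * mesh p"
  using m_ge_2 by (simp add: mesh_def)

lemma interp_fine: "0 < p \<Longrightarrow> interp p (p * l) \<omega> = fine_scheme \<omega> l"
  by (simp add: interp_def)

lemma interp_Suc:
  assumes p: "0 < p"
  shows "interp p (Suc j) \<omega> = interp p j \<omega> + mesh p *\<^sub>R drift_at p j \<omega> + incr p j \<omega>"
proof -
  let ?l = "j div p"
  have d: "drift_at p j \<omega> = b (fine_scheme \<omega> ?l)" using p by (simp add: drift_at_def interp_fine)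
  show ?thesis
  \<comment> \<open>In the first case the step ends at a point of the scheme with
    \<open>m * n\<close> steps, so the interpolation must meet the recursion of that scheme; in the
    second both points lie in the same fine step.\<close>
  proof (cases "Suc (j mod p) = p")
    case True
    have dm: "j = p * ?l + j mod p" by simp
    then have Sj: "Suc j = p * Suc ?l" using True by (metis add_Suc_right mult_Suc_right add.commute)
    have "interp p (Suc j) \<omega> = fine_scheme \<omega> (Suc ?l)"
      unfolding Sj by (rule interp_fine[OF p])
    also have "\<dots> = fine_scheme \<omega> ?l + (real p * mesh p) *\<^sub>R b (fine_scheme \<omega> ?l) + (W (real (Suc j) * mesh p) \<omega> - W (real (p * ?l) * mesh p) \<omega>)"
    proof -
      have "T / real (m * n) = real p * mesh p" using mesh_fine[OF p, of 1] by simp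
      then show ?thesis
        unfolding Sj mesh_fine[OF p, symmetric] by (simp add: fine_scheme_def)
    qed
    also have "real p * mesh p = real (j mod p) * mesh p + mesh p"
      using True by (metis distrib_right mult_1 of_nat_Suc add.commute)
    finally show ?thesis
      unfolding d by (simp add: interp_def incr_def scaleR_add_left)
  next
    case False
    then have "Suc j div p = ?l" "Suc j mod p = Suc (j mod p)"
      by (auto simp: div_Suc mod_Suc)
    then show ?thesis
      unfolding d by (simp add: interp_def incr_def algebra_simps)
  qed
qed

lemma sum_incr: "(\<Sum>i<j. incr p i \<omega>) = W (real j * mesh p) \<omega> - W 0 \<omega>"
  using sum_lessThan_telescope[of "\<lambda>i. W (real i * mesh p) \<omega>" j] by (simp add: incr_def)

lemma euler_pair:
  assumes p: "0 < p"
  shows "euler_pair b b' b'' x0 L a T (mesh p) m n p (\<lambda>j. interp p j \<omega>) (\<lambda>j. drift_at p j \<omega>) (\<lambda>j. incr p j \<omega>) (coarse_scheme \<omega>) (\<lambda>j. run_max p j \<omega>)"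
proof unfold_locales
  show "0 < T" by (rule T_pos)
  show "0 < m" "0 < n" "0 < p" using m_ge_2 n_pos p by auto
  show "mesh p = T / (real m * real n * real p)" by (simp add: mesh_def)
  show "interp p 0 \<omega> = x0" by (simp add: interp_def fine_scheme_def)
  show "interp p (Suc j) \<omega> = interp p j \<omega> + mesh p *\<^sub>R drift_at p j \<omega> + incr p j \<omega>" for j
    by (rule interp_Suc[OF p])
  show "drift_at p j \<omega> = b (interp p (p * (j div p)) \<omega>)" for j by (simp add: drift_at_def)
  show "coarse_scheme \<omega> 0 = x0" by (simp add: coarse_scheme_def)
  show "coarse_scheme \<omega> (Suc k) = coarse_scheme \<omega> k + (T / real n) *\<^sub>R b (coarse_scheme \<omega> k) + (\<Sum>r<m * p. incr p (k * (m * p) + r) \<omega>)" for k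
  proof -
    let ?q = "m * p"
    have "(\<Sum>r<?q. incr p (k * ?q + r) \<omega>) = W (real (k * ?q + ?q) * mesh p) \<omega> - W (real (k * ?q) * mesh p) \<omega>"
      using sum_lessThan_telescope[of "\<lambda>r. W (real (k * ?q + r) * mesh p) \<omega>" ?q] by (simp add: incr_def)
    also have "\<dots> = W (real (Suc k) * (T / real n)) \<omega> - W (real k * (T / real n)) \<omega>"
      unfolding mesh_coarse[OF p] by (simp add: add.commute)
    finally show ?thesis by (simp add: coarse_scheme_def)
  qed
  show "norm (\<Sum>i<j. incr p i \<omega>) \<le> run_max p j \<omega>" for j
    unfolding sum_incr run_max_def by (intro Max_ge) auto
  show "run_max p i \<omega> \<le> run_max p j \<omega>" if "i \<le> j" for i j
    unfolding run_max_def using that by (intro Max_mono) auto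
qed

abbreviation "Fil p \<equiv> incr_sigma M W (\<lambda>j. real j * mesh p)"

lemma walk: "0 < p \<Longrightarrow> gaussian_walk M (Fil p) (incr p) J (mesh p)"
  unfolding incr_def by (rule bm_gaussian_walk[OF bm mesh_pos])

lemma borel_measurable_b [measurable]: "b \<in> borel_measurable borel"
  by (intro borel_measurable_continuous_onI continuous_b)

text \<open>Strong induction, because the drift of a step is evaluated at the start of the fine step
  that contains it.\<close>

lemma interp_adapted:
  assumes p: "0 < p" and ij: "i \<le> j"
  shows "interp p i \<in> borel_measurable (Fil p j)"
proof -
  interpret gaussian_walk M "Fil p" "incr p" j "mesh p" by (rule walk[OF p])
  show ?thesis
    using ij
  proof (induction i rule: less_induct)
    case (less i)
    show ?case
    proof (cases i)
      case 0
      then show ?thesis by (simp add: interp_def fine_scheme_def)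
    next
      case (Suc k)
      have [measurable]: "interp p k \<in> borel_measurable (Fil p j)" "interp p (p * (k div p)) \<in> borel_measurable (Fil p j)"
        using less Suc by (auto intro!: less.IH simp: le_imp_less_Suc)
      have [measurable]: "incr p k \<in> borel_measurable (Fil p j)"
        using Suc less.prems by (intro Fil_measurable_mono[OF increment_measurable]) auto
      show ?thesis
        unfolding Suc interp_Suc[OF p] drift_at_def by measurable
    qed
  qed
qed

definition weight :: "nat \<Rightarrow> nat \<Rightarrow> real" where
  "weight p j = (T / (real m * real n)) * (real m - 1 - real ((j div p) mod m))"

text \<open>A weighted row of the Jacobian matrix: its inner product with the increment is one
  component of the martingale term, so scalar transforms can be used.\<close>

definition row :: "nat \<Rightarrow> 'd \<Rightarrow> nat \<Rightarrow> 'w \<Rightarrow> real^'d" where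
  "row p i j \<omega> = weight p j *\<^sub>R (\<chi> l. b' (interp p j \<omega>) (axis l 1) $ i)"

text \<open>A deterministic bound for the conditional variance of one component over one
  step.\<close>

definition var :: "nat \<Rightarrow> nat \<Rightarrow> real" where
  "var p j = mesh p * (weight p j * L)\<^sup>2"

lemma row_adapted:
  assumes p: "0 < p" shows "row p i j \<in> borel_measurable (Fil p j)"
proof -
  have [measurable]: "interp p j \<in> borel_measurable (Fil p j)" by (rule interp_adapted[OF p order_refl])
  have bl: "bounded_linear (\<lambda>A :: (real^'d) \<Rightarrow>\<^sub>L (real^'d). blinfun_apply A (axis l 1) $ i)" for l
    by (rule bounded_linear_compose[OF bounded_linear_vec_nth blinfun.bounded_linear_left])
  have "(\<lambda>y. weight p j *\<^sub>R (\<chi> l. b' y (axis l 1) $ i)) \<in> borel_measurable borel"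
    by (intro borel_measurable_continuous_onI continuous_intros bounded_linear.continuous_on[OF bl continuous_b'])
  then show ?thesis
    unfolding row_def by measurable
qed

lemma gradient_inner: "(\<chi> l. b' y (axis l 1) $ i) \<bullet> g = b' y g $ i"
proof -
  have g: "g = (\<Sum>l\<in>UNIV. g $ l *\<^sub>R axis l 1)"
    by (simp add: vec_eq_iff axis_def if_distrib[of "\<lambda>x. _ * x"] cong: if_cong)
  have "b' y g $ i = (\<Sum>l\<in>UNIV. g $ l * b' y (axis l 1) $ i)"
    by (subst g) (simp add: blinfun.sum_right blinfun.scaleR_right)
  then show ?thesis by (simp add: inner_vec_def mult.commute)
qed

text \<open>Apply the Jacobian matrix to its own row \<open>v\<close>: component \<open>i\<close> of
  the result is \<open>(norm v)\<^sup>2\<close>, and it is at most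
  \<open>L * norm v\<close>.\<close>

lemma gradient_bound: "norm (\<chi> l. b' y (axis l 1) $ i) \<le> L"
proof -
  let ?v = "\<chi> l. b' y (axis l 1) $ i"
  have "(norm ?v)\<^sup>2 = b' y ?v $ i" by (simp only: power2_norm_eq_inner gradient_inner)
  also have "\<dots> \<le> norm (b' y ?v)" using component_le_norm_cart[of "b' y ?v" i] by linarith
  also have "\<dots> \<le> norm (b' y) * norm ?v" by (rule norm_blinfun)
  also have "\<dots> \<le> L * norm ?v" by (intro mult_right_mono b'_bound) simp
  finally have "norm ?v * norm ?v \<le> L * norm ?v" by (simp add: power2_eq_square)
  then show ?thesis using L_pos by (cases "norm ?v = 0") (auto simp: mult_le_cancel_right)
qed

lemma row_bound:
  assumes p: "0 < p" shows "mesh p * (norm (row p i j \<omega>))\<^sup>2 \<le> var p j"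
proof -
  have "norm (row p i j \<omega>) \<le> \<bar>weight p j\<bar> * L"
    unfolding row_def norm_scaleR by (intro mult_left_mono gradient_bound) simp
  then have "(norm (row p i j \<omega>))\<^sup>2 \<le> (\<bar>weight p j\<bar> * L)\<^sup>2" by (intro power_mono) auto
  then show ?thesis using mesh_pos[OF p] by (simp add: var_def power_mult_distrib)
qed

text \<open>Chosen so that \<open>theta\<^sup>2 * t\<close> bounds the variance of one component of
  the martingale at a coarse time \<open>t\<close>; see \<open>sum_var\<close>.\<close>

definition theta :: real where
  "theta = L * (T / real n) * sqrt ((real m - 1) * (2 * real m - 1) / 6) / real m"

lemma theta_pos: "0 < theta"
  using L_pos T_pos n_pos m_ge_2 by (simp add: theta_def)

lemma sum_var:
  assumes p: "0 < p"
  shows "(\<Sum>j<k * (m * p). var p j) = theta\<^sup>2 * (real k * (T / real n))"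
proof -
  interpret euler_pair b b' b'' x0 L a T "mesh p" m n p "\<lambda>j. interp p j \<omega>" "\<lambda>j. drift_at p j \<omega>" "\<lambda>j. incr p j \<omega>" "coarse_scheme \<omega>" "\<lambda>j. run_max p j \<omega>" for \<omega>
    by (rule euler_pair[OF p])
  have w: "weight p = c" by (simp add: fun_eq_iff weight_def c_def)
  have "(\<Sum>j<k * (m * p). var p j) = (\<Sum>i<k. \<Sum>r<m * p. mesh p * (L * (T / (real m * real n)))\<^sup>2 * (real m - 1 - real (r div p))\<^sup>2)"
    unfolding sum_blocks[of _ k "m * p"] by (intro sum.cong refl) (simp add: var_def w c_block power2_eq_square mult_ac)
  also have "\<dots> = real k * (mesh p * (L * (T / (real m * real n)))\<^sup>2 * (real p * (real m * (real m - 1) * (2 * real m - 1) / 6)))"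
    unfolding sum_distrib_left[symmetric] sum_weights_block(2)[OF p] by simp
  also have "\<dots> = theta\<^sup>2 * (real k * (T / real n))"
  proof -
    have t: "theta\<^sup>2 = L\<^sup>2 * (T / real n)\<^sup>2 * ((real m - 1) * (2 * real m - 1) / 6) / (real m)\<^sup>2"
      using m_ge_2 by (simp add: theta_def power_mult_distrib power_divide)
    have gen: "mm \<noteq> 0 \<Longrightarrow> pp \<noteq> 0 \<Longrightarrow> nn \<noteq> 0 \<Longrightarrow> kk * (T / (mm * nn * pp) * (L * (T / (mm * nn)))\<^sup>2 * (pp * (mm * (mm - 1) * (2 * mm - 1) / 6)))
      = L\<^sup>2 * (T / nn)\<^sup>2 * ((mm - 1) * (2 * mm - 1) / 6) / mm\<^sup>2 * (kk * (T / nn))" for mm pp nn kk :: real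
      by (simp add: field_simps power2_eq_square)
    show ?thesis unfolding t mesh_def by (rule gen) (use m_ge_2 n_pos p in auto)
  qed
  finally show ?thesis .
qed

text \<open>A maximum over time, so that a single random variable, monotone in \<open>k\<close>,
  covers all earlier coarse times.\<close>

definition mart_max :: "nat \<Rightarrow> 'd \<Rightarrow> nat \<Rightarrow> 'w \<Rightarrow> real" where
  "mart_max p i k \<omega> = (MAX l\<in>{..k * (m * p)}. \<bar>\<Sum>j<l. row p i j \<omega> \<bullet> incr p j \<omega>\<bar>)"

lemma mart_max_measurable:
  assumes p: "0 < p" shows "mart_max p i k \<in> borel_measurable M"
proof -
  let ?K = "k * (m * p)"
  interpret gaussian_walk M "Fil p" "incr p" ?K "mesh p" by (rule walk[OF p])
  have "(\<lambda>\<omega>. \<Sum>j<l. row p i j \<omega> \<bullet> incr p j \<omega>) \<in> borel_measurable M" if "l \<le> ?K" for l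
    using that
    by (intro borel_measurable_sum borel_measurable_inner Fil_measurable[OF row_adapted[OF p]] increment_measurable_M) auto
  then show ?thesis
    unfolding mart_max_def by (intro borel_measurable_Max borel_measurable_abs) auto
qed

text \<open>Division by the standard deviation bound makes the estimate independent of the time, the
  component and the grid, as mixing requires.\<close>

lemma mart_max_exp_moment:
  assumes p: "0 < p" and k: "0 < k" and lam: "0 \<le> lam" "lam \<le> 1/8"
  shows "exp_moment_le M (\<lambda>\<omega>. lam * (mart_max p i k \<omega> / (theta * sqrt (real k * (T / real n))))\<^sup>2) (4 * lam * ln 2)"
proof (rule exp_moment_leI)
  let ?K = "k * (m * p)" and ?V = "theta\<^sup>2 * (real k * (T / real n))"
  interpret gaussian_walk M "Fil p" "incr p" ?K "mesh p" by (rule walk[OF p])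
  have V: "0 < ?V" using theta_pos k T_pos n_pos by simp
  have tr: "transform (row p i) l \<omega> = (\<Sum>j<l. row p i j \<omega> \<bullet> incr p j \<omega>)" for l \<omega>
    by (rule transform_def[of "row p i" "var p"]) (auto intro: row_adapted[OF p] row_bound[OF p])
  have mm: "mart_max p i k \<omega> = (MAX l\<in>{..?K}. \<bar>transform (row p i) l \<omega>\<bar>)" for \<omega>
    by (simp add: mart_max_def tr)
  have [measurable]: "mart_max p i k \<in> borel_measurable M" by (rule mart_max_measurable[OF p])
  show "(\<lambda>\<omega>. lam * (mart_max p i k \<omega> / (theta * sqrt (real k * (T / real n))))\<^sup>2) \<in> borel_measurable M"
    by measurable
  have sc: "lam * (z / (theta * sqrt (real k * (T / real n))))\<^sup>2 = lam / ?V * z\<^sup>2" for z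
    using T_pos by (simp add: power_divide power_mult_distrib)
  have "(\<integral>\<^sup>+\<omega>. ennreal (exp (lam / ?V * (MAX l\<in>{..?K}. \<bar>transform (row p i) l \<omega>\<bar>)\<^sup>2)) \<partial>M)
      \<le> ennreal (exp (4 * (lam / ?V) * (\<Sum>j<?K. var p j) * ln 2))"
  proof (intro transform_max_exp_bound row_adapted[OF p] row_bound[OF p] order_refl)
    show "0 \<le> lam / ?V" by (rule divide_nonneg_nonneg[OF lam(1) less_imp_le[OF V]])
    show "lam / ?V * (\<Sum>j<?K. var p j) \<le> 1/8" 
    proof -
      have "v \<noteq> 0 \<Longrightarrow> lam / v * v = lam" for v :: real by simp
      from this[OF less_imp_neq[OF V, symmetric]] show ?thesis unfolding sum_var[OF p] using lam by simp
    qed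
  qed
  also have "4 * (lam / ?V) * (\<Sum>j<?K. var p j) * ln 2 = 4 * lam * ln 2"
    
  proof -
    have "v \<noteq> 0 \<Longrightarrow> 4 * (lam / v) * v = 4 * lam" for v :: real by simp
    from this[OF less_imp_neq[OF V, symmetric]] show ?thesis unfolding sum_var[OF p] by simp
  qed
  finally show "(\<integral>\<^sup>+\<omega>. ennreal (exp (lam * (mart_max p i k \<omega> / (theta * sqrt (real k * (T / real n))))\<^sup>2)) \<partial>M) \<le> ennreal (exp (4 * lam * ln 2))"
    unfolding sc mm .
qed

end

text \<open>Here \<open>u\<close> and \<open>v\<close> stand for \<open>(m - 1) / m\<close> and
  \<open>(2 * m - 1) / m\<close>; \<open>K1\<close> and \<open>K2\<close> are the total masses of
  the martingale and path contributions. The first identity links the admissible range of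
  \<open>\<rho>\<close> to \<open>C_AB\<close>, the second turns the exponent that the proof
  produces into \<open>C_U\<close>.\<close>

lemma reference_constants:
  fixes u v d CA CB L T n \<rho> Y :: real
  assumes pos: "0 < u" "0 < v" "0 < d" "0 < L" "0 < T" "0 < n"
  defines "K1 \<equiv> sqrt d * (L * (T / n) * sqrt (u * v / 6)) * CA"
    and "K2 \<equiv> T\<^sup>2 * u / (2 * n) * CB * (2 / 3 * sqrt T)"
    and "AB \<equiv> CA * L * sqrt (3 * d * v) + CB * T powr (3/2) * sqrt (2 * u)"
  shows "K1 + K2 = T / n * sqrt u * AB / sqrt 18"
    and "(K1 + K2) * (K1 * (4 * ln 2) + K2 * ((3 * d + 1) * (3 * (Y / L) / (2 * sqrt T))\<^sup>2 + 8 * d * (3 * (Y / L) / (2 * sqrt T)) / sqrt pi + 4 * d * ln 2))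
      = AB * (CA * L * (2 * ln 2 / (3 * sqrt 3)) * sqrt (d * v) + CB * sqrt (u * T / 2) *
          ((3 * d + 1) * Y\<^sup>2 / (4 * L\<^sup>2) + 4 * d * sqrt T * Y / (3 * sqrt pi * L) + 4 * d * T * ln 2 / 9)) * (u * T\<^sup>2 / n\<^sup>2)"
proof -
  \<comment> \<open>With the square roots named, both claims become rational identities modulo the
    relations \<open>sq\<close>.\<close>
  define su where "su = sqrt u"
  define sT where "sT = sqrt T"
  define sdv where "sdv = sqrt (d * v)"
  define s2 where "s2 = sqrt 2"
  define s3 where "s3 = sqrt 3"
  define sp where "sp = sqrt pi"
  have sq: "su * su = u" "sT * sT = T" "s2 * s2 = 2" "s3 * s3 = 3" using pos by (auto simp: su_def sT_def s2_def s3_def)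
  have nz: "su \<noteq> 0" "sT \<noteq> 0" "s2 \<noteq> 0" "s3 \<noteq> 0" "sp \<noteq> 0" "L \<noteq> 0" "n \<noteq> 0"
    using pos by (auto simp: su_def sT_def s2_def s3_def sp_def)
  have T32: "T powr (3/2) = T * sT"
  proof -
    have "T powr (3/2) = T powr (1 + 1/2)" by simp
    also have "\<dots> = T powr 1 * T powr (1/2)" by (rule powr_add)
    finally show ?thesis using pos by (simp add: sT_def powr_half_sqrt)
  qed
  have r18: "sqrt 18 = 3 * s2"
  proof -
    have "sqrt 18 = sqrt (3\<^sup>2 * 2)" by simp
    then show ?thesis by (simp only: real_sqrt_mult s2_def real_sqrt_abs)
  qed
  have r6: "sqrt 6 = s2 * s3"
  proof -
    have "sqrt 6 = sqrt (2 * 3)" by simp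
    then show ?thesis by (simp only: real_sqrt_mult s2_def s3_def)
  qed
  have K1: "K1 = T / n * su * (CA * L * sdv / (s2 * s3))"
    unfolding K1_def by (simp add: real_sqrt_mult real_sqrt_divide r6 su_def sdv_def)
  have K2: "K2 = T / n * su * (CB * T * sT * su / 3)"
    unfolding K2_def using nz by (simp add: sq(1)[symmetric] sT_def[symmetric] power2_eq_square)
  have AB: "AB = CA * L * (s3 * sdv) + CB * (T * sT) * (s2 * su)"
    unfolding AB_def by (simp add: T32 real_sqrt_mult sdv_def s2_def s3_def su_def)
  show C: "K1 + K2 = T / n * sqrt u * AB / sqrt 18"
  proof -
    have "CA * L * sdv / (s2 * s3) + CB * T * sT * su / 3 = (CA * L * (s3 * sdv) + CB * (T * sT) * (s2 * su)) / (3 * s2)"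
      using nz sq by (simp add: field_simps)
    then show ?thesis
      unfolding K1 K2 AB r18 su_def[symmetric] distrib_left[symmetric] by simp
  qed
  let ?q = "3 * (Y / L) / (2 * sT)"
  let ?c = "(3 * d + 1) * ?q\<^sup>2 + 8 * d * ?q / sp + 4 * d * ln 2"
  let ?Br = "(3 * d + 1) * Y\<^sup>2 / (4 * L\<^sup>2) + 4 * d * sT * Y / (3 * sp * L) + 4 * d * T * ln 2 / 9"
  have Br: "?Br = T / 9 * ?c"
  proof -
    have 1: "T / 9 * ?q\<^sup>2 = Y\<^sup>2 / (4 * L\<^sup>2)"
      unfolding sq(2)[symmetric] using nz by (simp add: field_simps power2_eq_square)
    have 2: "T / 9 * (8 * d * ?q / sp) = 4 * d * sT * Y / (3 * sp * L)"
      unfolding sq(2)[symmetric] using nz by (simp add: field_simps)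
    have "T / 9 * ?c = (3 * d + 1) * (T / 9 * ?q\<^sup>2) + T / 9 * (8 * d * ?q / sp) + 4 * d * T * ln 2 / 9"
      by (simp add: algebra_simps)
    then show ?thesis unfolding 1 2 by simp
  qed
  have h: "sqrt (u * T / 2) = su * sT / s2" by (simp add: real_sqrt_mult real_sqrt_divide su_def sT_def s2_def)
  have t1: "CA * L * (2 * ln 2 / (3 * s3)) * sdv = (CA * L * sdv / (s2 * s3)) * (4 * ln 2) / (3 * s2)"
    using nz by (simp add: field_simps) (simp add: sq mult.assoc[symmetric])
  have t2: "CB * (su * sT / s2) * ?Br = (CB * T * sT * su / 3) * ?c / (3 * s2)"
  proof -
    have "CB * (su * sT / s2) * (T / 9 * c) = (CB * T * sT * su / 3) * c / (3 * s2)" for c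
      by (simp add: mult_ac)
    then show ?thesis unfolding Br .
  qed
  have "(K1 + K2) * (K1 * (4 * ln 2) + K2 * ?c)
      = (T / n * su * AB / (3 * s2)) * (T / n * su * ((CA * L * sdv / (s2 * s3)) * (4 * ln 2) + (CB * T * sT * su / 3) * ?c))"
    unfolding C r18 su_def[symmetric] by (simp only: K1 K2 distrib_left mult.assoc)
  also have "\<dots> = AB * ((CA * L * sdv / (s2 * s3)) * (4 * ln 2) / (3 * s2) + (CB * T * sT * su / 3) * ?c / (3 * s2)) * (u * T\<^sup>2 / n\<^sup>2)"
  proof -
    have "(T / n * su * AB / w) * (T / n * su * (X1 + X2)) = AB * (X1 / w + X2 / w) * (su * su * T\<^sup>2 / n\<^sup>2)" for X1 X2 w
      by (simp add: power2_eq_square add_divide_distrib[symmetric] mult_ac)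
    then show ?thesis unfolding sq(1) .
  qed
  also have "\<dots> = AB * (CA * L * (2 * ln 2 / (3 * s3)) * sdv + CB * (su * sT / s2) * ?Br) * (u * T\<^sup>2 / n\<^sup>2)"
    unfolding t1 t2 ..
  finally show "(K1 + K2) * (K1 * (4 * ln 2) + K2 * ((3 * d + 1) * (3 * (Y / L) / (2 * sqrt T))\<^sup>2 + 8 * d * (3 * (Y / L) / (2 * sqrt T)) / sqrt pi + 4 * d * ln 2))
      = AB * (CA * L * (2 * ln 2 / (3 * sqrt 3)) * sqrt (d * v) + CB * sqrt (u * T / 2) *
          ((3 * d + 1) * Y\<^sup>2 / (4 * L\<^sup>2) + 4 * d * sqrt T * Y / (3 * sqrt pi * L) + 4 * d * T * ln 2 / 9)) * (u * T\<^sup>2 / n\<^sup>2)"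
    unfolding h sT_def s3_def sdv_def sp_def .
qed

section \<open>A random bound for the difference\<close>

context euler_bm
begin

definition martingale_part :: "nat \<Rightarrow> nat \<Rightarrow> 'w \<Rightarrow> real^'d" where
  "martingale_part p k \<omega> = (\<Sum>j<k * (m * p). weight p j *\<^sub>R b' (interp p j \<omega>) (incr p j \<omega>))"

definition remainder_part :: "nat \<Rightarrow> nat \<Rightarrow> 'w \<Rightarrow> real^'d" where
  "remainder_part p k \<omega> = (\<Sum>j<k * (m * p). weight p j *\<^sub>R ito_remainder (mesh p) (drift_at p j \<omega>) (interp p j \<omega>) (incr p j \<omega>))"

text \<open>The maxima are taken component by component, possibly at different times; the norm of
  these maxima still dominates the martingale at every coarse time up to \<open>k\<close>.\<close>

definition mart_norm :: "nat \<Rightarrow> nat \<Rightarrow> 'w \<Rightarrow> real" where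
  "mart_norm p k \<omega> = sqrt (\<Sum>i\<in>UNIV. (mart_max p i k \<omega>)\<^sup>2)"

lemma mart_max_nonneg: "0 \<le> mart_max p i k \<omega>"
  unfolding mart_max_def by (rule order_trans[OF abs_ge_zero Max_ge]) auto

lemma mart_max_mono: "k \<le> l \<Longrightarrow> mart_max p i k \<omega> \<le> mart_max p i l \<omega>"
  unfolding mart_max_def by (intro Max_mono image_mono) (auto simp: mult_right_mono)

lemma mart_norm_mono: "k \<le> l \<Longrightarrow> mart_norm p k \<omega> \<le> mart_norm p l \<omega>"
  unfolding mart_norm_def by (intro real_sqrt_le_mono sum_mono power_mono mart_max_mono mart_max_nonneg)

lemma mart_norm_zero: "mart_norm p 0 \<omega> = 0"
  by (simp add: mart_norm_def mart_max_def)

lemma martingale_part_le: "norm (martingale_part p k \<omega>) \<le> mart_norm p k \<omega>"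
proof -
  have "martingale_part p k \<omega> $ i = (\<Sum>j<k * (m * p). row p i j \<omega> \<bullet> incr p j \<omega>)" for i
    by (simp add: martingale_part_def row_def gradient_inner)
  then have "\<bar>martingale_part p k \<omega> $ i\<bar> \<le> mart_max p i k \<omega>" for i
    unfolding mart_max_def by (intro Max_ge) auto
  then have "(\<Sum>i\<in>UNIV. (martingale_part p k \<omega> $ i)\<^sup>2) \<le> (\<Sum>i\<in>UNIV. (mart_max p i k \<omega>)\<^sup>2)"
    by (intro sum_mono) (metis abs_ge_zero power2_abs power_mono)
  then show ?thesis
    by (simp add: mart_norm_def norm_vec_def L2_set_def)
qed

text \<open>The coefficient of the path term in \<open>euler_difference_bound\<close> with one
  factor \<open>T\<close> pulled out, so that it multiplies a time average of running
  maxima.\<close>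

definition kappa :: real where
  "kappa = T\<^sup>2 * ((real m - 1) / real m) / (2 * real n) * C_B T L a"

definition gain :: "nat \<Rightarrow> real" where
  "gain i = exp (L * (T / real n) * (real n - 1 - real i)) * (L * (T / real n))"

definition main_bound :: "nat \<Rightarrow> real \<Rightarrow> 'w \<Rightarrow> real" where
  "main_bound p Y \<omega> = mart_norm p n \<omega> + (\<Sum>i<n. gain i * mart_norm p i \<omega>)
     + kappa * (Y / L + mesh p / T * (\<Sum>j<n * (m * p). run_max p j \<omega>))"

lemma gain_nonneg: "0 \<le> gain i"
  using L_pos T_pos by (simp add: gain_def)

lemma gain_le: "gain i \<le> exp (L * T) * (L * (T / real n))"
proof -
  have "T / real n * (real n - 1 - real i) \<le> T / real n * real n"
    using T_pos by (intro mult_left_mono) auto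
  then have "L * (T / real n * (real n - 1 - real i)) \<le> L * T"
    using L_pos n_pos by (intro mult_left_mono) auto
  then show ?thesis
    unfolding gain_def using L_pos T_pos by (intro mult_right_mono) (auto simp: mult.assoc)
qed

text \<open>The additional \<open>kappa * z / L\<close> has the same form as the term with
  \<open>norm (b x0)\<close> in the path bound and merges with it. The factor before the remainders
  may be crude, since they vanish in the limit.\<close>

lemma scheme_difference_le:
  assumes p: "0 < p" and k: "k \<le> n"
  shows "kappa * z / L + norm (fine_scheme \<omega> (k * m) - coarse_scheme \<omega> k)
    \<le> main_bound p (norm (b x0) + L + z) \<omega> + (1 + exp (L * T) * (L * (T / real n))) * (\<Sum>i\<le>n. norm (remainder_part p i \<omega>))"
proof -
  interpret e: euler_pair b b' b'' x0 L a T "mesh p" m n p "\<lambda>j. interp p j \<omega>" "\<lambda>j. drift_at p j \<omega>" "\<lambda>j. incr p j \<omega>" "coarse_scheme \<omega>" "\<lambda>j. run_max p j \<omega>"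
    by (rule euler_pair[OF p])
  have w: "weight p = e.c" by (simp add: fun_eq_iff weight_def e.c_def)
  have mart: "e.mart i = martingale_part p i \<omega>" for i by (simp add: e.mart_def martingale_part_def w)
  have rest: "e.rest i = remainder_part p i \<omega>" for i by (simp add: e.rest_def remainder_part_def w)
  have kq: "interp p (k * (m * p)) \<omega> = fine_scheme \<omega> (k * m)"
    using interp_fine[OF p, of "k * m" \<omega>] by (simp add: mult_ac)
  let ?S = "\<Sum>j<n * (m * p). run_max p j \<omega>"
  let ?R = "\<Sum>i\<le>n. norm (remainder_part p i \<omega>)"
  have f0: "norm (fine_scheme \<omega> (k * m) - coarse_scheme \<omega> k) \<le> norm (martingale_part p k \<omega>) + norm (remainder_part p k \<omega>)
     + (\<Sum>i<n. gain i * (norm (martingale_part p i \<omega>) + norm (remainder_part p i \<omega>)))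
     + T * (real m - 1) / (2 * real m * real n) * C_B T L a * (T * (norm (b x0) + L) / L + mesh p * ?S)"
    using e.euler_difference_bound[OF k] unfolding mart rest kq by (simp only: gain_def mult.assoc)
  have f1: "norm (martingale_part p k \<omega>) \<le> mart_norm p n \<omega>"
    using martingale_part_le mart_norm_mono[OF k] order_trans by blast
  have f2: "(\<Sum>i<n. gain i * (norm (martingale_part p i \<omega>) + norm (remainder_part p i \<omega>)))
     \<le> (\<Sum>i<n. gain i * mart_norm p i \<omega>) + exp (L * T) * (L * (T / real n)) * ?R"
  proof -
    have "(\<Sum>i<n. gain i * norm (remainder_part p i \<omega>)) \<le> (\<Sum>i<n. exp (L * T) * (L * (T / real n)) * norm (remainder_part p i \<omega>))"
      by (intro sum_mono mult_right_mono gain_le) auto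
    also have "\<dots> \<le> exp (L * T) * (L * (T / real n)) * ?R"
      unfolding sum_distrib_left[symmetric] using L_pos T_pos by (intro mult_left_mono sum_mono2) auto
    moreover have "(\<Sum>i<n. gain i * norm (martingale_part p i \<omega>)) \<le> (\<Sum>i<n. gain i * mart_norm p i \<omega>)"
      by (intro sum_mono mult_left_mono martingale_part_le gain_nonneg)
    ultimately show ?thesis by (simp add: distrib_left sum.distrib)
  qed
  have f3: "norm (remainder_part p k \<omega>) \<le> ?R"
    using k by (intro member_le_sum) auto
  have f4: "T * (real m - 1) / (2 * real m * real n) * C_B T L a * (T * (norm (b x0) + L) / L + mesh p * ?S)
     = kappa * ((norm (b x0) + L) / L + mesh p / T * ?S)"
  proof -
    have "mm \<noteq> 0 \<Longrightarrow> nn \<noteq> 0 \<Longrightarrow> T * A / (2 * mm * nn) * C * (T * B / L + \<mu> * S) = (T\<^sup>2 * (A / mm) / (2 * nn) * C) * (B / L + \<mu> / T * S)"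
      for A B C S \<mu> mm nn :: real
      using T_pos L_pos by (simp add: field_simps power2_eq_square)
    from this[of "real m" "real n"] show ?thesis
      unfolding kappa_def using m_ge_2 n_pos by simp
  qed
  have f5: "kappa * z / L + kappa * ((norm (b x0) + L) / L + mesh p / T * ?S) = kappa * ((norm (b x0) + L + z) / L + mesh p / T * ?S)"
    by (simp add: add_divide_distrib distrib_left)
  show ?thesis
    using f0 f1 f2 f3 unfolding f4 main_bound_def f5[symmetric] distrib_right[of 1] mult_1_left by linarith
qed

end

lemma exp_moment_le_mono:
  assumes "exp_moment_le M Z c" and "Z' \<in> borel_measurable M" and "\<And>\<omega>. Z' \<omega> \<le> Z \<omega>" and "c \<le> c'"
  shows "exp_moment_le M Z' c'"
proof (rule exp_moment_leI)
  have "(\<integral>\<^sup>+\<omega>. ennreal (exp (Z' \<omega>)) \<partial>M) \<le> (\<integral>\<^sup>+\<omega>. ennreal (exp (Z \<omega>)) \<partial>M)"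
    using assms(3) by (intro nn_integral_mono ennreal_leI) simp
  also have "\<dots> \<le> ennreal (exp c)" using assms(1) by (simp add: exp_moment_le_def)
  also have "\<dots> \<le> ennreal (exp c')" using assms(4) by (intro ennreal_leI) simp
  finally show "(\<integral>\<^sup>+\<omega>. ennreal (exp (Z' \<omega>)) \<partial>M) \<le> ennreal (exp c')" .
qed (rule assms(2))

context euler_bm
begin

lemma W_measurable: "0 \<le> t \<Longrightarrow> W t \<in> borel_measurable M"
  by (rule bm_measurable[OF bm])

lemma run_max_measurable:
  assumes "0 < p" shows "run_max p j \<in> borel_measurable M"
proof -
  have [measurable]: "W (real i * mesh p) \<in> borel_measurable M" "W 0 \<in> borel_measurable M" for i
    using mesh_pos[OF assms] by (auto intro!: W_measurable)
  show ?thesis unfolding run_max_def by (intro borel_measurable_Max) auto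
qed

lemma run_max_zero: "run_max p 0 \<omega> = 0"
  by (simp add: run_max_def)

lemma mart_norm_measurable:
  assumes "0 < p" shows "mart_norm p k \<in> borel_measurable M"
proof -
  note mart_max_measurable[OF assms, measurable]
  show ?thesis unfolding mart_norm_def by measurable
qed

lemma main_bound_measurable: "0 < p \<Longrightarrow> main_bound p Y \<in> borel_measurable M"
  unfolding main_bound_def
  by (intro borel_measurable_add borel_measurable_sum borel_measurable_times borel_measurable_const mart_norm_measurable run_max_measurable)

text \<open>Up to the factor \<open>K1 + K2\<close>, \<open>main_bound\<close> is a convex combination of normalized maxima of martingales and of the
Brownian path. At time \<open>0\<close> the normalization divides by \<open>0\<close>, which gives the harmless value \<open>0\<close>.\<close>
lemma main_bound_exp_moment:
  fixes Y \<rho> :: real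
  assumes p: "0 < p" and Y: "0 \<le> Y" and \<rho>: "0 \<le> \<rho>"
  defines "d \<equiv> real CARD('d)"
  defines "K1 \<equiv> sqrt d * theta * C_A T L" and "K2 \<equiv> kappa * (2 / 3 * sqrt T)"
    and "q \<equiv> 3 * (Y / L) / (2 * sqrt T)"
  assumes lam8: "\<rho> * (K1 + K2)\<^sup>2 \<le> 1/8"
  shows "exp_moment_le M (\<lambda>\<omega>. \<rho> * (main_bound p Y \<omega>)\<^sup>2)
    (\<rho> * ((K1 + K2) * (K1 * (4 * ln 2) + K2 * ((3 * d + 1) * q\<^sup>2 + 8 * d * q / sqrt pi + 4 * d * ln 2))))"
proof -
  let ?J = "n * (m * p)" and ?H = "T / real n"
  let ?c = "(3 * d + 1) * q\<^sup>2 + 8 * d * q / sqrt pi + 4 * d * ln 2"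
  define CA where "CA = C_A T L"
  define K where "K = K1 + K2"
  define lam where "lam = \<rho> * K\<^sup>2"
  have d0: "0 < d" by (simp add: d_def)
  have q0: "0 \<le> q" using Y L_pos T_pos by (simp add: q_def)
  have CA: "sqrt T + (\<Sum>i<n. gain i * sqrt (real i * ?H)) \<le> CA"
    using sum_exp_sqrt_le_C_A[OF T_pos n_pos L_pos] by (simp add: gain_def CA_def)
  have CA0: "0 < CA"
  proof -
    have "0 \<le> (\<Sum>i<n. gain i * sqrt (real i * ?H))" using T_pos by (intro sum_nonneg mult_nonneg_nonneg gain_nonneg) auto
    moreover have "0 < sqrt T" using T_pos by simp
    ultimately show ?thesis using CA by linarith
  qed
  have kappa0: "0 < kappa"
    using T_pos m_ge_2 n_pos L_pos a_nonneg by (simp add: kappa_def C_B_def add_pos_nonneg)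
  have K1: "0 < K1" using d0 theta_pos CA0 by (simp add: K1_def CA_def)
  have K2: "0 < K2" using kappa0 T_pos by (simp add: K2_def)
  have K: "0 < K" using K1 K2 by (simp add: K_def)
  have lam: "0 \<le> lam" "lam \<le> 1/8" using \<rho> lam8 by (auto simp: lam_def K_def)
  have c0: "0 \<le> ?c" using q0 d0 by auto

  \<comment> \<open>Normalized so that \<open>lam * (u k)\<^sup>2\<close> is an average over
    components of the variables in \<open>mart_max_exp_moment\<close>.\<close>
  define u where "u k \<omega> = mart_norm p k \<omega> / (sqrt d * theta * sqrt (real k * ?H))" for k \<omega>
  have hU: "exp_moment_le M (\<lambda>\<omega>. lam * (u k \<omega>)\<^sup>2) (4 * lam * ln 2)" for k
  proof (cases "k = 0")
    case True
    then show ?thesis using lam by (simp add: u_def exp_moment_le_const)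
  next
    case False
    have "(\<lambda>\<omega>. lam * (u k \<omega>)\<^sup>2) = (\<lambda>\<omega>. \<Sum>i\<in>(UNIV::'d set). (1 / d) * (lam * (mart_max p i k \<omega> / (theta * sqrt (real k * ?H)))\<^sup>2))"
    proof
      fix \<omega>
      have "(mart_norm p k \<omega>)\<^sup>2 = (\<Sum>i\<in>UNIV. (mart_max p i k \<omega>)\<^sup>2)"
        by (simp add: mart_norm_def sum_nonneg)
      then have "(u k \<omega>)\<^sup>2 = (\<Sum>i\<in>UNIV. (mart_max p i k \<omega>)\<^sup>2) / (d * (theta * sqrt (real k * ?H))\<^sup>2)"
        using d0 by (simp add: u_def power_divide power_mult_distrib)
      then show "lam * (u k \<omega>)\<^sup>2 = (\<Sum>i\<in>(UNIV::'d set). (1 / d) * (lam * (mart_max p i k \<omega> / (theta * sqrt (real k * ?H)))\<^sup>2))"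
        by (simp add: sum_distrib_left sum_divide_distrib power_divide)
    qed
    moreover have "exp_moment_le M (\<lambda>\<omega>. \<Sum>i\<in>(UNIV::'d set). (1 / d) * (lam * (mart_max p i k \<omega> / (theta * sqrt (real k * ?H)))\<^sup>2)) (4 * lam * ln 2)"
      using False d0 lam by (intro exp_moment_le_convex_const mart_max_exp_moment p) (auto simp: d_def)
    ultimately show ?thesis by simp
  qed

  \<comment> \<open>Index \<open>n\<close> stands for the isolated martingale term and smaller
    indices for the Gronwall sum; \<open>C_A\<close> is just large enough for the total mass to be
    at most 1.\<close>
  define w where "w k = (if k = n then sqrt T else gain k * sqrt (real k * ?H)) / CA" for k
  have w0: "0 \<le> w k" for k using CA0 gain_nonneg[of k] T_pos by (auto simp: w_def)
  have "(\<Sum>k\<le>n. w k) = (sqrt T + (\<Sum>i<n. gain i * sqrt (real i * ?H))) / CA"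
    by (simp add: w_def sum_divide_distrib add_divide_distrib lessThan_Suc_atMost[symmetric])
  then have w1: "(\<Sum>k\<le>n. w k) \<le> 1" using CA CA0 by simp
  define N where "N \<omega> = (\<Sum>k\<le>n. w k * (lam * (u k \<omega>)\<^sup>2))" for \<omega>
  have hN: "exp_moment_le M N (4 * lam * ln 2)"
    unfolding N_def[abs_def] using lam by (intro exp_moment_le_convex_const w0 w1 hU) auto

  define s where "s j \<omega> = run_max p j \<omega> / sqrt (real j * mesh p)" for j \<omega>
  have hS: "exp_moment_le M (\<lambda>\<omega>. lam * (q + s j \<omega>)\<^sup>2) (lam * ?c)" for j
  proof (cases "j = 0")
    case True
    have "q\<^sup>2 \<le> ?c" using q0 d0 by (simp add: algebra_simps)
    then show ?thesis using lam True by (simp add: s_def exp_moment_le_const mult_left_mono)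
  next
    case False
    note run_max_measurable[OF p, measurable]
    show ?thesis
    proof (rule exp_moment_leI)
      show "(\<lambda>\<omega>. lam * (q + s j \<omega>)\<^sup>2) \<in> borel_measurable M" unfolding s_def by measurable
      show "(\<integral>\<^sup>+\<omega>. ennreal (exp (lam * (q + s j \<omega>)\<^sup>2)) \<partial>M) \<le> ennreal (exp (lam * ?c))"
        unfolding s_def run_max_def d_def using bm_max_exp_bound[OF bm mesh_pos[OF p] _ lam q0, of j] False by simp
    qed
  qed

  have J0: "0 < ?J" using n_pos m_ge_2 p by simp
  have meshJ: "mesh p = T / real ?J" by (simp add: mesh_def mult_ac)
  \<comment> \<open>The relative weight of time \<open>j\<close> in the average of
    \<open>sqrt t\<close>, whose total over \<open>[0, T]\<close> is \<open>2 / 3 * sqrt T\<close>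
    by \<open>sum_sqrt_le\<close>.\<close>
  define g where "g j = mesh p / T * sqrt (real j * mesh p) / (2 / 3 * sqrt T)" for j
  \<comment> \<open>The deterministic \<open>q\<close> must receive total weight exactly 1. The
    missing mass is put at \<open>j = 0\<close>, where \<open>s\<close> vanishes, so the path part
    is unchanged.\<close>
  define v where "v j = g j + (if j = 0 then 1 - (\<Sum>j<?J. g j) else 0)" for j
  have g0: "0 \<le> g j" for j using mesh_pos[OF p] T_pos by (simp add: g_def)
  have "(\<Sum>j<?J. g j) = (\<Sum>j<?J. mesh p * sqrt (real j * mesh p)) / (2 / 3 * T * sqrt T)"
    unfolding g_def sum_divide_distrib by (intro sum.cong refl) simp
  also have "\<dots> \<le> 1"
    using sum_sqrt_le[OF T_pos J0 meshJ] T_pos by (simp only: divide_le_eq_1_pos mult_pos_pos real_sqrt_gt_0_iff)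
  finally have g1: "(\<Sum>j<?J. g j) \<le> 1" .
  have v0: "0 \<le> v j" for j using g0[of j] g1 by (simp add: v_def)
  have split: "(\<Sum>j<?J. v j * f j) = (\<Sum>j<?J. g j * f j) + (1 - (\<Sum>j<?J. g j)) * f 0" for f :: "nat \<Rightarrow> real"
    using J0 by (simp add: v_def distrib_right sum.distrib if_distrib[of "\<lambda>x. x * _"] cong: if_cong)
  have v1: "(\<Sum>j<?J. v j) = 1" using split[of "\<lambda>_. 1"] by simp
  define V where "V \<omega> = (\<Sum>j<?J. v j * (lam * (q + s j \<omega>)\<^sup>2))" for \<omega>
  have hV: "exp_moment_le M V (lam * ?c)"
    unfolding V_def[abs_def] using lam c0 v1 by (intro exp_moment_le_convex_const v0 hS) auto

  have hfin: "exp_moment_le M (\<lambda>\<omega>. K1 / K * N \<omega> + K2 / K * V \<omega>) (K1 / K * (4 * lam * ln 2) + K2 / K * (lam * ?c))"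
  proof -
    have "exp_moment_le M (\<lambda>\<omega>. \<Sum>b\<in>(UNIV::bool set). (if b then K1 / K else K2 / K) * (if b then N else V) \<omega>)
       (\<Sum>b\<in>(UNIV::bool set). (if b then K1 / K else K2 / K) * (if b then 4 * lam * ln 2 else lam * ?c))"
    proof (rule exp_moment_le_convex)
      show "(\<Sum>b\<in>UNIV. if b then K1 / K else K2 / K) \<le> 1"
        using K by (simp add: UNIV_bool add_divide_distrib[symmetric]) (simp add: K_def)
    qed (use K K1 K2 hN hV in auto)
    then show ?thesis by (simp add: UNIV_bool add.commute)
  qed

  show ?thesis
  proof (rule exp_moment_le_mono[OF hfin])
    show "(\<lambda>\<omega>. \<rho> * (main_bound p Y \<omega>)\<^sup>2) \<in> borel_measurable M"
      by (intro borel_measurable_times borel_measurable_power borel_measurable_const main_bound_measurable p)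
    fix \<omega>
    define X where "X = (\<Sum>k\<le>n. w k * u k \<omega>)"
    define Z where "Z = (\<Sum>j<?J. v j * (q + s j \<omega>))"
    have X: "K1 * X = mart_norm p n \<omega> + (\<Sum>i<n. gain i * mart_norm p i \<omega>)"
    proof -
      have k: "K1 * (w k * u k \<omega>) = (if k = n then mart_norm p n \<omega> else gain k * mart_norm p k \<omega>)" for k
      proof (cases "k = 0")
        case True
        then show ?thesis using n_pos by (simp add: u_def mart_norm_zero)
      next
        case False
        have c4: "sqrt (real k * ?H) \<noteq> 0" using False T_pos n_pos by simp
        have wk: "w k = (if k = n then 1 else gain k) * sqrt (real k * ?H) / CA" using n_pos by (simp add: w_def)
        have gen: "c1 \<noteq> 0 \<Longrightarrow> c2 \<noteq> 0 \<Longrightarrow> c3 \<noteq> 0 \<Longrightarrow> c4 \<noteq> 0 \<Longrightarrow> c1 * c2 * c3 * (y * c4 / c3 * (z / (c1 * c2 * c4))) = y * z" for c1 c2 c3 c4 y z :: real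
          by simp
        have "K1 * (w k * u k \<omega>) = (if k = n then 1 else gain k) * mart_norm p k \<omega>"
          unfolding K1_def CA_def[symmetric] wk u_def
          by (rule gen) (use d0 theta_pos CA0 c4 in auto)
        then show ?thesis by simp
      qed
      have "K1 * X = (\<Sum>k\<le>n. if k = n then mart_norm p n \<omega> else gain k * mart_norm p k \<omega>)"
        unfolding X_def sum_distrib_left k ..
      then show ?thesis by (simp add: lessThan_Suc_atMost[symmetric])
    qed
    have Z: "K2 * Z = kappa * (Y / L + mesh p / T * (\<Sum>j<?J. run_max p j \<omega>))"
    proof -
      have z1: "Z = (\<Sum>j<?J. g j * s j \<omega>) + q"
      proof -
        have "Z = (\<Sum>j<?J. g j * (q + s j \<omega>)) + (1 - (\<Sum>j<?J. g j)) * (q + s 0 \<omega>)"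
          unfolding Z_def by (rule split)
        then show ?thesis
          by (simp add: distrib_left sum.distrib sum_distrib_right[symmetric] s_def left_diff_distrib)
      qed
      have z2: "2 / 3 * sqrt T * q = Y / L" using T_pos by (simp add: q_def)
      have z3: "2 / 3 * sqrt T * (\<Sum>j<?J. g j * s j \<omega>) = mesh p / T * (\<Sum>j<?J. run_max p j \<omega>)"
        unfolding sum_distrib_left
      proof (intro sum.cong refl)
        fix j
        show "2 / 3 * sqrt T * (g j * s j \<omega>) = mesh p / T * run_max p j \<omega>"
        proof (cases "j = 0")
          case True then show ?thesis by (simp add: s_def run_max_zero)
        next
          case False
          then have "sqrt (real j * mesh p) \<noteq> 0" using mesh_pos[OF p] by simp
          then show ?thesis using T_pos by (simp add: g_def s_def)
        qed
      qed
      show ?thesis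
        unfolding z1 K2_def mult.assoc[of kappa] distrib_left[of "2 / 3 * sqrt T"] z2 z3 by (simp only: add.commute)
    qed
    have mb: "main_bound p Y \<omega> = K1 * X + K2 * Z"
      unfolding main_bound_def X Z ..
    \<comment> \<open>This product is the gap in the convexity inequality for the square with
      weights \<open>K1 / K\<close> and \<open>K2 / K\<close>, multiplied by
      \<open>K\<^sup>2\<close>.\<close>
    have "0 \<le> K1 * K2 * (X - Z)\<^sup>2" using K1 K2 by simp
    then have "(K1 * X + K2 * Z)\<^sup>2 \<le> K * (K1 * X\<^sup>2 + K2 * Z\<^sup>2)"
      by (simp add: K_def power2_eq_square algebra_simps)
    then have "\<rho> * (main_bound p Y \<omega>)\<^sup>2 \<le> \<rho> * (K * (K1 * X\<^sup>2 + K2 * Z\<^sup>2))"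
      unfolding mb using \<rho> by (rule mult_left_mono)
    also have "\<dots> = K1 / K * (lam * X\<^sup>2) + K2 / K * (lam * Z\<^sup>2)"
      using K by (simp add: lam_def power2_eq_square field_simps)
    also have "\<dots> \<le> K1 / K * N \<omega> + K2 / K * V \<omega>"
    proof (intro add_mono mult_left_mono)
      have "lam * X\<^sup>2 \<le> lam * (\<Sum>k\<le>n. w k * (u k \<omega>)\<^sup>2)"
        unfolding X_def using lam by (intro mult_left_mono square_weighted_sum_le w0 w1) auto
      then show "lam * X\<^sup>2 \<le> N \<omega>" by (simp add: N_def sum_distrib_left mult_ac)
      have "lam * Z\<^sup>2 \<le> lam * (\<Sum>j<?J. v j * (q + s j \<omega>)\<^sup>2)"
        unfolding Z_def using lam v1 by (intro mult_left_mono square_weighted_sum_le v0) auto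
      then show "lam * Z\<^sup>2 \<le> V \<omega>" by (simp add: V_def sum_distrib_left mult_ac)
    qed (use K K1 K2 in auto)
    finally show "\<rho> * (main_bound p Y \<omega>)\<^sup>2 \<le> K1 / K * N \<omega> + K2 / K * V \<omega>" .
  next
    have "K1 / K * (4 * lam * ln 2) + K2 / K * (lam * ?c) = \<rho> * (K * (K1 * (4 * ln 2) + K2 * ?c))"
    proof -
      have "K1 / K * (4 * (\<rho> * K\<^sup>2) * A) + K2 / K * ((\<rho> * K\<^sup>2) * c) = \<rho> * (K * (K1 * (4 * A) + K2 * c))" for A c
        using K by (simp add: power2_eq_square field_simps)
      then show ?thesis unfolding lam_def .
    qed
    then show "K1 / K * (4 * lam * ln 2) + K2 / K * (lam * ?c) \<le> \<rho> * ((K1 + K2) * (K1 * (4 * ln 2) + K2 * ?c))"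
      by (simp add: K_def)
  qed
qed

end

section \<open>Refinement of the grid\<close>

text \<open>Fatou's lemma with bounds that may vary; it serves both the removal of the remainder and
  the limit in the ratio of the step sizes.\<close>

lemma nn_integral_exp_limit:
  fixes Z :: "nat \<Rightarrow> 'w \<Rightarrow> real"
  assumes [measurable]: "\<And>N. Z N \<in> borel_measurable M"
    and lim: "AE \<omega> in M. (\<lambda>N. Z N \<omega>) \<longlonglongrightarrow> Z' \<omega>" and c: "c \<longlonglongrightarrow> c'"
    and le: "\<And>N. (\<integral>\<^sup>+\<omega>. ennreal (Z N \<omega>) \<partial>M) \<le> ennreal (c N)"
  shows "(\<integral>\<^sup>+\<omega>. ennreal (Z' \<omega>) \<partial>M) \<le> ennreal c'"
proof -
  have "(\<integral>\<^sup>+\<omega>. ennreal (Z' \<omega>) \<partial>M) = (\<integral>\<^sup>+\<omega>. liminf (\<lambda>N. ennreal (Z N \<omega>)) \<partial>M)"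
  proof (rule nn_integral_cong_AE, use lim in eventually_elim)
    fix \<omega> assume "(\<lambda>N. Z N \<omega>) \<longlonglongrightarrow> Z' \<omega>"
    then have "(\<lambda>N. ennreal (Z N \<omega>)) \<longlonglongrightarrow> ennreal (Z' \<omega>)" by (rule tendsto_ennrealI)
    then show "ennreal (Z' \<omega>) = liminf (\<lambda>N. ennreal (Z N \<omega>))"
      by (intro lim_imp_Liminf[symmetric]) auto
  qed
  also have "\<dots> \<le> liminf (\<lambda>N. \<integral>\<^sup>+\<omega>. ennreal (Z N \<omega>) \<partial>M)"
    by (rule nn_integral_liminf) simp
  also have "\<dots> \<le> liminf (\<lambda>N. ennreal (c N))"
    by (intro Liminf_mono always_eventually allI le)
  also have "\<dots> = ennreal c'"
    using tendsto_ennrealI[OF c] by (intro lim_imp_Liminf) auto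
  finally show ?thesis .
qed

text \<open>Smallness of \<open>R p\<close> in probability does not control exponential moments of
  \<open>Q p + R p\<close>. Therefore the integrand is truncated first: the exceptional event then
  costs at most the truncation level times its probability.\<close>

lemma (in prob_space) exp_square_limit_in_probability:
  fixes tot :: "'a \<Rightarrow> real" and Q R :: "nat \<Rightarrow> 'a \<Rightarrow> real"
  assumes tot[measurable]: "tot \<in> borel_measurable M" and tot0: "\<And>\<omega>. 0 \<le> tot \<omega>" and \<rho>: "0 \<le> \<rho>"
    and R[measurable]: "\<And>p. 0 < p \<Longrightarrow> R p \<in> borel_measurable M"
    and le: "\<And>p \<omega>. 0 < p \<Longrightarrow> tot \<omega> \<le> Q p \<omega> + R p \<omega>"
    and Q: "\<And>p. 0 < p \<Longrightarrow> exp_moment_le M (\<lambda>\<omega>. \<rho> * (Q p \<omega>)\<^sup>2) c"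
    and small: "\<And>\<epsilon> \<eta>. 0 < \<epsilon> \<Longrightarrow> 0 < \<eta> \<Longrightarrow> \<exists>p>0. emeasure M {\<omega>\<in>space M. \<epsilon> < R p \<omega>} \<le> ennreal \<eta>"
  shows "(\<integral>\<^sup>+\<omega>. ennreal (exp (\<rho> * (tot \<omega>)\<^sup>2)) \<partial>M) \<le> ennreal (exp c)"
proof -
  \<comment> \<open>The shift \<open>1 / Suc N\<close> absorbs \<open>R p\<close> off the
    exceptional event. That event gets probability \<open>e / Suc N\<close>, so its cost at level
    \<open>N\<close> is at most \<open>e\<close>.\<close>
  define Z where "Z N \<omega> = min (real N) (exp (\<rho> * (max 0 (tot \<omega> - 1 / real (Suc N)))\<^sup>2))" for N \<omega>
  have Zm[measurable]: "Z N \<in> borel_measurable M" for N unfolding Z_def by measurable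
  show ?thesis
  proof (rule nn_integral_exp_limit[OF Zm _ tendsto_const])
    show "AE \<omega> in M. (\<lambda>N. Z N \<omega>) \<longlonglongrightarrow> exp (\<rho> * (tot \<omega>)\<^sup>2)"
    proof (rule AE_I2)
      fix \<omega>
      let ?f = "\<lambda>N. exp (\<rho> * (max 0 (tot \<omega> - 1 / real (Suc N)))\<^sup>2)"
      have "(\<lambda>N. tot \<omega> - 1 / real (Suc N)) \<longlonglongrightarrow> tot \<omega> - 0"
        by (intro tendsto_diff tendsto_const LIMSEQ_inverse_real_of_nat[unfolded inverse_eq_divide])
      then have "?f \<longlonglongrightarrow> exp (\<rho> * (max 0 (tot \<omega> - 0))\<^sup>2)"
        by (intro tendsto_exp tendsto_mult tendsto_power tendsto_max tendsto_const)
      then have lim: "?f \<longlonglongrightarrow> exp (\<rho> * (tot \<omega>)\<^sup>2)" using tot0[of \<omega>] by simp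
      have "eventually (\<lambda>N. Z N \<omega> = ?f N) sequentially"
      proof (rule eventually_sequentiallyI[of "nat \<lceil>exp (\<rho> * (tot \<omega>)\<^sup>2)\<rceil>"])
        fix N assume "nat \<lceil>exp (\<rho> * (tot \<omega>)\<^sup>2)\<rceil> \<le> N"
        then have N: "exp (\<rho> * (tot \<omega>)\<^sup>2) \<le> real N" by (simp add: nat_le_iff ceiling_le_iff)
        have "max 0 (tot \<omega> - 1 / real (Suc N)) \<le> tot \<omega>" using tot0[of \<omega>] by simp
        then have "?f N \<le> exp (\<rho> * (tot \<omega>)\<^sup>2)"
          using \<rho> by (intro exp_le_cancel_iff[THEN iffD2] mult_left_mono power_mono) auto
        then show "Z N \<omega> = ?f N" using N unfolding Z_def by (intro min_absorb2) linarith
      qed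
      with lim show "(\<lambda>N. Z N \<omega>) \<longlonglongrightarrow> exp (\<rho> * (tot \<omega>)\<^sup>2)"
        by (simp add: tendsto_cong)
    qed
    fix N
    show "(\<integral>\<^sup>+\<omega>. ennreal (Z N \<omega>) \<partial>M) \<le> ennreal (exp c)"
    proof (rule ennreal_le_epsilon)
      fix e :: real assume e: "0 < e"
      obtain p where p: "0 < p" and sm: "emeasure M {\<omega>\<in>space M. 1 / real (Suc N) < R p \<omega>} \<le> ennreal (e / real (Suc N))"
        using small[of "1 / real (Suc N)" "e / real (Suc N)"] e by auto
      let ?B = "{\<omega>\<in>space M. 1 / real (Suc N) < R p \<omega>}"
      note R[OF p, measurable]
      have B: "?B \<in> sets M" by measurable
      have Qm: "(\<lambda>\<omega>. \<rho> * (Q p \<omega>)\<^sup>2) \<in> borel_measurable M" using Q[OF p] by (simp add: exp_moment_le_def)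
      have "(\<integral>\<^sup>+\<omega>. ennreal (Z N \<omega>) \<partial>M) \<le> (\<integral>\<^sup>+\<omega>. ennreal (exp (\<rho> * (Q p \<omega>)\<^sup>2)) + ennreal (real N) * indicator ?B \<omega> \<partial>M)"
      proof (rule nn_integral_mono)
        fix \<omega> assume \<omega>: "\<omega> \<in> space M"
        show "ennreal (Z N \<omega>) \<le> ennreal (exp (\<rho> * (Q p \<omega>)\<^sup>2)) + ennreal (real N) * indicator ?B \<omega>"
        proof (cases "\<omega> \<in> ?B")
          case True
          have "ennreal (Z N \<omega>) \<le> ennreal (real N)" by (intro ennreal_leI) (simp add: Z_def)
          then show ?thesis using True by (simp add: add_increasing)
        next
          case False
          then have "tot \<omega> - 1 / real (Suc N) \<le> Q p \<omega>" using le[OF p, of \<omega>] \<omega> by auto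
          then have "(max 0 (tot \<omega> - 1 / real (Suc N)))\<^sup>2 \<le> (Q p \<omega>)\<^sup>2"
            by (cases "0 \<le> tot \<omega> - 1 / real (Suc N)") (auto simp: max_def intro!: power_mono)
          then have "Z N \<omega> \<le> exp (\<rho> * (Q p \<omega>)\<^sup>2)"
            unfolding Z_def using \<rho> by (intro min.coboundedI2) (simp add: mult_left_mono)
          then show ?thesis using False by (simp add: ennreal_leI)
        qed
      qed
      also have "\<dots> = (\<integral>\<^sup>+\<omega>. ennreal (exp (\<rho> * (Q p \<omega>)\<^sup>2)) \<partial>M) + ennreal (real N) * emeasure M ?B"
        using Qm B by (subst nn_integral_add) (auto simp: nn_integral_cmult_indicator)
      also have "\<dots> \<le> ennreal (exp c) + ennreal (real N) * ennreal (e / real (Suc N))"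
        using Q[OF p] sm by (intro add_mono mult_left_mono) (auto simp: exp_moment_le_def)
      also have "\<dots> = ennreal (exp c) + ennreal (real N * (e / real (Suc N)))"
        by (simp only: ennreal_mult'[symmetric] of_nat_0_le_iff)
      also have "\<dots> \<le> ennreal (exp c) + ennreal e"
        using e by (intro add_left_mono ennreal_leI) (simp add: field_simps)
      finally show "(\<integral>\<^sup>+\<omega>. ennreal (Z N \<omega>) \<partial>M) \<le> ennreal (exp c) + ennreal e" .
    qed
  qed
qed

context euler_bm
begin

text \<open>Markov's inequality for the exponential moment at \<open>lam = 1/8\<close>,
  \<open>q = 0\<close>, whose bound does not depend on the grid. The radius is chosen so that
  \<open>C / exp (C / \<eta>)\<close> appears, which is at most \<open>\<eta>\<close>.\<close>

lemma run_max_tail: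
  assumes \<eta>: "0 < \<eta>"
  shows "\<exists>r>0. \<forall>p>0. emeasure M {\<omega>\<in>space M. r < run_max p (n * (m * p)) \<omega>} \<le> ennreal \<eta>"
proof -
  define C where "C = exp (1/8 * ((3 * real CARD('d) + 1) * 0\<^sup>2 + 8 * real CARD('d) * 0 / sqrt pi + 4 * real CARD('d) * ln 2))"
  define r where "r = sqrt (8 * T * (C / \<eta>))"
  have C0: "0 < C" by (simp add: C_def)
  have r0: "0 < r" using T_pos C0 \<eta> by (simp add: r_def)
  have r2: "1/8 * (r / sqrt T)\<^sup>2 = C / \<eta>"
    using T_pos C0 \<eta> by (simp add: r_def power_divide)
  show ?thesis
  proof (intro exI[of _ r] conjI allI impI r0)
    fix p :: nat assume p: "0 < p"
    let ?J = "n * (m * p)" and ?t = "\<lambda>x. exp (1/8 * (0 + x / sqrt T)\<^sup>2)"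
    have J: "0 < ?J" using n_pos m_ge_2 p by simp
    have JT: "real ?J * mesh p = T" using n_pos m_ge_2 p by (simp add: mesh_def)
    note run_max_measurable[OF p, measurable]
    have "{\<omega>\<in>space M. r < run_max p ?J \<omega>} \<subseteq> {\<omega>\<in>space M. exp (C / \<eta>) < ?t (run_max p ?J \<omega>)}"
    proof
      fix \<omega> assume \<omega>: "\<omega> \<in> {\<omega>\<in>space M. r < run_max p ?J \<omega>}"
      then have "r / sqrt T < run_max p ?J \<omega> / sqrt T" using T_pos by (simp add: divide_strict_right_mono)
      then have "(r / sqrt T)\<^sup>2 < (run_max p ?J \<omega> / sqrt T)\<^sup>2"
        using r0 T_pos by (intro power_strict_mono) auto
      then show "\<omega> \<in> {\<omega>\<in>space M. exp (C / \<eta>) < ?t (run_max p ?J \<omega>)}"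
        using \<omega> by (simp add: r2[symmetric])
    qed
    then have "emeasure M {\<omega>\<in>space M. r < run_max p ?J \<omega>} \<le> emeasure M {\<omega>\<in>space M. exp (C / \<eta>) < ?t (run_max p ?J \<omega>)}"
      by (rule emeasure_mono) measurable
    also have "\<dots> \<le> ennreal (C / exp (C / \<eta>))"
    proof (rule emeasure_gt_le_nn_integral)
      show "(\<integral>\<^sup>+\<omega>. ennreal (?t (run_max p ?J \<omega>)) \<partial>M) \<le> ennreal C"
        using bm_max_exp_bound[OF bm mesh_pos[OF p] J, of "1/8" 0] unfolding JT run_max_def C_def by simp
    qed auto
    also have "\<dots> \<le> ennreal \<eta>"
    proof (rule ennreal_leI)
      have "C / \<eta> \<le> exp (C / \<eta>)" using exp_ge_add_one_self[of "C / \<eta>"] by linarith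
      then show "C / exp (C / \<eta>) \<le> \<eta>" using \<eta> by (simp add: divide_le_eq pos_divide_le_eq mult.commute)
    qed
    finally show "emeasure M {\<omega>\<in>space M. r < run_max p ?J \<omega>} \<le> ennreal \<eta>" .
  qed
qed

text \<open>By \<open>y_bound\<close> the scheme is controlled pathwise by the running maximum, so
  its tail bound, uniform in \<open>p\<close>, carries over.\<close>

lemma interp_localization:
  assumes \<eta>: "0 < \<eta>"
  shows "\<exists>R>0. \<forall>p>0. emeasure M {\<omega>\<in>space M. \<exists>j<n * (m * p). R < norm (interp p j \<omega> - x0)} \<le> ennreal \<eta>"
proof -
  obtain r where r: "0 < r" "\<And>p. 0 < p \<Longrightarrow> emeasure M {\<omega>\<in>space M. r < run_max p (n * (m * p)) \<omega>} \<le> ennreal \<eta>"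
    using run_max_tail[OF \<eta>] by blast
  define R where "R = exp (L * T) * (norm (b x0) + L + L * r) / L"
  have R0: "0 < R" using L_pos r by (simp add: R_def add_nonneg_pos)
  show ?thesis
  proof (intro exI[of _ R] conjI allI impI R0)
    fix p :: nat assume p: "0 < p"
    let ?J = "n * (m * p)"
    have JT: "real ?J * mesh p = T" using n_pos m_ge_2 p by (simp add: mesh_def)
    note run_max_measurable[OF p, measurable]
    have "{\<omega>\<in>space M. \<exists>j<?J. R < norm (interp p j \<omega> - x0)} \<subseteq> {\<omega>\<in>space M. r < run_max p ?J \<omega>}"
    proof
      fix \<omega> assume "\<omega> \<in> {\<omega>\<in>space M. \<exists>j<?J. R < norm (interp p j \<omega> - x0)}"
      then obtain j where \<omega>: "\<omega> \<in> space M" and j: "j < ?J" "R < norm (interp p j \<omega> - x0)" by auto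
      interpret e: euler_pair b b' b'' x0 L a T "mesh p" m n p "\<lambda>j. interp p j \<omega>" "\<lambda>j. drift_at p j \<omega>" "\<lambda>j. incr p j \<omega>" "coarse_scheme \<omega>" "\<lambda>j. run_max p j \<omega>"
        by (rule euler_pair[OF p])
      have "exp (L * T) * (norm (b x0) + L + L * r) = L * R" using L_pos by (simp add: R_def)
      also have "\<dots> < L * norm (interp p j \<omega> - x0)" using j L_pos by simp
      also have "\<dots> \<le> norm (b x0) + L + L * norm (interp p j \<omega> - x0)" using L_pos by simp
      also have "\<dots> \<le> e.\<Theta> j" by (rule e.y_bound)
      also have "\<dots> \<le> e.\<Theta> ?J" using j by (intro e.Theta_mono) simp
      also have "\<dots> = exp (L * T) * (norm (b x0) + L + L * run_max p ?J \<omega>)"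
        unfolding e.\<Theta>_def JT ..
      finally have "r < run_max p ?J \<omega>" using L_pos by simp
      with \<omega> show "\<omega> \<in> {\<omega>\<in>space M. r < run_max p ?J \<omega>}" by simp
    qed
    then have "emeasure M {\<omega>\<in>space M. \<exists>j<?J. R < norm (interp p j \<omega> - x0)} \<le> emeasure M {\<omega>\<in>space M. r < run_max p ?J \<omega>}"
      by (rule emeasure_mono) measurable
    also have "\<dots> \<le> ennreal \<eta>" by (rule r(2)[OF p])
    finally show "emeasure M {\<omega>\<in>space M. \<exists>j<?J. R < norm (interp p j \<omega> - x0)} \<le> ennreal \<eta>" .
  qed
qed

lemma remainder_measurable:
  assumes p: "0 < p" shows "remainder_part p k \<in> borel_measurable M"
proof -
  have i[measurable]: "interp p j \<in> borel_measurable M" for j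
    using gaussian_walk.Fil_measurable[OF walk[OF p] interp_adapted[OF p order_refl] order_refl] .
  have [measurable]: "incr p j \<in> borel_measurable M" for j
    using gaussian_walk.increment_measurable_M[OF walk[OF p, of "Suc j"]] by simp
  have l: "(\<lambda>y. b' y v) \<in> borel_measurable borel" for v
    by (intro borel_measurable_continuous_onI bounded_linear.continuous_on[OF blinfun.bounded_linear_left continuous_b'])
  have g: "(\<lambda>\<omega>. b' (interp p j \<omega>) (f \<omega>)) \<in> borel_measurable M" if [measurable]: "f \<in> borel_measurable M" for f j
  proof -
    have "continuous_on UNIV (\<lambda>z :: (real^'d) \<times> (real^'d). b' (fst z) (snd z))"
      by (intro continuous_intros continuous_on_compose2[OF continuous_b']) auto
    from borel_measurable_continuous_on[OF this, of "\<lambda>\<omega>. (interp p j \<omega>, f \<omega>)" M] show ?thesis by simp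
  qed
  have h: "(\<lambda>\<omega>. \<Sum>i\<in>UNIV. b'' (interp p j \<omega>) (axis i 1) (axis i 1)) \<in> borel_measurable M" for j
  proof -
    have "continuous_on UNIV (\<lambda>y. \<Sum>i\<in>UNIV. b'' y (axis i 1) (axis i 1))"
      by (intro continuous_on_sum bounded_linear.continuous_on[OF bounded_linear_compose[OF blinfun.bounded_linear_left blinfun.bounded_linear_left] b''_cont])
    then show ?thesis by (rule borel_measurable_continuous_on) simp
  qed
  note g[measurable] h[measurable]
  show ?thesis
    unfolding remainder_part_def ito_remainder_def drift_at_def by measurable
qed

text \<open>Each of the \<open>n + 1\<close> coarse times receives an equal share of
  \<open>\<epsilon>\<close> and \<open>\<eta>\<close>, and half of each share of
  \<open>\<eta>\<close> pays for leaving the ball. On the ball the drift is bounded by linear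
  growth.\<close>

lemma remainder_in_probability:
  assumes \<epsilon>: "0 < \<epsilon>" and \<eta>: "0 < \<eta>"
  shows "\<exists>p>0. emeasure M {\<omega>\<in>space M. \<epsilon> < (\<Sum>i\<le>n. norm (remainder_part p i \<omega>))} \<le> ennreal \<eta>"
proof -
  define N where "N = real (Suc n)"
  have N: "0 < N" by (simp add: N_def)
  obtain R where R: "0 < R" "\<And>p. 0 < p \<Longrightarrow> emeasure M {\<omega>\<in>space M. \<exists>j<n * (m * p). R < norm (interp p j \<omega> - x0)} \<le> ennreal (\<eta> / (2 * N))"
    using interp_localization[of "\<eta> / (2 * N)"] \<eta> N by auto
  let ?B = "norm (b x0) + L * R"
  have B: "0 \<le> ?B" using L_pos R by simp
  obtain \<delta>0 where \<delta>0: "0 < \<delta>0" and lim: "\<And>Fil G J \<delta> y \<beta> c K. gaussian_walk M Fil G J \<delta> \<Longrightarrow> 0 < \<delta> \<Longrightarrow> \<delta> < \<delta>0 \<Longrightarrow> real J * \<delta> = T \<Longrightarrow> K \<le> J \<Longrightarrow>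
     (\<forall>j<J. y j \<in> borel_measurable (Fil j)) \<Longrightarrow>
     (\<forall>j<J. \<forall>\<omega>\<in>space M. (\<forall>i\<le>j. norm (y i \<omega> - x0) \<le> R) \<longrightarrow> norm (\<beta> j \<omega>) \<le> ?B) \<Longrightarrow>
     (\<forall>j. 0 \<le> c j \<and> c j \<le> T) \<Longrightarrow>
     emeasure M {\<omega>\<in>space M. \<epsilon> / N < norm (\<Sum>j<K. c j *\<^sub>R ito_remainder \<delta> (\<beta> j \<omega>) (y j \<omega>) (G j \<omega>))}
       \<le> emeasure M {\<omega>\<in>space M. \<exists>j<J. R < norm (y j \<omega> - x0)} + ennreal (\<eta> / (2 * N))"
    using ito_remainder_in_probability[of "\<epsilon> / N" "\<eta> / (2 * N)" T T ?B M R] \<epsilon> \<eta> N T_pos B by auto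
  \<comment> \<open>Since \<open>mesh p \<le> T / p\<close>, this brings the mesh below
    \<open>\<delta>0\<close>.\<close>
  obtain p :: nat where p: "T / \<delta>0 < real p" using reals_Archimedean2 by blast
  have "0 < T / \<delta>0" using T_pos \<delta>0 by simp
  with p have p0: "0 < p" by (metis of_nat_0_less_iff order.strict_trans)
  let ?J = "n * (m * p)"
  have "mesh p \<le> T / real p"
  proof -
    have "1 * real p \<le> real m * real n * real p"
      using m_ge_2 n_pos mult_mono[of 1 "real m" 1 "real n"] by (intro mult_right_mono) auto
    then show ?thesis unfolding mesh_def using T_pos p0 by (intro divide_left_mono) auto
  qed
  also have "\<dots> < \<delta>0" using p p0 \<delta>0 by (simp add: field_simps)
  finally have mesh: "mesh p < \<delta>0" .
  have one: "emeasure M {\<omega>\<in>space M. \<epsilon> / N < norm (remainder_part p i \<omega>)} \<le> ennreal (\<eta> / N)" if i: "i \<le> n" for i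
  proof -
    have "emeasure M {\<omega>\<in>space M. \<epsilon> / N < norm (remainder_part p i \<omega>)}
        \<le> emeasure M {\<omega>\<in>space M. \<exists>j<?J. R < norm (interp p j \<omega> - x0)} + ennreal (\<eta> / (2 * N))"
      unfolding remainder_part_def
    proof (rule lim[OF walk[OF p0] mesh_pos[OF p0] mesh])
      show "real ?J * mesh p = T" using n_pos m_ge_2 p0 by (simp add: mesh_def)
      show "i * (m * p) \<le> ?J" using i by (rule mult_right_mono) simp
      show "\<forall>j<?J. interp p j \<in> borel_measurable (Fil p j)" using interp_adapted[OF p0] by simp
      show "\<forall>j<?J. \<forall>\<omega>\<in>space M. (\<forall>i\<le>j. norm (interp p i \<omega> - x0) \<le> R) \<longrightarrow> norm (drift_at p j \<omega>) \<le> ?B"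
      proof (intro allI impI ballI)
        fix j \<omega> assume "\<forall>i\<le>j. norm (interp p i \<omega> - x0) \<le> R"
        then have "norm (interp p (p * (j div p)) \<omega> - x0) \<le> R" by simp
        then have "L * norm (interp p (p * (j div p)) \<omega> - x0) \<le> L * R" using L_pos by simp
        then show "norm (drift_at p j \<omega>) \<le> ?B"
          unfolding drift_at_def using b_growth[of "interp p (p * (j div p)) \<omega>"] by linarith
      qed
      show "\<forall>j. 0 \<le> weight p j \<and> weight p j \<le> T"
      proof
        fix j
        have "j div p mod m < m" using m_ge_2 by simp
        then have r: "0 \<le> real m - 1 - real (j div p mod m)" "real m - 1 - real (j div p mod m) \<le> real m" by auto
        have "weight p j \<le> T / (real m * real n) * real m"
          unfolding weight_def using r T_pos by (intro mult_left_mono) auto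
        also have "\<dots> = T / real n" using m_ge_2 by simp
        also have "\<dots> \<le> T" using T_pos n_pos by (simp add: divide_le_eq)
        finally show "0 \<le> weight p j \<and> weight p j \<le> T"
          unfolding weight_def using r T_pos by (simp add: mult_nonneg_nonneg)
      qed
    qed
    also have "\<dots> \<le> ennreal (\<eta> / (2 * N)) + ennreal (\<eta> / (2 * N))" by (intro add_right_mono R(2) p0)
    also have "\<dots> = ennreal (\<eta> / N)" using \<eta> N by (simp add: ennreal_plus[symmetric] del: ennreal_plus)
    finally show ?thesis .
  qed
  note remainder_measurable[OF p0, measurable]
  have "{\<omega>\<in>space M. \<epsilon> < (\<Sum>i\<le>n. norm (remainder_part p i \<omega>))} \<subseteq> (\<Union>i\<in>{..n}. {\<omega>\<in>space M. \<epsilon> / N < norm (remainder_part p i \<omega>)})"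
  proof
    fix \<omega> assume \<omega>: "\<omega> \<in> {\<omega>\<in>space M. \<epsilon> < (\<Sum>i\<le>n. norm (remainder_part p i \<omega>))}"
    have "\<exists>i\<le>n. \<epsilon> / N < norm (remainder_part p i \<omega>)"
    proof (rule ccontr)
      assume "\<not> (\<exists>i\<le>n. \<epsilon> / N < norm (remainder_part p i \<omega>))"
      then have "(\<Sum>i\<le>n. norm (remainder_part p i \<omega>)) \<le> (\<Sum>i\<le>n. \<epsilon> / N)"
        by (intro sum_mono) (auto simp: not_less)
      also have "\<dots> = \<epsilon>" by (simp add: N_def)
      finally show False using \<omega> by simp
    qed
    then show "\<omega> \<in> (\<Union>i\<in>{..n}. {\<omega>\<in>space M. \<epsilon> / N < norm (remainder_part p i \<omega>)})" using \<omega> by auto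
  qed
  then have "emeasure M {\<omega>\<in>space M. \<epsilon> < (\<Sum>i\<le>n. norm (remainder_part p i \<omega>))} \<le> emeasure M (\<Union>i\<in>{..n}. {\<omega>\<in>space M. \<epsilon> / N < norm (remainder_part p i \<omega>)})"
    by (rule emeasure_mono) measurable
  also have "\<dots> \<le> (\<Sum>i\<le>n. emeasure M {\<omega>\<in>space M. \<epsilon> / N < norm (remainder_part p i \<omega>)})"
    by (rule emeasure_subadditive_finite) auto
  also have "\<dots> \<le> (\<Sum>i\<le>n. ennreal (\<eta> / N))" by (intro sum_mono one) auto
  also have "\<dots> = ennreal \<eta>"
    using \<eta> N by (subst sum_ennreal) (auto simp: N_def)
  finally show ?thesis using p0 by blast
qed

lemma euler_path_measurable:
  assumes h: "0 \<le> h" shows "(\<lambda>\<omega>. euler_path b x0 h (\<lambda>t. W t \<omega>) l) \<in> borel_measurable M"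
proof (induction l)
  case (Suc l)
  note Suc[measurable]
  have [measurable]: "W (real k * h) \<in> borel_measurable M" for k
    using h by (intro W_measurable) auto
  show ?case unfolding euler_path.simps by measurable
qed simp

text \<open>Neither side depends on the auxiliary grid. It enters only through the intermediate
  bound, whose moment estimate is uniform in \<open>p\<close> and whose remainder can be made small
  in probability.\<close>

lemma finite_ratio_bound:
  fixes z \<rho> :: real
  assumes z: "0 \<le> z" and \<rho>: "0 \<le> \<rho>"
    and bound: "\<rho> \<le> rho_bound T L a CARD('d) (enat m) n"
  shows "(\<integral>\<^sup>+\<omega>. ennreal (exp (\<rho> * (pred_over_m (enat m) * T\<^sup>2 * z / (2 * real n)
       + (MAX k\<in>{1..n}. norm (fine_scheme \<omega> (k * m) - coarse_scheme \<omega> k)))\<^sup>2)) \<partial>M)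
    \<le> ennreal (exp (\<rho> * C_U T L a CARD('d) (norm (b x0)) (enat m) z * (pred_over_m (enat m) * T\<^sup>2 / (real n)\<^sup>2)))"
proof -
  let ?d = "real CARD('d)"
  define u where "u = pred_over_m (enat m)"
  define v where "v = double_pred_over_m (enat m)"
  have u: "u = (real m - 1) / real m" and v: "v = (2 * real m - 1) / real m"
    by (simp_all add: u_def v_def pred_over_m_def double_pred_over_m_def)
  have u0: "0 < u" and v0: "0 < v" using m_ge_2 by (auto simp: u v)
  have mop: "m_over_pred (enat m) = 1 / u" by (simp add: m_over_pred_def u)
  define zt where "zt = x_tilde T L a z"
  define Y where "Y = norm (b x0) + L + zt"
  have zt0: "0 \<le> zt" using z L_pos a_nonneg by (simp add: zt_def x_tilde_def)
  have Y0: "0 \<le> Y" using zt0 L_pos by (simp add: Y_def)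
  \<comment> \<open>\<open>x_tilde\<close> is defined so that the exponential and the factor
    \<open>L\<^sup>2 + a\<close> in \<open>kappa\<close> cancel.\<close>
  have shift: "u * T\<^sup>2 * z / (2 * real n) = kappa * zt / L"
  proof -
    have "0 < L\<^sup>2 + a" using L_pos a_nonneg by (simp add: add_pos_nonneg)
    moreover have "exp (T * L) * exp (- L * T) = 1" by (simp add: exp_add[symmetric])
    moreover have "w \<noteq> 0 \<Longrightarrow> E * F = 1 \<Longrightarrow> T\<^sup>2 * u / (2 * N) * (E * w) * (L * F / w * z) / L = u * T\<^sup>2 * z / (2 * N) * (E * F)" for w E F N :: real
      using L_pos by (simp add: field_simps)
    ultimately show ?thesis
      unfolding zt_def x_tilde_def kappa_def C_B_def u[symmetric] by (metis less_irrefl mult.right_neutral)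
  qed
  define K1 where "K1 = sqrt ?d * theta * C_A T L"
  define K2 where "K2 = kappa * (2 / 3 * sqrt T)"
  have th: "theta = L * (T / real n) * sqrt (u * v / 6)"
  proof -
    have "u * v / 6 = ((real m - 1) * (2 * real m - 1) / 6) / (real m)\<^sup>2"
      by (simp add: u v power2_eq_square)
    then have "sqrt (u * v / 6) = sqrt ((real m - 1) * (2 * real m - 1) / 6) / real m"
      by (simp only: real_sqrt_divide real_sqrt_abs abs_of_nat)
    then show ?thesis by (simp add: theta_def)
  qed
  have kap: "kappa = T\<^sup>2 * u / (2 * real n) * C_B T L a" by (simp add: kappa_def u)
  have d0: "0 < ?d" and n0: "0 < real n" using n_pos by auto
  note ref = reference_constants[OF u0 v0 d0 L_pos T_pos n0, of "C_A T L" "C_B T L a", folded th kap, folded K1_def K2_def]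
  define AB where "AB = C_AB T L a CARD('d) (enat m)"
  have AB: "AB = C_A T L * L * sqrt (3 * ?d * v) + C_B T L a * T powr (3/2) * sqrt (2 * u)"
    by (simp add: AB_def C_AB_def u_def v_def)
  have K: "K1 + K2 = T / real n * sqrt u * AB / sqrt 18"
    unfolding AB by (rule ref(1))
  \<comment> \<open>The square of \<open>sqrt 18\<close> meets the 9/4 of \<open>rho_bound\<close>:
    9 / (4 * 18) = 1/8.\<close>
  have lam8: "\<rho> * (K1 + K2)\<^sup>2 \<le> 1/8"
  proof (cases "AB = 0")
    case False
    have sq: "(K1 + K2)\<^sup>2 = T\<^sup>2 / (real n)\<^sup>2 * u * AB\<^sup>2 / 18"
      unfolding K using u0 by (simp add: power_mult_distrib power_divide)
    have "\<rho> \<le> 9 * (1 / u) * (real n)\<^sup>2 / (4 * T\<^sup>2 * AB\<^sup>2)"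
      using bound by (simp add: rho_bound_def mop AB_def)
    then have "\<rho> * (K1 + K2)\<^sup>2 \<le> 9 * (1 / u) * (real n)\<^sup>2 / (4 * T\<^sup>2 * AB\<^sup>2) * (T\<^sup>2 / (real n)\<^sup>2 * u * AB\<^sup>2 / 18)"
      unfolding sq using u0 by (intro mult_right_mono) auto
    also have "\<dots> = 1/8"
    proof -
      have "u' \<noteq> 0 \<Longrightarrow> T' \<noteq> 0 \<Longrightarrow> N' \<noteq> 0 \<Longrightarrow> A' \<noteq> 0 \<Longrightarrow> 9 * (1 / u') * N' / (4 * T' * A') * (T' / N' * u' * A' / 18) = 1/8" for u' T' N' A' :: real
        by simp
      then show ?thesis using u0 T_pos n0 False by simp
    qed
    finally show ?thesis .
  qed (simp add: K)
  let ?G = "1 + exp (L * T) * (L * (T / real n))"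
  let ?tot = "\<lambda>\<omega>. kappa * zt / L + (MAX k\<in>{1..n}. norm (fine_scheme \<omega> (k * m) - coarse_scheme \<omega> k))"
  have kap0: "0 \<le> kappa" using T_pos m_ge_2 L_pos a_nonneg by (simp add: kappa_def C_B_def)
  have ne: "{1..n} \<noteq> {}" using n_pos by auto
  have G0: "0 < ?G" using L_pos T_pos by (intro add_pos_nonneg) auto
  have "(\<integral>\<^sup>+\<omega>. ennreal (exp (\<rho> * (?tot \<omega>)\<^sup>2)) \<partial>M) \<le> ennreal (exp (\<rho> * ((K1 + K2) * (K1 * (4 * ln 2) + K2 * ((3 * ?d + 1) * (3 * (Y / L) / (2 * sqrt T))\<^sup>2 + 8 * ?d * (3 * (Y / L) / (2 * sqrt T)) / sqrt pi + 4 * ?d * ln 2)))))"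
  proof (rule exp_square_limit_in_probability[where Q="\<lambda>p. main_bound p Y" and R="\<lambda>p \<omega>. ?G * (\<Sum>i\<le>n. norm (remainder_part p i \<omega>))"])
    have [measurable]: "(\<lambda>\<omega>. fine_scheme \<omega> l) \<in> borel_measurable M" "(\<lambda>\<omega>. coarse_scheme \<omega> l) \<in> borel_measurable M" for l
      using T_pos by (auto simp: fine_scheme_def coarse_scheme_def intro!: euler_path_measurable)
    show "?tot \<in> borel_measurable M"
      by (intro borel_measurable_add borel_measurable_const borel_measurable_Max) auto
    show "0 \<le> ?tot \<omega>" for \<omega>
    proof -
      have "0 \<le> (MAX k\<in>{1..n}. norm (fine_scheme \<omega> (k * m) - coarse_scheme \<omega> k))"
        using n_pos by (intro order_trans[OF norm_ge_zero Max_ge[of _ "norm (fine_scheme \<omega> (n * m) - coarse_scheme \<omega> n)"]]) auto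
      then show ?thesis using kap0 zt0 L_pos by simp
    qed
    show "0 \<le> \<rho>" by fact
    show "(\<lambda>\<omega>. ?G * (\<Sum>i\<le>n. norm (remainder_part p i \<omega>))) \<in> borel_measurable M" if "0 < p" for p
    proof -
      note remainder_measurable[OF that, measurable]
      show ?thesis by measurable
    qed
    show "?tot \<omega> \<le> main_bound p Y \<omega> + ?G * (\<Sum>i\<le>n. norm (remainder_part p i \<omega>))" if p: "0 < p" for p \<omega>
    proof -
      have "norm (fine_scheme \<omega> (k * m) - coarse_scheme \<omega> k) \<le> main_bound p Y \<omega> + ?G * (\<Sum>i\<le>n. norm (remainder_part p i \<omega>)) - kappa * zt / L" if "k \<in> {1..n}" for k
        using scheme_difference_le[OF p, of k zt \<omega>] that unfolding Y_def by auto
      then have "(MAX k\<in>{1..n}. norm (fine_scheme \<omega> (k * m) - coarse_scheme \<omega> k)) \<le> main_bound p Y \<omega> + ?G * (\<Sum>i\<le>n. norm (remainder_part p i \<omega>)) - kappa * zt / L"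
        using ne by (subst Max_le_iff) auto
      then show ?thesis by linarith
    qed
    show "exp_moment_le M (\<lambda>\<omega>. \<rho> * (main_bound p Y \<omega>)\<^sup>2) (\<rho> * ((K1 + K2) * (K1 * (4 * ln 2) + K2 * ((3 * ?d + 1) * (3 * (Y / L) / (2 * sqrt T))\<^sup>2 + 8 * ?d * (3 * (Y / L) / (2 * sqrt T)) / sqrt pi + 4 * ?d * ln 2))))" if "0 < p" for p
      unfolding K1_def K2_def by (rule main_bound_exp_moment[OF that Y0 \<rho>]) (use lam8 in \<open>simp add: K1_def K2_def\<close>)
    show "\<exists>p>0. emeasure M {\<omega>\<in>space M. \<epsilon> < ?G * (\<Sum>i\<le>n. norm (remainder_part p i \<omega>))} \<le> ennreal \<eta>" if "0 < \<epsilon>" "0 < \<eta>" for \<epsilon> \<eta>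
    proof -
      have "\<epsilon> < ?G * s \<longleftrightarrow> \<epsilon> / ?G < s" for s
        using G0 by (simp only: pos_divide_less_eq mult.commute[of ?G])
      then show ?thesis using remainder_in_probability[of "\<epsilon> / ?G" \<eta>] that G0 by simp
    qed
  qed
  also have "\<rho> * ((K1 + K2) * (K1 * (4 * ln 2) + K2 * ((3 * ?d + 1) * (3 * (Y / L) / (2 * sqrt T))\<^sup>2 + 8 * ?d * (3 * (Y / L) / (2 * sqrt T)) / sqrt pi + 4 * ?d * ln 2)))
      = \<rho> * C_U T L a CARD('d) (norm (b x0)) (enat m) z * (u * T\<^sup>2 / (real n)\<^sup>2)"
    unfolding ref(2) C_U_def AB_def[symmetric] u_def[symmetric] v_def[symmetric] zt_def[symmetric] Y_def[symmetric] AB[symmetric] by (simp only: mult.assoc)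
  finally show ?thesis
    unfolding u_def[symmetric] shift .
qed

end

section \<open>Passage to the diffusion\<close>

lemma tendsto_MAX:
  fixes f :: "'k \<Rightarrow> 'a \<Rightarrow> real"
  assumes "finite A" "A \<noteq> {}" "\<And>k. k \<in> A \<Longrightarrow> ((\<lambda>x. f k x) \<longlongrightarrow> l k) F"
  shows "((\<lambda>x. MAX k\<in>A. f k x) \<longlongrightarrow> (MAX k\<in>A. l k)) F"
  using assms
proof (induction A rule: finite_ne_induct)
  case (insert a A)
  have "((\<lambda>x. max (f a x) (MAX k\<in>A. f k x)) \<longlongrightarrow> max (l a) (MAX k\<in>A. l k)) F"
    using insert by (intro tendsto_max) auto
  with insert show ?case by simp
qed simp

lemma eta_on_step:
  assumes T: "0 < T" and N: "0 < N" and s: "real k * (T / real N) \<le> s" "s < real (Suc k) * (T / real N)"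
  shows "eta T N s = real k * (T / real N)"
proof -
  have "real k \<le> real N * s / T" "real N * s / T < real k + 1"
    using s T N by (auto simp: field_simps)
  then have "\<lfloor>real N * s / T\<rfloor> = int k" by (intro floor_unique) auto
  then show ?thesis by (simp add: eta_def)
qed

lemma euler_scheme_eq_euler_path:
  fixes Y :: "real \<Rightarrow> real^'d::finite"
  assumes T: "0 < T" and N: "0 < N" and w0: "w 0 = 0"
    and int: "\<And>t. t \<in> {0..T} \<Longrightarrow> (\<lambda>s. b (Y (eta T N s))) integrable_on {0..t}"
    and eq: "\<And>t. t \<in> {0..T} \<Longrightarrow> Y t = x0 + integral {0..t} (\<lambda>s. b (Y (eta T N s))) + w t"
    and k: "k \<le> N"
  shows "Y (real k * (T / real N)) = euler_path b x0 (T / real N) w k"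
  using k
proof (induction k)
  case 0
  then show ?case using eq[of 0] T w0 by simp
next
  case (Suc k)
  let ?h = "T / real N"
  let ?f = "\<lambda>s. b (Y (eta T N s))"
  have h: "0 < ?h" using T N by simp
  have hN: "real N * ?h = T" using N by simp
  have len: "real (Suc k) * ?h - real k * ?h = ?h" by (simp only: of_nat_Suc distrib_right)
  have le: "real (Suc k) * ?h \<le> T" "real k * ?h \<le> real (Suc k) * ?h" "0 \<le> real k * ?h"
  proof -
    have "real (Suc k) * ?h \<le> real N * ?h" using Suc.prems h by (intro mult_right_mono) auto
    then show "real (Suc k) * ?h \<le> T" unfolding hN .
    show "real k * ?h \<le> real (Suc k) * ?h" using h by (intro mult_right_mono) auto
    show "0 \<le> real k * ?h" using h by (intro mult_nonneg_nonneg) auto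
  qed
  have "(?f has_integral ?h *\<^sub>R b (Y (real k * ?h))) {real k * ?h..real (Suc k) * ?h}"
  \<comment> \<open>At the right end of the step \<open>eta\<close> has already jumped to the next
    grid point.\<close>
  proof (rule has_integral_spike_finite[where S="{real (Suc k) * ?h}"])
    show "((\<lambda>_. b (Y (real k * ?h))) has_integral ?h *\<^sub>R b (Y (real k * ?h))) {real k * ?h..real (Suc k) * ?h}"
      using has_integral_const_real[of "b (Y (real k * ?h))" "real k * ?h" "real (Suc k) * ?h"]
      unfolding content_real[OF le(2)] len .
    fix s assume "s \<in> {real k * ?h..real (Suc k) * ?h} - {real (Suc k) * ?h}"
    then have "eta T N s = real k * ?h" by (intro eta_on_step T N) auto
    then show "?f s = b (Y (real k * ?h))" by simp
  qed simp
  then have i: "integral {real k * ?h..real (Suc k) * ?h} ?f = ?h *\<^sub>R b (Y (real k * ?h))"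
    by (rule integral_unique)
  have "integral {0..real k * ?h} ?f + integral {real k * ?h..real (Suc k) * ?h} ?f = integral {0..real (Suc k) * ?h} ?f"
    using le by (intro Henstock_Kurzweil_Integration.integral_combine int) auto
  then have "Y (real (Suc k) * ?h) = Y (real k * ?h) + ?h *\<^sub>R b (Y (real k * ?h)) + (w (real (Suc k) * ?h) - w (real k * ?h))"
    using eq[of "real (Suc k) * ?h"] eq[of "real k * ?h"] le unfolding i by (simp add: algebra_simps)
  then show ?case using Suc by simp
qed

text \<open>With additive noise the increments of \<open>w\<close> cancel in the difference. What
  remains is a Lipschitz term and the oscillation of the continuous path \<open>X\<close> within one
  step, to which Gronwall's lemma applies; no rate is required.\<close>

lemma (in drift) euler_path_converges:
  fixes X :: "real \<Rightarrow> real^'d"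
  assumes T: "0 < T" and w0: "w 0 = 0" and cont: "continuous_on {0..T} X"
    and eq: "\<And>t. t \<in> {0..T} \<Longrightarrow> X t = x0 + integral {0..t} (\<lambda>s. b (X s)) + w t"
    and \<epsilon>: "0 < \<epsilon>"
  shows "\<exists>N0. \<forall>N\<ge>N0. 0 < N \<longrightarrow> (\<forall>k\<le>N. norm (X (real k * (T / real N)) - euler_path b x0 (T / real N) w k) \<le> \<epsilon>)"
proof -
  \<comment> \<open>Gronwall's lemma magnifies the oscillation by at most
    \<open>L * T * exp (L * T)\<close>.\<close>
  define \<epsilon>' where "\<epsilon>' = \<epsilon> / (L * T * exp (L * T))"
  have \<epsilon>': "0 < \<epsilon>'" using \<epsilon> L_pos T by (simp add: \<epsilon>'_def)
  have "uniformly_continuous_on {0..T} X" by (rule compact_uniformly_continuous[OF cont]) simp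
  then obtain \<eta> where \<eta>: "0 < \<eta>" "\<And>s t. s \<in> {0..T} \<Longrightarrow> t \<in> {0..T} \<Longrightarrow> dist s t < \<eta> \<Longrightarrow> dist (X s) (X t) < \<epsilon>'"
    unfolding uniformly_continuous_on_def using \<epsilon>' by metis
  obtain N0 :: nat where N0: "T / \<eta> < real N0" using reals_Archimedean2 by blast
  have bX: "continuous_on {0..T} (\<lambda>s. b (X s))"
    by (rule continuous_on_compose2[OF continuous_b[of UNIV] cont]) auto
  show ?thesis
  proof (intro exI[of _ N0] allI impI)
    fix N k :: nat assume N: "N0 \<le> N" "0 < N" and k: "k \<le> N"
    let ?h = "T / real N"
    let ?e = "euler_path b x0 ?h w"
    have h: "0 < ?h" using T N by simp
    have hN: "real N * ?h = T" using N by simp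
    have "T / \<eta> < real N" using N0 N by linarith
    then have h\<eta>: "?h < \<eta>" using \<eta>(1) N by (simp add: field_simps)
    have "norm (X (real k * ?h) - ?e k) \<le> (\<Sum>i<N. exp (L * ?h * (real N - 1 - real i)) * (L * ?h * \<epsilon>'))"
    proof (rule discrete_gronwall[OF _ _ _ _ k])
      show "norm (X (real 0 * ?h) - ?e 0) \<le> 0" using eq[of 0] T w0 by simp
      show "0 \<le> L * ?h" by (rule mult_nonneg_nonneg[OF less_imp_le[OF L_pos] less_imp_le[OF h]])
      then show "0 \<le> L * ?h * \<epsilon>'" using \<epsilon>' by (intro mult_nonneg_nonneg[of "L * ?h"]) auto
      fix k assume k: "k < N"
      have len: "real (Suc k) * ?h - real k * ?h = ?h" by (simp only: of_nat_Suc distrib_right)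
      let ?I = "{real k * ?h..real (Suc k) * ?h}"
      have le: "real (Suc k) * ?h \<le> T" "real k * ?h \<le> real (Suc k) * ?h" "0 \<le> real k * ?h"
  proof -
    have "real (Suc k) * ?h \<le> real N * ?h" using k h by (intro mult_right_mono) auto
    then show "real (Suc k) * ?h \<le> T" unfolding hN .
    show "real k * ?h \<le> real (Suc k) * ?h" using h by (intro mult_right_mono) auto
    show "0 \<le> real k * ?h" using h by (intro mult_nonneg_nonneg) auto
  qed
      have sub: "?I \<subseteq> {0..T}" using le by auto
      have "integral {0..real k * ?h} (\<lambda>s. b (X s)) + integral ?I (\<lambda>s. b (X s)) = integral {0..real (Suc k) * ?h} (\<lambda>s. b (X s))"
        using le by (intro Henstock_Kurzweil_Integration.integral_combine integrable_continuous_real continuous_on_subset[OF bX]) auto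
      then have Xs: "X (real (Suc k) * ?h) = X (real k * ?h) + integral ?I (\<lambda>s. b (X s)) + (w (real (Suc k) * ?h) - w (real k * ?h))"
        using eq[of "real (Suc k) * ?h"] eq[of "real k * ?h"] le by (simp add: algebra_simps)
      have c: "integral ?I (\<lambda>_. b (?e k)) = ?h *\<^sub>R b (?e k)"
        unfolding integral_const_real content_real[OF le(2)] len ..
      have "X (real (Suc k) * ?h) - ?e (Suc k) = (X (real k * ?h) - ?e k) + integral ?I (\<lambda>s. b (X s) - b (?e k))"
      proof -
        have "integral ?I (\<lambda>s. b (X s) - b (?e k)) = integral ?I (\<lambda>s. b (X s)) - integral ?I (\<lambda>_. b (?e k))"
          using sub by (intro Henstock_Kurzweil_Integration.integral_diff integrable_continuous_real continuous_on_subset[OF bX] continuous_on_const)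
        then show ?thesis unfolding Xs c by simp
      qed
      then have "norm (X (real (Suc k) * ?h) - ?e (Suc k)) \<le> norm (X (real k * ?h) - ?e k) + norm (integral ?I (\<lambda>s. b (X s) - b (?e k)))"
        by (simp only: norm_triangle_ineq)
      also have "norm (integral ?I (\<lambda>s. b (X s) - b (?e k))) \<le> L * (norm (X (real k * ?h) - ?e k) + \<epsilon>') * (real (Suc k) * ?h - real k * ?h)"
      proof (rule integral_bound[OF le(2)])
        show "continuous_on ?I (\<lambda>s. b (X s) - b (?e k))"
          using sub by (intro continuous_on_diff continuous_on_subset[OF bX] continuous_on_const)
        fix s assume s: "s \<in> ?I"
        have "dist s (real k * ?h) \<le> ?h" using s len by (simp only: atLeastAtMost_iff dist_real_def) linarith
        then have "dist (X s) (X (real k * ?h)) < \<epsilon>'"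
          using s sub le h\<eta> by (intro \<eta>(2)) auto
        then have "norm (X s - X (real k * ?h)) \<le> \<epsilon>'" by (simp add: dist_norm)
        then have "norm (X s - ?e k) \<le> norm (X (real k * ?h) - ?e k) + \<epsilon>'"
          using norm_triangle_ineq[of "X s - X (real k * ?h)" "X (real k * ?h) - ?e k"] by simp
        then show "norm (b (X s) - b (?e k)) \<le> L * (norm (X (real k * ?h) - ?e k) + \<epsilon>')"
          using L_pos by (intro order_trans[OF b_lipschitz] mult_left_mono) auto
      qed
      finally have "norm (X (real (Suc k) * ?h) - ?e (Suc k)) \<le> norm (X (real k * ?h) - ?e k) + L * (norm (X (real k * ?h) - ?e k) + \<epsilon>') * ?h"
        unfolding len by simp
      moreover have "u + L * (u + \<epsilon>') * h = (1 + L * h) * u + L * h * \<epsilon>'" for u h by (simp add: algebra_simps)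
      ultimately show "norm (X (real (Suc k) * ?h) - ?e (Suc k)) \<le> (1 + L * ?h) * norm (X (real k * ?h) - ?e k) + L * ?h * \<epsilon>'"
        by (simp only:)
    qed
    also have "\<dots> \<le> (\<Sum>i<N. exp (L * T) * (L * ?h * \<epsilon>'))"
    proof (intro sum_mono mult_right_mono)
      fix i
      have "?h * (real N - 1 - real i) \<le> ?h * real N" using h by (intro mult_left_mono) auto
      then have "L * (?h * (real N - 1 - real i)) \<le> L * T" using L_pos N by (intro mult_left_mono) auto
      then show "exp (L * ?h * (real N - 1 - real i)) \<le> exp (L * T)" by (simp add: mult.assoc)
      show "0 \<le> L * ?h * \<epsilon>'" by (intro mult_nonneg_nonneg less_imp_le[OF L_pos] less_imp_le[OF h] less_imp_le[OF \<epsilon>'])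
    qed
    also have "\<dots> = exp (L * T) * (L * (real N * ?h) * \<epsilon>')" by simp
    also have "\<dots> = \<epsilon>" unfolding hN using L_pos T by (simp add: \<epsilon>'_def)
    finally show "norm (X (real k * ?h) - ?e k) \<le> \<epsilon>" .
  qed
qed

text \<open>The index \<open>N + 2\<close> keeps the ratio at least 2, the range of the finite
  case.\<close>

lemma tendsto_enat_ratios:
  "(\<lambda>N. pred_over_m (enat (N + 2))) \<longlonglongrightarrow> pred_over_m \<infinity>"
  "(\<lambda>N. double_pred_over_m (enat (N + 2))) \<longlonglongrightarrow> double_pred_over_m \<infinity>"
  "(\<lambda>N. m_over_pred (enat (N + 2))) \<longlonglongrightarrow> m_over_pred \<infinity>"
proof -
  have i: "(\<lambda>N. 1 / (real N + c)) \<longlonglongrightarrow> 0" for c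
    using real_tendsto_divide_at_top[OF tendsto_const filterlim_tendsto_add_at_top[OF tendsto_const filterlim_real_sequentially], of 1 c]
    by (simp add: add.commute)
  have "(\<lambda>N. 1 - 1 / (real N + 2)) \<longlonglongrightarrow> 1 - 0" by (intro tendsto_diff tendsto_const i)
  moreover have "pred_over_m (enat (N + 2)) = 1 - 1 / (real N + 2)" for N by (simp add: pred_over_m_def field_simps)
  ultimately show "(\<lambda>N. pred_over_m (enat (N + 2))) \<longlonglongrightarrow> pred_over_m \<infinity>"
    by (simp add: pred_over_m_def[of \<infinity>])
  have "(\<lambda>N. 2 - 1 / (real N + 2)) \<longlonglongrightarrow> 2 - 0" by (intro tendsto_diff tendsto_const i)
  moreover have "double_pred_over_m (enat (N + 2)) = 2 - 1 / (real N + 2)" for N by (simp add: double_pred_over_m_def field_simps)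
  ultimately show "(\<lambda>N. double_pred_over_m (enat (N + 2))) \<longlonglongrightarrow> double_pred_over_m \<infinity>"
    by (simp add: double_pred_over_m_def[of \<infinity>])
  have "(\<lambda>N. 1 + 1 / (real N + 1)) \<longlonglongrightarrow> 1 + 0" by (intro tendsto_add tendsto_const i)
  moreover have "m_over_pred (enat (N + 2)) = 1 + 1 / (real N + 1)" for N by (simp add: m_over_pred_def field_simps)
  ultimately show "(\<lambda>N. m_over_pred (enat (N + 2))) \<longlonglongrightarrow> m_over_pred \<infinity>"
    by (simp add: m_over_pred_def[of \<infinity>])
qed

lemma tendsto_C_AB: "(\<lambda>N. C_AB T L a d (enat (N + 2))) \<longlonglongrightarrow> C_AB T L a d \<infinity>"
  unfolding C_AB_def by (intro tendsto_intros tendsto_enat_ratios)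

lemma tendsto_C_U: "(\<lambda>N. C_U T L a d \<beta> (enat (N + 2)) x) \<longlonglongrightarrow> C_U T L a d \<beta> \<infinity> x"
  unfolding C_U_def by (intro tendsto_intros tendsto_C_AB tendsto_enat_ratios) simp_all

text \<open>\<open>rho_bound\<close> divides by the square of this constant, so its limit in the
  ratio relies on positivity.\<close>

lemma C_AB_pos:
  assumes "0 < T" "0 < L" "0 \<le> a" "0 < d" shows "0 < C_AB T L a d \<infinity>"
proof -
  have "sqrt T \<le> C_A T L"
  proof -
    \<comment> \<open>With one cell the sum in \<open>sum_exp_sqrt_le_C_A\<close> has only the term
      at time 0, which vanishes; this leaves \<open>sqrt T \<le> C_A T L\<close>.\<close>
    have "0 \<le> (\<Sum>i<1. exp (L * (T / real 1) * (real 1 - 1 - real i)) * (L * (T / real 1)) * sqrt (real i * (T / real 1)))"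
      using assms by (intro sum_nonneg) auto
    with sum_exp_sqrt_le_C_A[of T 1 L] assms show ?thesis by simp
  qed
  then have "0 < C_A T L" using assms by (meson less_le_trans real_sqrt_gt_zero)
  then have "0 < C_A T L * L * sqrt (3 * real d * double_pred_over_m \<infinity>)"
    using assms by (simp add: double_pred_over_m_def)
  moreover have "0 \<le> C_B T L a * T powr (3/2) * sqrt (2 * pred_over_m \<infinity>)"
    using assms by (simp add: C_B_def pred_over_m_def)
  ultimately show ?thesis by (simp add: C_AB_def)
qed

lemma tendsto_rho_bound:
  assumes "0 < T" "0 < L" "0 \<le> a" "0 < d"
  shows "(\<lambda>N. rho_bound T L a d (enat (N + 2)) n) \<longlonglongrightarrow> rho_bound T L a d \<infinity> n"
  unfolding rho_bound_def using C_AB_pos[OF assms] assms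
  by (intro tendsto_intros tendsto_C_AB tendsto_enat_ratios) auto

section \<open>Finite and infinite ratio of the step sizes\<close>

context
  fixes M :: "'w measure" and W X :: "real \<Rightarrow> 'w \<Rightarrow> real^'d::finite" and XE :: "nat \<Rightarrow> real \<Rightarrow> 'w \<Rightarrow> real^'d"
    and b :: "real^'d \<Rightarrow> real^'d" and x0 :: "real^'d" and T L a :: real and n :: nat
  assumes T: "0 < T" and bm: "brownian_motion M W" and R1: "R1 b x0 L a" and n: "1 \<le> n"
    and XE: "\<And>N. 1 \<le> N \<Longrightarrow> euler_scheme M W T b x0 N (XE N)"
begin

lemma AE_euler_path:
  assumes N: "1 \<le> N"
  shows "AE \<omega> in M. \<forall>k\<le>N. XE N (real k * (T / real N)) \<omega> = euler_path b x0 (T / real N) (\<lambda>t. W t \<omega>) k"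
proof -
  have "AE \<omega> in M. W 0 \<omega> = 0" using bm by (simp add: brownian_motion_def)
  moreover have "AE \<omega> in M. \<forall>t\<in>{0..T}. (\<lambda>s. b (XE N (eta T N s) \<omega>)) integrable_on {0..t} \<and>
           XE N t \<omega> = x0 + integral {0..t} (\<lambda>s. b (XE N (eta T N s) \<omega>)) + W t \<omega>"
    using XE[OF N] by (auto simp: euler_scheme_def solves_additive_sde_def)
  ultimately show ?thesis
  proof eventually_elim
    case (elim \<omega>)
    show ?case
    proof (intro allI impI)
      fix k assume "k \<le> N"
      then show "XE N (real k * (T / real N)) \<omega> = euler_path b x0 (T / real N) (\<lambda>t. W t \<omega>) k"
        using N T elim by (intro euler_scheme_eq_euler_path[where Y="\<lambda>t. XE N t \<omega>"]) auto
    qed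
  qed
qed

text \<open>Almost surely the given processes coincide at grid times with the recursive schemes;
  coarse time \<open>k\<close> has index \<open>k * m\<close> in the scheme with
  \<open>m * n\<close> steps.\<close>

lemma finite_ratio_theorem:
  assumes m: "2 \<le> m" and \<rho>: "0 \<le> \<rho>" "\<rho> \<le> rho_bound T L a CARD('d) (enat m) n" and x: "0 \<le> x"
  shows "(\<integral>\<^sup>+\<omega>. ennreal (exp (\<rho> * (pred_over_m (enat m) * T\<^sup>2 * x / (2 * real n)
             + (MAX k\<in>{1..n}. norm (XE (m * n) (real k * T / real n) \<omega> - XE n (real k * T / real n) \<omega>)))\<^sup>2)) \<partial>M)
         \<le> ennreal (exp (\<rho> * C_U T L a CARD('d) (norm (b x0)) (enat m) x * (pred_over_m (enat m) * T\<^sup>2 / (real n)\<^sup>2)))"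
proof -
  from R1_imp_drift[OF R1] obtain b' b'' where d: "drift b b' b'' x0 L a" by blast
  interpret euler_bm b b' b'' x0 L a M W T m n
    using d T bm m n by (intro euler_bm.intro euler_bm_axioms.intro) auto
  have "AE \<omega> in M. \<forall>k\<in>{1..n}. XE (m * n) (real k * T / real n) \<omega> = fine_scheme \<omega> (k * m) \<and> XE n (real k * T / real n) \<omega> = coarse_scheme \<omega> k"
  proof -
    have "1 \<le> m * n" using m n by (simp add: Suc_le_eq)
    from AE_euler_path[OF this] AE_euler_path[OF n] show ?thesis
    proof eventually_elim
      case (elim \<omega>)
      show ?case
      proof
        fix k assume k: "k \<in> {1..n}"
        then have "k * m \<le> m * n" by (simp add: mult.commute)
        moreover have "real (k * m) * (T / real (m * n)) = real k * T / real n" using m by simp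
        moreover have "real k * (T / real n) = real k * T / real n" by simp
        ultimately show "XE (m * n) (real k * T / real n) \<omega> = fine_scheme \<omega> (k * m) \<and> XE n (real k * T / real n) \<omega> = coarse_scheme \<omega> k"
          using elim(1)[rule_format, of "k * m"] elim(2)[rule_format, of k] k
          by (simp only: fine_scheme_def coarse_scheme_def atLeastAtMost_iff)
      qed
    qed
  qed
  then have "(\<integral>\<^sup>+\<omega>. ennreal (exp (\<rho> * (pred_over_m (enat m) * T\<^sup>2 * x / (2 * real n)
             + (MAX k\<in>{1..n}. norm (XE (m * n) (real k * T / real n) \<omega> - XE n (real k * T / real n) \<omega>)))\<^sup>2)) \<partial>M)
      = (\<integral>\<^sup>+\<omega>. ennreal (exp (\<rho> * (pred_over_m (enat m) * T\<^sup>2 * x / (2 * real n)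
             + (MAX k\<in>{1..n}. norm (fine_scheme \<omega> (k * m) - coarse_scheme \<omega> k)))\<^sup>2)) \<partial>M)"
  proof (intro nn_integral_cong_AE, eventually_elim)
    case (elim \<omega>)
    then have "(\<lambda>k. norm (XE (m * n) (real k * T / real n) \<omega> - XE n (real k * T / real n) \<omega>)) ` {1..n} = (\<lambda>k. norm (fine_scheme \<omega> (k * m) - coarse_scheme \<omega> k)) ` {1..n}"
      by (intro image_cong refl) simp
    then show ?case by simp
  qed
  then show ?thesis using finite_ratio_bound[OF x \<rho>] by simp
qed

lemma infinite_ratio_theorem:
  assumes sol: "sde_solution M W T b x0 X"
    and \<rho>: "0 \<le> \<rho>" "\<rho> \<le> rho_bound T L a CARD('d) \<infinity> n" and x: "0 \<le> x"
  shows "(\<integral>\<^sup>+\<omega>. ennreal (exp (\<rho> * (pred_over_m \<infinity> * T\<^sup>2 * x / (2 * real n)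
             + (MAX k\<in>{1..n}. norm (X (real k * T / real n) \<omega> - XE n (real k * T / real n) \<omega>)))\<^sup>2)) \<partial>M)
         \<le> ennreal (exp (\<rho> * C_U T L a CARD('d) (norm (b x0)) \<infinity> x * (pred_over_m \<infinity> * T\<^sup>2 / (real n)\<^sup>2)))"
proof -
  from R1_imp_drift[OF R1] obtain b' b'' where d: "drift b b' b'' x0 L a" by blast
  interpret drift b b' b'' x0 L a by (rule d)
  \<comment> \<open>The minimum is admissible at each finite ratio without comparing the bounds for
    different ratios, and it converges to \<open>\<rho>\<close>.\<close>
  define r where "r N = min \<rho> (rho_bound T L a CARD('d) (enat (N + 2)) n)" for N
  have r: "r \<longlonglongrightarrow> \<rho>"
  proof -
    have "r \<longlonglongrightarrow> min \<rho> (rho_bound T L a CARD('d) \<infinity> n)"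
      unfolding r_def[abs_def] using T L_pos a_nonneg by (intro tendsto_min tendsto_const tendsto_rho_bound) auto
    then show ?thesis using \<rho>(2) by (simp add: min_absorb1)
  qed
  have r0: "0 \<le> r N" for N
    using \<rho>(1) by (auto simp: r_def rho_bound_def m_over_pred_def)
  let ?p = "\<lambda>N. pred_over_m (enat (N + 2))" and ?t = "\<lambda>k. real k * T / real n"
  let ?D = "\<lambda>N k \<omega>. norm (XE ((N + 2) * n) (?t k) \<omega> - XE n (?t k) \<omega>)"
  define Z where "Z N \<omega> = exp (r N * (?p N * T\<^sup>2 * x / (2 * real n) + (MAX k\<in>{1..n}. ?D N k \<omega>))\<^sup>2)" for N \<omega>
  have ne: "{1..n} \<noteq> {}" using n by auto
  show ?thesis
  proof (rule nn_integral_exp_limit[of Z])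
    fix N
    have meas: "XE K (?t k) \<in> borel_measurable M" if "1 \<le> K" "k \<in> {1..n}" for K k
    proof -
      have "real k * T \<le> real n * T" using T that by (intro mult_right_mono) auto
      then have "?t k \<in> {0..T}" using T n that by (auto simp: field_simps)
      then show ?thesis using XE[OF that(1)] by (auto simp: euler_scheme_def solves_additive_sde_def)
    qed
    have N2: "1 \<le> (N + 2) * n" using n by (simp add: Suc_le_eq)
    have "(\<lambda>\<omega>. MAX k\<in>{1..n}. ?D N k \<omega>) \<in> borel_measurable M"
    proof (intro borel_measurable_Max)
      fix k assume k: "k \<in> {1..n}"
      note meas[OF N2 k, measurable] meas[OF n k, measurable]
      show "?D N k \<in> borel_measurable M" by measurable
    qed simp
    note this[measurable]
    show "Z N \<in> borel_measurable M" unfolding Z_def by measurable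
    show "(\<integral>\<^sup>+\<omega>. ennreal (Z N \<omega>) \<partial>M) \<le> ennreal (exp (r N * C_U T L a CARD('d) (norm (b x0)) (enat (N + 2)) x * (?p N * T\<^sup>2 / (real n)\<^sup>2)))"
      unfolding Z_def by (rule finite_ratio_theorem[OF _ r0 _ x]) (simp_all add: r_def)
  next
    show "(\<lambda>N. exp (r N * C_U T L a CARD('d) (norm (b x0)) (enat (N + 2)) x * (?p N * T\<^sup>2 / (real n)\<^sup>2)))
       \<longlonglongrightarrow> exp (\<rho> * C_U T L a CARD('d) (norm (b x0)) \<infinity> x * (pred_over_m \<infinity> * T\<^sup>2 / (real n)\<^sup>2))"
      using n by (intro tendsto_intros r tendsto_C_U tendsto_enat_ratios) auto
  next
    have "AE \<omega> in M. W 0 \<omega> = 0" using bm by (simp add: brownian_motion_def)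
    moreover have "AE \<omega> in M. continuous_on {0..T} (\<lambda>t. X t \<omega>) \<and> (\<forall>t\<in>{0..T}. X t \<omega> = x0 + integral {0..t} (\<lambda>s. b (X s \<omega>)) + W t \<omega>)"
    proof -
      from sol have "AE \<omega> in M. continuous_on {0..T} (\<lambda>t. X t \<omega>) \<and>
        (\<forall>t\<in>{0..T}. (\<lambda>s. b (X s \<omega>)) integrable_on {0..t} \<and> X t \<omega> = x0 + integral {0..t} (\<lambda>s. b (X s \<omega>)) + W t \<omega>)"
        by (simp add: sde_solution_def solves_additive_sde_def)
      then show ?thesis by eventually_elim blast
    qed
    moreover have "AE \<omega> in M. \<forall>N. 1 \<le> N \<longrightarrow> (\<forall>k\<le>N. XE N (real k * (T / real N)) \<omega> = euler_path b x0 (T / real N) (\<lambda>t. W t \<omega>) k)"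
      unfolding AE_all_countable
    proof
      fix N show "AE \<omega> in M. 1 \<le> N \<longrightarrow> (\<forall>k\<le>N. XE N (real k * (T / real N)) \<omega> = euler_path b x0 (T / real N) (\<lambda>t. W t \<omega>) k)"
        using AE_euler_path[of N] by (cases "1 \<le> N") auto
    qed
    ultimately show "AE \<omega> in M. (\<lambda>N. Z N \<omega>) \<longlonglongrightarrow> exp (\<rho> * (pred_over_m \<infinity> * T\<^sup>2 * x / (2 * real n)
             + (MAX k\<in>{1..n}. norm (X (?t k) \<omega> - XE n (?t k) \<omega>)))\<^sup>2)"
    proof eventually_elim
      case (elim \<omega>)
      have conv: "(\<lambda>N. XE ((N + 2) * n) (?t k) \<omega>) \<longlonglongrightarrow> X (?t k) \<omega>" if k: "k \<in> {1..n}" for k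
      proof (rule LIMSEQ_I)
        fix e :: real assume "0 < e"
        then obtain N0 where N0: "\<And>N j. N0 \<le> N \<Longrightarrow> 0 < N \<Longrightarrow> j \<le> N \<Longrightarrow> norm (X (real j * (T / real N)) \<omega> - euler_path b x0 (T / real N) (\<lambda>t. W t \<omega>) j) \<le> e / 2"
          using euler_path_converges[OF T, of "\<lambda>t. W t \<omega>" "\<lambda>t. X t \<omega>" "e / 2"] elim(1,2) by auto
        show "\<exists>no. \<forall>N\<ge>no. norm (XE ((N + 2) * n) (?t k) \<omega> - X (?t k) \<omega>) < e"
        proof (intro exI[of _ N0] allI impI)
          fix N assume N: "N0 \<le> N"
          let ?N = "(N + 2) * n" and ?j = "k * (N + 2)"
          have "N * 1 \<le> (N + 2) * n" using n by (intro mult_mono) auto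
          then have N': "N0 \<le> ?N" using N by simp
          have N1: "1 \<le> ?N" using n by (simp add: Suc_le_eq)
          have j: "?j \<le> ?N" unfolding mult.commute[of "N + 2"] using k by (intro mult_right_mono) auto
          have t: "real ?j * (T / real ?N) = ?t k"
          proof -
            have "w \<noteq> 0 \<Longrightarrow> real k * w * (T / (w * real n)) = ?t k" for w :: real by simp
            from this[of "real (N + 2)"] show ?thesis by (simp only: of_nat_mult)
          qed
          have "XE ?N (?t k) \<omega> = euler_path b x0 (T / real ?N) (\<lambda>t. W t \<omega>) ?j"
            using elim(3)[rule_format, OF N1 j] unfolding t .
          moreover have "norm (X (?t k) \<omega> - euler_path b x0 (T / real ?N) (\<lambda>t. W t \<omega>) ?j) \<le> e / 2"
            using N0[OF N' less_le_trans[OF zero_less_one N1] j] unfolding t .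
          ultimately show "norm (XE ?N (?t k) \<omega> - X (?t k) \<omega>) < e"
            using \<open>0 < e\<close> by (simp add: norm_minus_commute)
        qed
      qed
      show ?case
        unfolding Z_def using n ne
        by (intro tendsto_exp tendsto_mult tendsto_power tendsto_add tendsto_divide tendsto_const r tendsto_enat_ratios
              tendsto_MAX tendsto_norm tendsto_diff conv) auto
    qed
  qed
qed

end

theorem theorem3p1:
  fixes M :: "'w measure"
    and W X :: "real \<Rightarrow> 'w \<Rightarrow> real^'d::finite"
    and XE :: "nat \<Rightarrow> real \<Rightarrow> 'w \<Rightarrow> real^'d"
    and b :: "real^'d \<Rightarrow> real^'d"
    and x0 :: "real^'d"
    and T L a \<rho> x :: real
    and n :: nat
    and m :: enat
  assumes "0 < T"
    and "brownian_motion M W"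
    and "R1 b x0 L a"
    and "sde_solution M W T b x0 X"
    and "\<And>N. 1 \<le> N \<Longrightarrow> euler_scheme M W T b x0 N (XE N)"
    and "1 \<le> n"
    and "1 \<le> m"
    and "0 \<le> \<rho>"
    and "m \<noteq> 1 \<Longrightarrow> \<rho> \<le> rho_bound T L a CARD('d) m n"
    and "0 \<le> x"
  shows "(\<integral>\<^sup>+\<omega>. ennreal (exp (\<rho> *
            (pred_over_m m * T\<^sup>2 * x / (2 * real n)
             + (MAX k\<in>{1..n}. norm (fine_process X XE m n (real k * T / real n) \<omega>
                                     - XE n (real k * T / real n) \<omega>)))\<^sup>2)) \<partial>M)
         \<le> ennreal (exp (\<rho> * C_U T L a CARD('d) (norm (b x0)) m x
                          * (pred_over_m m * T\<^sup>2 / (real n)\<^sup>2)))"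
proof (cases m)
  case (enat k)
  show ?thesis
  proof (cases "k = 1")
    \<comment> \<open>Here the two processes coincide and \<open>pred_over_m\<close> is 0, so both
      sides equal 1.\<close>
    case True
    interpret prob_space M using assms(2) by (simp add: brownian_motion_def)
    have "{1..n} \<noteq> {}" using assms(6) by auto
    then show ?thesis
      by (simp add: enat True pred_over_m_def fine_process_def emeasure_space_1)
  next
    case False
    then have "2 \<le> k" "m \<noteq> 1" using assms(7) by (auto simp: enat one_enat_def)
    then show ?thesis
      using finite_ratio_theorem[OF assms(1-3,6,5) \<open>2 \<le> k\<close> assms(8) _ assms(10)] assms(9)
      by (simp add: enat fine_process_def)
  qed
next
  case infinity
  then show ?thesis
    using infinite_ratio_theorem[OF assms(1-3,6,5,4,8) _ assms(10)] assms(9)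
    by (simp add: fine_process_def)
qed

end
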